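(* Let $q$ be a power of an odd prime, $k\ge1$ an integer and $0<\epsilon<1$. For nonnegative integers $n,n_1,n_2$ define $$M_k(q;n,n_1,n_2):=\frac{1}{|\widehat{\mathcal{F}}_{[n,n_1,n_2]}|}\sum_{(f,f_1,f_2)\in\widehat{\mathcal{F}}_{[n,n_1,n_2]}}\left(\frac{\mathrm{Tr}(\mathrm{Frob}_{C_{(f,f_1,f_2)}})}{\sqrt{1+q}}\right)^k,$$ where $C_{(f,f_1,f_2)}$ is the biquadratic curve with affine model $y_1^2=ff_1(t)$, $y_2^2=ff_2(t)$, so that $\mathrm{Tr}(\mathrm{Frob}_{C_{(f,f_1,f_2)}})=-\widehat{S}(f,f_1,f_2)$. Then $$M_k(q;n,n_1,n_2)=\mathbb{E}\left(\left(-\frac{1}{\sqrt{1+q}}\sum_{i=1}^{q+1}X_i\right)^k\right)+O\big(q^{-\frac{1-\epsilon}{2}\min(n,n_1,n_2)+k}\big),$$ where $X_1,\dots,X_{q+1}$ are i.i.d. random variables taking the value $-1$ with probability $\frac{3(q+2)}{4(q+3)}$, the value $1$ with probability $\frac{6}{4(q+3)}$, and the value $3$ with probability $\frac{q}{4(q+3)}$.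
   Context: $\mathcal{F}_d$ (resp. $\widehat{\mathcal{F}}_d$) is the set of monic (resp. arbitrary) square-free polynomials of degree $d$ in $\mathbb{F}_q[t]$. $\widehat{\mathcal{F}}_{(n,n_1,n_2)}=\{(f,f_1,f_2)\in\mathcal{F}_n\times\widehat{\mathcal{F}}_{n_1}\times\widehat{\mathcal{F}}_{n_2}: f,f_1,f_2\text{ pairwise coprime}\}$ and $\widehat{\mathcal{F}}_{[n,n_1,n_2]}=\widehat{\mathcal{F}}_{(n,n_1,n_2)}\cup\widehat{\mathcal{F}}_{(n-1,n_1,n_2)}\cup\widehat{\mathcal{F}}_{(n,n_1-1,n_2)}\cup\widehat{\mathcal{F}}_{(n,n_1,n_2-1)}$. With $\chi$ the quadratic character of $\mathbb{F}_q^*$, $\chi(0)=0$, and $\chi(F(\infty))$ equal to $0$ if $\deg F$ is odd and to $\pm1$ according as the leading coefficient of $F$ is a square or not if $\deg F$ is even, $\widehat{S}(f,f_1,f_2)=\sum_{x\in\mathbb{P}^1(\mathbb{F}_q)}(\chi(ff_1(x))+\chi(ff_2(x))+\chi(f_1f_2(x)))$, and $\#C_{(f,f_1,f_2)}(\mathbb{F}_q)=q+1+\widehat S(f,f_1,f_2)$. (The paper defines $M_k$ as the average, over the moduli space of biquadratic curves whose three hyperelliptic quotients have given genera, counted with weights $1/|\mathrm{Aut}(C)|$; by the paper this equals the uniform average over $\widehat{\mathcal{F}}_{[n,n_1,n_2]}$ used here.)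
   Formalization: The formal theorem assumes n, n_1, n_2 all have the same parity (as the genera of the three quotients force); for mixed parity the claim fails already for k=2, because of the point at infinity. The O-constant depends only on k and ε. *)

theory Defs
  imports "HOL-Probability.Probability" "HOL-Probability.Product_PMF"
    "HOL-Algebra.Polynomial_Divisibility"
begin

text \<open>
  The finite field \<open>\<bbbF>\<^sub>q\<close> is a structure \<open>R\<close> with a finite carrier rather than a type, so that a
  constant can be chosen uniformly in \<open>q\<close>. Elements of \<open>\<bbbF>\<^sub>q[t]\<close> are elements of
  \<^term>\<open>carrier (poly_ring R)\<close>: coefficient lists, leading coefficient first, with \<open>[]\<close> for zero.
\<close>

definition squarefree_in :: "('a, 'b) ring_scheme \<Rightarrow> 'a \<Rightarrow> bool" where
  "squarefree_in P a \<longleftrightarrow> (\<forall>g\<in>carrier P. (g [^]\<^bsub>P\<^esub> (2::nat)) divides\<^bsub>P\<^esub> a \<longrightarrow> g \<in> Units P)"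

definition coprime_in :: "('a, 'b) ring_scheme \<Rightarrow> 'a \<Rightarrow> 'a \<Rightarrow> bool" where
  "coprime_in P a b \<longleftrightarrow>
     (\<forall>g\<in>carrier P. g divides\<^bsub>P\<^esub> a \<longrightarrow> g divides\<^bsub>P\<^esub> b \<longrightarrow> g \<in> Units P)"

text \<open>
  Degrees are integers in the next four definitions, so that a family with prescribed degree
  \<open>-1\<close> is empty.
\<close>

definition sqfree_polys :: "('a, 'b) ring_scheme \<Rightarrow> int \<Rightarrow> 'a list set" where
  "sqfree_polys R d =
     {f \<in> carrier (poly_ring R) - {\<zero>\<^bsub>poly_ring R\<^esub>}.
        int (Polynomials.degree f) = d \<and> squarefree_in (poly_ring R) f}"

definition monic_sqfree_polys :: "('a, 'b) ring_scheme \<Rightarrow> int \<Rightarrow> 'a list set" where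
  "monic_sqfree_polys R d = {f \<in> sqfree_polys R d. Polynomials.lead_coeff f = \<one>\<^bsub>R\<^esub>}"

definition coprime_triples ::
    "('a, 'b) ring_scheme \<Rightarrow> int \<Rightarrow> int \<Rightarrow> int \<Rightarrow> ('a list \<times> 'a list \<times> 'a list) set" where
  "coprime_triples R n n1 n2 =
     {(f, f1, f2). f \<in> monic_sqfree_polys R n \<and> f1 \<in> sqfree_polys R n1 \<and> f2 \<in> sqfree_polys R n2
        \<and> coprime_in (poly_ring R) f f1 \<and> coprime_in (poly_ring R) f f2
        \<and> coprime_in (poly_ring R) f1 f2}"

definition biquadratic_family ::
    "('a, 'b) ring_scheme \<Rightarrow> int \<Rightarrow> int \<Rightarrow> int \<Rightarrow> ('a list \<times> 'a list \<times> 'a list) set" where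
  "biquadratic_family R n n1 n2 =
     coprime_triples R n n1 n2 \<union> coprime_triples R (n - 1) n1 n2
     \<union> coprime_triples R n (n1 - 1) n2 \<union> coprime_triples R n n1 (n2 - 1)"

definition quadratic_char :: "('a, 'b) ring_scheme \<Rightarrow> 'a \<Rightarrow> int" where
  "quadratic_char R a =
     (if a = \<zero>\<^bsub>R\<^esub> then 0 else if \<exists>b\<in>carrier R. a = b \<otimes>\<^bsub>R\<^esub> b then 1 else - 1)"

text \<open>The points of \<open>\<bbbP>\<^sup>1(\<bbbF>\<^sub>q)\<close>; \<^term>\<open>None\<close> is the point at infinity.\<close>

definition proj_line :: "('a, 'b) ring_scheme \<Rightarrow> 'a option set" where
  "proj_line R = insert None (Some ` carrier R)"

definition quadratic_char_at :: "('a, 'b) ring_scheme \<Rightarrow> 'a list \<Rightarrow> 'a option \<Rightarrow> int" where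
  "quadratic_char_at R F x =
     (case x of
        Some a \<Rightarrow> quadratic_char R (ring.eval R F a)
      | None \<Rightarrow> if odd (Polynomials.degree F) then 0
                else quadratic_char R (Polynomials.lead_coeff F))"

definition S_hat :: "('a, 'b) ring_scheme \<Rightarrow> 'a list \<Rightarrow> 'a list \<Rightarrow> 'a list \<Rightarrow> int" where
  "S_hat R f f1 f2 =
     (\<Sum>x\<in>proj_line R.
        quadratic_char_at R (f \<otimes>\<^bsub>poly_ring R\<^esub> f1) x
        + quadratic_char_at R (f \<otimes>\<^bsub>poly_ring R\<^esub> f2) x
        + quadratic_char_at R (f1 \<otimes>\<^bsub>poly_ring R\<^esub> f2) x)"

text \<open>
  The number of \<open>\<bbbF>\<^sub>q\<close>-points of the smooth projective model \<open>C\<close> of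
  \<open>y\<^sub>1\<^sup>2 = f f\<^sub>1(t), y\<^sub>2\<^sup>2 = f f\<^sub>2(t)\<close>, given by its character-sum formula, and the trace of Frobenius on
  the first cohomology, \<open>q + 1 - #C(\<bbbF>\<^sub>q)\<close>.
\<close>

definition curve_points :: "('a, 'b) ring_scheme \<Rightarrow> 'a list \<Rightarrow> 'a list \<Rightarrow> 'a list \<Rightarrow> int" where
  "curve_points R f f1 f2 = int (card (carrier R)) + 1 + S_hat R f f1 f2"

definition frob_trace :: "('a, 'b) ring_scheme \<Rightarrow> 'a list \<Rightarrow> 'a list \<Rightarrow> 'a list \<Rightarrow> int" where
  "frob_trace R f f1 f2 = int (card (carrier R)) + 1 - curve_points R f f1 f2"

lemma frob_trace_eq: "frob_trace R f f1 f2 = - S_hat R f f1 f2"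
  by (simp add: frob_trace_def curve_points_def)

definition trace_moment :: "nat \<Rightarrow> ('a, 'b) ring_scheme \<Rightarrow> nat \<Rightarrow> nat \<Rightarrow> nat \<Rightarrow> real" where
  "trace_moment k R n n1 n2 =
     (1 / real (card (biquadratic_family R (int n) (int n1) (int n2)))) *
     (\<Sum>(f, f1, f2)\<in>biquadratic_family R (int n) (int n1) (int n2).
        (real_of_int (frob_trace R f f1 f2) / sqrt (1 + real (card (carrier R)))) ^ k)"

definition point_pmf :: "nat \<Rightarrow> real pmf" where
  "point_pmf q = pmf_of_list
     [(- 1, 3 * (real q + 2) / (4 * (real q + 3))),
      (1, 6 / (4 * (real q + 3))),
      (3, real q / (4 * (real q + 3)))]"

lemma pmf_point_pmf:
  "pmf (point_pmf q) (- 1) = 3 * (real q + 2) / (4 * (real q + 3))"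
  "pmf (point_pmf q) 1 = 6 / (4 * (real q + 3))"
  "pmf (point_pmf q) 3 = real q / (4 * (real q + 3))"
proof -
  have "pmf_of_list_wf
     [(- 1 :: real, 3 * (real q + 2) / (4 * (real q + 3))),
      (1, 6 / (4 * (real q + 3))),
      (3, real q / (4 * (real q + 3)))]"
  proof (rule pmf_of_list_wfI)
    have "4 * (real q + 3) \<noteq> 0"
      by (simp add: add_eq_0_iff)
    moreover have "3 * (real q + 2) + (6 + real q) = 4 * (real q + 3)"
      by simp
    ultimately show "sum_list (map snd
     [(- 1 :: real, 3 * (real q + 2) / (4 * (real q + 3))),
      (1, 6 / (4 * (real q + 3))),
      (3, real q / (4 * (real q + 3)))]) = 1"
      by (simp only: list.map snd_conv sum_list.Cons sum_list.Nil add_0_right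
            add_divide_distrib[symmetric] divide_self not_False_eq_True)
  qed auto
  note * = pmf_pmf_of_list[OF this]
  show "pmf (point_pmf q) (- 1) = 3 * (real q + 2) / (4 * (real q + 3))"
    "pmf (point_pmf q) 1 = 6 / (4 * (real q + 3))"
    "pmf (point_pmf q) 3 = real q / (4 * (real q + 3))"
    unfolding point_pmf_def * by simp_all
qed

lemma finite_biquadratic_family:
  assumes "finite (carrier R)"
  shows "finite (biquadratic_family R n n1 n2)"
proof -
  have fin: "finite (sqfree_polys R d)" for d
  proof (rule finite_subset)
    show "sqfree_polys R d \<subseteq> {xs. set xs \<subseteq> carrier R \<and> length xs \<le> nat d + 1}"
      by (auto simp: sqfree_polys_def univ_poly_carrier[symmetric] univ_poly_zero polynomial_def)
    show "finite {xs. set xs \<subseteq> carrier R \<and> length xs \<le> nat d + 1}"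
      using assms by (rule finite_lists_length_le)
  qed
  have "coprime_triples R d d1 d2 \<subseteq> sqfree_polys R d \<times> sqfree_polys R d1 \<times> sqfree_polys R d2"
    for d d1 d2
    by (auto simp: coprime_triples_def monic_sqfree_polys_def)
  then have "finite (coprime_triples R d d1 d2)" for d d1 d2
    by (rule finite_subset) (intro finite_cartesian_product fin)
  then show ?thesis
    by (simp add: biquadratic_family_def)
qed

end

theory Submission
  imports Defs "HOL-Real_Asymp.Real_Asymp"
begin

text \<open>
  Write \<open>f\<^sub>1 = \<alpha> g\<close> and \<open>f\<^sub>2 = \<beta> h\<close> with \<open>g, h\<close> monic. A triple lies in the family iff \<open>f g h\<close> is
  squarefree, which is detected by \<open>\<Sum> \<mu>(E)\<close> over the monic \<open>E\<close> with \<open>E\<^sup>2\<close> dividing \<open>f g h\<close>. For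
  \<open>2 deg E + r \<le> min (n, n\<^sub>1, n\<^sub>2)\<close> the residues of \<open>f, g, h\<close> modulo \<open>E\<^sup>2\<close> together with their values at
  \<open>r\<close> points are exactly equidistributed, and the \<open>E\<close> of degree \<open>j\<close> altogether contribute a proportion of
  at most \<open>(j + 1)\<^sup>6 q\<^bsup>-j\<^esup>\<close>. So counting with weights at \<open>r\<close> points has relative error
  \<open>O (q\<^bsup>-(1-\<epsilon>)(min-r)/2\<^esup>)\<close>. Splitting off \<open>t - x\<close> according to which of \<open>f, g, h\<close> vanishes at \<open>x\<close>
  produces the law of the variables \<open>X\<^sub>i\<close>, and the three families of lowered degree do the same at infinity.

  The main terms share the density of squarefree triples as a common factor, which cancels against
  the size of the family. It is bounded below uniformly in \<open>q\<close>, because every triple is a squarefree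
  triple multiplied by squares and by common factors of pairs. Expanding the \<open>k\<close>-th power over
  \<open>k\<close>-tuples of points costs \<open>(q + 1)\<^bsup>k/2\<^esup>\<close>, and \<open>r \<le> k\<close> points cost \<open>q\<^bsup>k/2\<^esup>\<close>, hence the exponent \<open>k\<close>.
\<close>

section \<open>Monic polynomials as a factorial monoid\<close>

text \<open>The constant must serve all fields at once, and this dictates how \<epsilon> is spent. A
  tail term (j + 1)^6 q^(-j) is split as q^(-\<epsilon> j) times q^(-(1 - \<epsilon>) j): since q is
  at least 3, the first factor leaves a convergent sum that depends on \<epsilon> alone, and the
  second, for 2 j beyond the range of equidistribution, is the error term. The sixth power counts
  the ways to distribute j over six degrees.

  Residues modulo E^2 and values at given points are independent only if E vanishes at none of the
  points. Vanishing is therefore split off before the Moebius sum is formed, and the density that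
  results, \<open>dens T\<close>, runs over the E prime to the points \<open>T\<close>, so it
  depends on \<open>T\<close>. It is never evaluated: the size of the family is expanded over the
  same \<open>T\<close> with all exponents zero, and then \<open>dens T\<close> is literally the
  same factor in numerator and denominator. A lower bound is required for the size of the family
  alone. Where the error term is too large to leave such a bound, the claim is trivial, since after
  division by 3 all local contributions have absolute value at most 1.\<close>

text \<open>
  The intended model consists of the monic polynomials over \<open>\<bbbF>\<^sub>q\<close>: \<open>Pts\<close> is \<open>\<bbbF>\<^sub>q\<close>, \<open>lin x\<close> is \<open>t - x\<close>,
  \<open>chi f x\<close> is the quadratic character of \<open>f x\<close>, and \<open>rho E\<close> is the density of the triples \<open>(f, g, h)\<close>
  for which \<open>E\<^sup>2\<close> divides \<open>f g h\<close>.
\<close>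


locale monic_monoid = comm_monoid_cancel G for G :: "('m, 'g) monoid_scheme" (structure) +
  fixes q :: nat and deg :: "'m \<Rightarrow> nat" and Pts :: "'x set" and lin :: "'x \<Rightarrow> 'm"
    and chi :: "'m \<Rightarrow> 'x \<Rightarrow> real" and rho :: "'m \<Rightarrow> real"
  assumes q_ge_3: "q \<ge> 3"
    and deg_mult: "\<lbrakk>a \<in> carrier G; b \<in> carrier G\<rbrakk> \<Longrightarrow> deg (a \<otimes> b) = deg a + deg b"
    and deg_0: "\<lbrakk>a \<in> carrier G; deg a = 0\<rbrakk> \<Longrightarrow> a = \<one>"
    and card_deg: "card {a \<in> carrier G. deg a = n} = q ^ n"
    and irreducible_imp_prime: "\<lbrakk>p \<in> carrier G; p \<noteq> \<one>;
      \<And>a b. \<lbrakk>a \<in> carrier G; b \<in> carrier G; p = a \<otimes> b\<rbrakk> \<Longrightarrow> a = \<one> \<or> b = \<one>;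
      a \<in> carrier G; b \<in> carrier G; p divides a \<otimes> b\<rbrakk> \<Longrightarrow> p divides a \<or> p divides b"
    and finite_Pts: "finite Pts"
    and lin_closed: "x \<in> Pts \<Longrightarrow> lin x \<in> carrier G"
    and deg_lin: "x \<in> Pts \<Longrightarrow> deg (lin x) = 1"
    and chi_mult: "\<lbrakk>a \<in> carrier G; b \<in> carrier G; x \<in> Pts\<rbrakk> \<Longrightarrow> chi (a \<otimes> b) x = chi a x * chi b x"
    and chi_values: "\<lbrakk>a \<in> carrier G; x \<in> Pts\<rbrakk> \<Longrightarrow> chi a x \<in> {-1, 0, 1}"
    and chi_eq_0_iff: "\<lbrakk>a \<in> carrier G; x \<in> Pts\<rbrakk> \<Longrightarrow> chi a x = 0 \<longleftrightarrow> lin x divides a"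
    and chi_lin: "\<lbrakk>x \<in> Pts; y \<in> Pts; x \<noteq> y\<rbrakk> \<Longrightarrow> chi (lin x) y \<noteq> 0"
    and equidistribution: "\<lbrakk>E \<in> carrier G; U \<subseteq> Pts; \<And>x. x \<in> U \<Longrightarrow> chi E x \<noteq> 0;
      \<And>x. x \<in> U \<Longrightarrow> s x \<in> {1, -1} \<times> {1, -1} \<times> {1, -1};
      n1 \<ge> 2 * deg E + card U; n2 \<ge> 2 * deg E + card U; n3 \<ge> 2 * deg E + card U\<rbrakk> \<Longrightarrow>
      real (card {(f, g, h). f \<in> carrier G \<and> g \<in> carrier G \<and> h \<in> carrier G
        \<and> deg f = n1 \<and> deg g = n2 \<and> deg h = n3 \<and> E \<otimes> E divides f \<otimes> g \<otimes> h
        \<and> (\<forall>x\<in>U. (chi f x, chi g x, chi h x) = s x)})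
      = rho E * real q ^ (n1 + n2 + n3) * ((real q - 1) / (2 * real q)) ^ (3 * card U)"
begin

section \<open>Divisibility, prime elements and squarefree elements\<close>

lemma deg_one: "deg \<one> = 0"
  using deg_mult[of \<one> \<one>] by simp

lemma finite_deg: "finite {a \<in> carrier G. deg a = n}"
  using card_deg[of n] q_ge_3 by (intro card_ge_0_finite) simp

lemma finite_deg_le: "finite {a \<in> carrier G. deg a \<le> n}"
proof -
  have "{a \<in> carrier G. deg a \<le> n} = (\<Union>i\<le>n. {a \<in> carrier G. deg a = i})" by auto
  then show ?thesis using finite_deg by simp
qed

lemma dividesE':
  assumes "a divides b" obtains c where "c \<in> carrier G" "b = a \<otimes> c"
  using assms unfolding factor_def by blast

lemma dividesI': "c \<in> carrier G \<Longrightarrow> b = a \<otimes> c \<Longrightarrow> a divides b"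
  unfolding factor_def by blast

lemma mult_eq_one: "\<lbrakk>a \<in> carrier G; b \<in> carrier G; a \<otimes> b = \<one>\<rbrakk> \<Longrightarrow> a = \<one> \<and> b = \<one>"
  using deg_mult[of a b] deg_one deg_0[of a] deg_0[of b] by simp

lemma deg_divides: "\<lbrakk>a \<in> carrier G; b \<in> carrier G; a divides b\<rbrakk> \<Longrightarrow> deg a \<le> deg b"
  by (elim dividesE') (auto simp: deg_mult)

text \<open>Irreducibility in form; \<open>irreducible_imp_prime\<close> makes such elements prime.
  Since \<open>deg_0\<close> and \<open>mult_eq_one\<close> leave \<open>\<one>\<close> as the only
  unit, associates coincide.\<close>

definition prime_elt :: "'m \<Rightarrow> bool" where
  "prime_elt p \<longleftrightarrow> p \<in> carrier G \<and> p \<noteq> \<one> \<and>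
     (\<forall>a\<in>carrier G. \<forall>b\<in>carrier G. p = a \<otimes> b \<longrightarrow> a = \<one> \<or> b = \<one>)"

lemma prime_elt_closed: "prime_elt p \<Longrightarrow> p \<in> carrier G"
  by (simp add: prime_elt_def)

lemma prime_elt_dvd_mult_iff:
  assumes "prime_elt p" "a \<in> carrier G" "b \<in> carrier G"
  shows "p divides a \<otimes> b \<longleftrightarrow> p divides a \<or> p divides b"
proof
  show "p divides a \<otimes> b \<Longrightarrow> p divides a \<or> p divides b"
    using assms irreducible_imp_prime[of p a b] unfolding prime_elt_def by blast
  show "p divides a \<or> p divides b \<Longrightarrow> p divides a \<otimes> b"
    using assms by (auto simp: prime_elt_def divides_prod_r divides_prod_l)
qed

lemma prime_elt_dvd_prime_elt:
  assumes "prime_elt p" "prime_elt r" "p divides r" shows "p = r"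
proof -
  obtain c where c: "c \<in> carrier G" "r = p \<otimes> c" using assms by (elim dividesE')
  then have "c = \<one>" using assms unfolding prime_elt_def by blast
  then show ?thesis using c assms prime_elt_closed by simp
qed

lemma exists_prime_elt:
  "a \<in> carrier G \<Longrightarrow> a \<noteq> \<one> \<Longrightarrow> \<exists>p. prime_elt p \<and> p divides a"
proof (induction "deg a" arbitrary: a rule: less_induct)
  case less
  show ?case
  proof (cases "prime_elt a")
    case True
    then show ?thesis using less.prems by (auto intro: divides_refl)
  next
    case False
    then obtain b c where bc: "b \<in> carrier G" "c \<in> carrier G" "a = b \<otimes> c" "b \<noteq> \<one>" "c \<noteq> \<one>"
      using less.prems by (auto simp: prime_elt_def)
    have "deg c \<noteq> 0" using bc deg_0 by blast
    then have "deg b < deg a" using bc by (simp add: deg_mult)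
    from less.hyps[OF this] bc obtain p where "prime_elt p" "p divides b" by blast
    then show ?thesis using bc prime_elt_closed by (auto intro: divides_prod_r)
  qed
qed

definition sqfree :: "'m \<Rightarrow> bool" where
  "sqfree F \<longleftrightarrow> (\<forall>g\<in>carrier G. g \<otimes> g divides F \<longrightarrow> g = \<one>)"

lemma sqfree_iff_prime_elt:
  assumes "F \<in> carrier G"
  shows "sqfree F \<longleftrightarrow> (\<forall>p. prime_elt p \<longrightarrow> \<not> p \<otimes> p divides F)"
proof
  assume "sqfree F"
  then show "\<forall>p. prime_elt p \<longrightarrow> \<not> p \<otimes> p divides F"
    by (auto simp: sqfree_def prime_elt_def)
next
  assume *: "\<forall>p. prime_elt p \<longrightarrow> \<not> p \<otimes> p divides F"
  show "sqfree F" unfolding sqfree_def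
  proof (intro ballI impI)
    fix g assume g: "g \<in> carrier G" "g \<otimes> g divides F"
    show "g = \<one>"
    proof (rule ccontr)
      assume "g \<noteq> \<one>"
      then obtain p where p: "prime_elt p" "p divides g" using exists_prime_elt g by blast
      obtain c where c: "c \<in> carrier G" "g = p \<otimes> c" using p by (elim dividesE')
      have "p \<otimes> p divides g \<otimes> g"
        using c p prime_elt_closed by (intro dividesI'[of "c \<otimes> c"]) (auto simp: m_ac)
      then have "p \<otimes> p divides F" using g assms p prime_elt_closed
        by (meson divides_trans m_closed)
      then show False using * p by blast
    qed
  qed
qed

lemma sqfree_divides:
  assumes "sqfree F" "a \<in> carrier G" "F \<in> carrier G" "a divides F"
  shows "sqfree a"
  unfolding sqfree_def
proof (intro ballI impI)
  fix g assume g: "g \<in> carrier G" "g \<otimes> g divides a"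
  then have "g \<otimes> g divides F" using assms divides_trans[of "g \<otimes> g" a F] by simp
  then show "g = \<one>" using assms g unfolding sqfree_def by blast
qed

text \<open>Serves two purposes: the sign rule for \<open>moebius\<close>, and, with p = t - x, the
  passage in \<open>bij_betw_lin_factor\<close> from a squarefree product vanishing at x to a
  smaller one that does not vanish there.\<close>

lemma sqfree_prime_elt_mult_iff:
  assumes p: "prime_elt p" and E: "E \<in> carrier G"
  shows "sqfree (p \<otimes> E) \<longleftrightarrow> sqfree E \<and> \<not> p divides E"
proof
  have pc: "p \<in> carrier G" using p prime_elt_closed by blast
  assume *: "sqfree (p \<otimes> E)"
  have "\<not> p divides E"
  proof
    assume "p divides E"
    then obtain c where "c \<in> carrier G" "E = p \<otimes> c" by (elim dividesE')
    then have "p \<otimes> p divides p \<otimes> E" using pc by (intro dividesI'[of c]) (auto simp: m_ac)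
    then show False using * pc p by (auto simp: sqfree_def prime_elt_def)
  qed
  moreover have "sqfree E"
    by (rule sqfree_divides[OF *]) (use E pc in \<open>auto intro: divides_prod_l divides_refl\<close>)
  ultimately show "sqfree E \<and> \<not> p divides E" by blast
next
  have pc: "p \<in> carrier G" using p prime_elt_closed by blast
  assume *: "sqfree E \<and> \<not> p divides E"
  show "sqfree (p \<otimes> E)"
    unfolding sqfree_iff_prime_elt[OF m_closed[OF pc E]]
  proof (intro allI impI notI)
    fix r assume r: "prime_elt r" "r \<otimes> r divides p \<otimes> E"
    have rc: "r \<in> carrier G" using r prime_elt_closed by blast
    obtain c where c: "c \<in> carrier G" "p \<otimes> E = r \<otimes> r \<otimes> c" using r by (elim dividesE')
    show False
    proof (cases "r = p")
      case True
      then have "E = p \<otimes> c" using c pc E m_assoc[of p p c] l_cancel[of p E "p \<otimes> c"] by simp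
      then show False using * c by (auto simp: factor_def)
    next
      case False
      have "p divides (r \<otimes> r) \<otimes> c" using c E by (intro dividesI'[of E]) auto
      moreover have "\<not> p divides r" using prime_elt_dvd_prime_elt p r False by blast
      ultimately have "p divides c" using p rc c by (simp add: prime_elt_dvd_mult_iff)
      then obtain d where d: "d \<in> carrier G" "c = p \<otimes> d" by (elim dividesE')
      have "p \<otimes> E = p \<otimes> (r \<otimes> r \<otimes> d)" using c d pc rc by (simp add: m_ac)
      then have "E = r \<otimes> r \<otimes> d" using pc rc d E l_cancel by simp
      then have "r \<otimes> r divides E" using d by (auto simp: factor_def)
      then show False using * r E by (auto simp: sqfree_iff_prime_elt)
    qed
  qed
qed

section \<open>The Moebius function and square divisors\<close>

definition moebius :: "'m \<Rightarrow> real" where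
  "moebius E = (if sqfree E then (-1) ^ card {p. prime_elt p \<and> p divides E} else 0)"

lemma abs_moebius_le: "\<bar>moebius E\<bar> \<le> 1"
  by (simp add: moebius_def power_abs)

lemma moebius_prime_elt_mult:
  assumes p: "prime_elt p" and E: "E \<in> carrier G" and "\<not> p divides E"
  shows "moebius (p \<otimes> E) = - moebius E"
proof -
  have pc: "p \<in> carrier G" using p prime_elt_closed by blast
  have eq: "{r. prime_elt r \<and> r divides p \<otimes> E} = insert p {r. prime_elt r \<and> r divides E}"
    using p E pc prime_elt_dvd_prime_elt[OF _ p] by (auto simp: prime_elt_dvd_mult_iff divides_refl)
  have "finite {r. prime_elt r \<and> r divides E}"
    by (rule finite_subset[OF _ finite_deg_le[of "deg E"]]) (use E prime_elt_closed deg_divides in auto)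
  then have "card {r. prime_elt r \<and> r divides p \<otimes> E} = Suc (card {r. prime_elt r \<and> r divides E})"
    unfolding eq using assms by (subst card_insert_disjoint) auto
  then show ?thesis
    using assms by (simp add: moebius_def sqfree_prime_elt_mult_iff)
qed

lemma divides_one_iff: "a \<in> carrier G \<Longrightarrow> a divides \<one> \<longleftrightarrow> a = \<one>"
  using mult_eq_one[of a] unfolding factor_def by (metis one_closed r_one)

lemma finite_square_divisors:
  assumes "F \<in> carrier G"
  shows "finite {E \<in> carrier G. E \<otimes> E divides F}"
proof (rule finite_subset[OF _ finite_deg_le[of "deg F"]])
  show "{E \<in> carrier G. E \<otimes> E divides F} \<subseteq> {a \<in> carrier G. deg a \<le> deg F}"
    using assms deg_divides[of _ F] deg_mult by fastforce
qed

lemma sum_moebius_square_divisors: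
  assumes F: "F \<in> carrier G"
  shows "(\<Sum>E\<in>{E \<in> carrier G. E \<otimes> E divides F}. moebius E) = of_bool (sqfree F)"
proof (cases "sqfree F")
  case True
  have one: "moebius \<one> = 1"
  proof -
    have "{p. prime_elt p \<and> p divides \<one>} = {}"
      using divides_one_iff by (auto simp: prime_elt_def)
    moreover have "sqfree \<one>"
      unfolding sqfree_def using divides_one_iff mult_eq_one by (metis m_closed)
    ultimately show ?thesis unfolding moebius_def by (simp only: if_True card.empty power_0)
  qed
  have "{E \<in> carrier G. E \<otimes> E divides F} = {\<one>}"
  proof
    show "{E \<in> carrier G. E \<otimes> E divides F} \<subseteq> {\<one>}"
      using True unfolding sqfree_def by blast
    have "\<one> \<otimes> \<one> divides F" using F by (intro dividesI'[of F]) auto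
    then show "{\<one>} \<subseteq> {E \<in> carrier G. E \<otimes> E divides F}" by simp
  qed
  then show ?thesis using True one by simp
next
  case False
  \<comment> \<open>multiplication by \<open>p\<close> pairs off the square divisors with opposite signs\<close>
  then obtain p where p: "prime_elt p" "p \<otimes> p divides F" using F sqfree_iff_prime_elt by blast
  have pc: "p \<in> carrier G" using p prime_elt_closed by blast
  let ?A = "{E \<in> carrier G. E \<otimes> E divides F}"
  let ?no = "{E \<in> carrier G. E \<otimes> E divides F \<and> \<not> p divides E}"
  let ?yes = "{E \<in> carrier G. E \<otimes> E divides F \<and> p divides E}"
  let ?B = "(\<lambda>E. p \<otimes> E) ` ?no"
  have fin: "finite ?A" using finite_square_divisors[OF F] .
  have "?A = ?no \<union> ?yes" by auto
  moreover have "finite ?no" "finite ?yes" by (rule finite_subset[OF _ fin]; auto)+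
  ultimately have "sum moebius ?A = sum moebius ?no + sum moebius ?yes"
    by (simp only:) (rule sum.union_disjoint; auto)
  also have "sum moebius ?yes = sum moebius ?B"
  proof (rule sum.mono_neutral_right)
    show "finite ?yes" by (rule finite_subset[OF _ fin]) auto
    \<comment> \<open>Both E^2 and p^2 divide \<open>F\<close> while p does not divide E; two
      factors p are peeled off the cofactor of E^2, one after the other, so (p E)^2 divides
      \<open>F\<close>.\<close>
    show "?B \<subseteq> ?yes"
    proof
      fix x assume "x \<in> ?B"
      then obtain E where E: "E \<in> carrier G" "E \<otimes> E divides F" "\<not> p divides E" "x = p \<otimes> E" by auto
      obtain c where c: "c \<in> carrier G" "F = E \<otimes> E \<otimes> c" using E by (elim dividesE')
      obtain d where d: "d \<in> carrier G" "F = p \<otimes> p \<otimes> d" using p by (elim dividesE')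
      have "p divides E \<otimes> E \<otimes> c" using d c pc m_assoc by (intro dividesI'[of "p \<otimes> d"]) auto
      then have "p divides c" using E c p by (simp add: prime_elt_dvd_mult_iff)
      then obtain c' where c': "c' \<in> carrier G" "c = p \<otimes> c'" by (elim dividesE')
      have "p \<otimes> (E \<otimes> E \<otimes> c') = p \<otimes> (p \<otimes> d)" using c c' d E pc by (simp add: m_ac)
      then have "E \<otimes> E \<otimes> c' = p \<otimes> d" using c' d E pc l_cancel by simp
      then have "p divides E \<otimes> E \<otimes> c'" using d by (auto simp: factor_def)
      then have "p divides c'" using E c' p by (simp add: prime_elt_dvd_mult_iff)
      then obtain c'' where c'': "c'' \<in> carrier G" "c' = p \<otimes> c''" by (elim dividesE')
      have "F = (p \<otimes> E) \<otimes> (p \<otimes> E) \<otimes> c''" using c c' c'' E pc by (simp add: m_ac)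
      then show "x \<in> ?yes" using E c'' pc by (auto simp: factor_def)
    qed
    \<comment> \<open>An E divisible by p that is not p times something prime to p is divisible by
      p^2, and its Moebius value vanishes.\<close>
    show "\<forall>E\<in>?yes - ?B. moebius E = 0"
    proof
      fix E assume E: "E \<in> ?yes - ?B"
      then obtain c where c: "c \<in> carrier G" "E = p \<otimes> c" by (auto elim: dividesE')
      obtain d where d: "d \<in> carrier G" "F = E \<otimes> E \<otimes> d" using E by (auto elim: dividesE')
      have "c \<otimes> c divides F" using c d pc by (intro dividesI'[of "p \<otimes> p \<otimes> d"]) (auto simp: m_ac)
      then have "p divides c" using E c by auto
      then have "\<not> sqfree E" using c p by (simp add: sqfree_prime_elt_mult_iff)
      then show "moebius E = 0" by (simp add: moebius_def)
    qed
  qed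
  also have "sum moebius ?B = (\<Sum>E\<in>?no. moebius (p \<otimes> E))"
    using pc l_cancel by (subst sum.reindex) (auto simp: inj_on_def)
  also have "\<dots> = - sum moebius ?no"
    using p by (simp add: moebius_prime_elt_mult sum_negf)
  finally show ?thesis using False by simp
qed

section \<open>Triples whose product is squarefree\<close>

text \<open>Degrees are integers, so that there are no triples with a negative degree.\<close>

definition tri :: "int \<Rightarrow> int \<Rightarrow> int \<Rightarrow> ('m \<times> 'm \<times> 'm) set" where
  "tri n1 n2 n3 = {f \<in> carrier G. int (deg f) = n1} \<times> {g \<in> carrier G. int (deg g) = n2}
     \<times> {h \<in> carrier G. int (deg h) = n3}"

definition prod3 :: "'m \<times> 'm \<times> 'm \<Rightarrow> 'm" where
  "prod3 = (\<lambda>(f, g, h). f \<otimes> g \<otimes> h)"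

definition sqtri :: "int \<Rightarrow> int \<Rightarrow> int \<Rightarrow> ('m \<times> 'm \<times> 'm) set" where
  "sqtri n1 n2 n3 = {t \<in> tri n1 n2 n3. sqfree (prod3 t)}"

lemma prod3_closed: "t \<in> tri n1 n2 n3 \<Longrightarrow> prod3 t \<in> carrier G"
  by (auto simp: tri_def prod3_def)

lemma deg_prod3: "t \<in> tri n1 n2 n3 \<Longrightarrow> int (deg (prod3 t)) = n1 + n2 + n3"
  by (auto simp: tri_def prod3_def deg_mult)

lemma card_int_deg: "card {f \<in> carrier G. int (deg f) = n} = (if n < 0 then 0 else q ^ nat n)"
proof (cases "n < 0")
  case False
  then have "{f \<in> carrier G. int (deg f) = n} = {f \<in> carrier G. deg f = nat n}" by auto
  then show ?thesis using False card_deg by simp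
next
  case True
  then have "{f \<in> carrier G. int (deg f) = n} = {}" by auto
  then show ?thesis using True by simp
qed

lemma finite_int_deg: "finite {f \<in> carrier G. int (deg f) = n}"
  by (rule finite_subset[OF _ finite_deg_le[of "nat n"]]) auto

lemma finite_tri: "finite (tri n1 n2 n3)"
  unfolding tri_def using finite_int_deg by simp

lemma finite_sqtri: "finite (sqtri n1 n2 n3)"
  unfolding sqtri_def using finite_tri by simp

lemma card_tri_le: "real (card (tri n1 n2 n3)) \<le> real q powr real_of_int (n1 + n2 + n3)"
proof (cases "n1 < 0 \<or> n2 < 0 \<or> n3 < 0")
  case True
  then show ?thesis by (auto simp: tri_def card_cartesian_product card_int_deg)
next
  case False
  have "real (q ^ nat n) = real q powr real_of_int n" if "n \<ge> 0" for n
    using that q_ge_3 by (simp add: powr_int)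
  then show ?thesis using False q_ge_3
    by (simp add: tri_def card_cartesian_product card_int_deg powr_add)
qed

lemma card_tri: "card (tri (int n1) (int n2) (int n3)) = q ^ (n1 + n2 + n3)"
  by (simp add: tri_def card_cartesian_product card_deg power_add)

section \<open>Square divisors of a product of three factors\<close>

text \<open>Either the square of p sits in one of the three factors, or the two copies of p are
  shared between two of them. These six cases are the origin of the six divisors in
  \<open>sixfold\<close>.\<close>

lemma prime_square_divides_prod:
  assumes p: "prime_elt p" and c: "f \<in> carrier G" "g \<in> carrier G" "h \<in> carrier G"
    and dv: "p \<otimes> p divides f \<otimes> g \<otimes> h"
  obtains f' where "f' \<in> carrier G" "f = p \<otimes> p \<otimes> f'"
  | g' where "g' \<in> carrier G" "g = p \<otimes> p \<otimes> g'"
  | h' where "h' \<in> carrier G" "h = p \<otimes> p \<otimes> h'"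
  | f' g' where "f' \<in> carrier G" "g' \<in> carrier G" "f = p \<otimes> f'" "g = p \<otimes> g'"
  | f' h' where "f' \<in> carrier G" "h' \<in> carrier G" "f = p \<otimes> f'" "h = p \<otimes> h'"
  | g' h' where "g' \<in> carrier G" "h' \<in> carrier G" "g = p \<otimes> g'" "h = p \<otimes> h'"
proof -
  have pc: "p \<in> carrier G" using p prime_elt_closed by blast
  obtain d where d: "d \<in> carrier G" "f \<otimes> g \<otimes> h = p \<otimes> p \<otimes> d" using dv by (elim dividesE')
  \<comment> \<open>One copy of \<open>p\<close> is cancelled against the factor that contains it;
    the other copy does not divide what is left of that factor, so it divides the rest of the
    product.\<close>
  have *: "p divides b" if "a \<in> carrier G" "b \<in> carrier G" "p \<otimes> a \<otimes> b = p \<otimes> p \<otimes> d" "\<not> p divides a"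
    for a b
  proof -
    have "p \<otimes> (a \<otimes> b) = p \<otimes> (p \<otimes> d)" using that pc d by (simp add: m_assoc)
    then have "a \<otimes> b = p \<otimes> d" using that pc d l_cancel by simp
    then have "p divides a \<otimes> b" using d by (auto intro: dividesI')
    then show ?thesis using that p by (simp add: prime_elt_dvd_mult_iff)
  qed
  have "p divides f \<otimes> g \<otimes> h" using d pc by (intro dividesI'[of "p \<otimes> d"]) (auto simp: m_assoc)
  then consider "p divides f" | "\<not> p divides f" "p divides g" | "\<not> p divides f" "\<not> p divides g" "p divides h"
    using p c by (auto simp: prime_elt_dvd_mult_iff)
  then show thesis
  proof cases
    case 1
    then obtain f' where f': "f' \<in> carrier G" "f = p \<otimes> f'" by (elim dividesE')
    show thesis
    proof (cases "p divides f'")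
      case True
      then obtain f'' where "f'' \<in> carrier G" "f' = p \<otimes> f''" by (elim dividesE')
      then show thesis using f' pc that(1) by (simp add: m_assoc)
    next
      case False
      have "p divides g \<otimes> h" using *[of f' "g \<otimes> h"] False f' c d pc by (simp add: m_assoc)
      then consider "p divides g" | "p divides h" using p c by (auto simp: prime_elt_dvd_mult_iff)
      then show thesis by cases (use f' that(4,5) in \<open>elim dividesE', blast\<close>)+
    qed
  next
    case 2
    then obtain g' where g': "g' \<in> carrier G" "g = p \<otimes> g'" by (elim dividesE')
    show thesis
    proof (cases "p divides g'")
      case True
      then obtain g'' where "g'' \<in> carrier G" "g' = p \<otimes> g''" by (elim dividesE')
      then show thesis using g' pc that(2) by (simp add: m_assoc)
    next
      case False
      have "p divides f \<otimes> h" using *[of g' "f \<otimes> h"] False g' c d pc by (simp add: m_ac)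
      then have "p divides h" using p c 2 by (auto simp: prime_elt_dvd_mult_iff)
      then show thesis using g' that(6) by (elim dividesE') blast
    qed
  next
    case 3
    then obtain h' where h': "h' \<in> carrier G" "h = p \<otimes> h'" by (elim dividesE')
    show thesis
    proof (cases "p divides h'")
      case True
      then obtain h'' where "h'' \<in> carrier G" "h' = p \<otimes> h''" by (elim dividesE')
      then show thesis using h' pc that(3) by (simp add: m_assoc)
    next
      case False
      have "p divides f \<otimes> g" using *[of h' "f \<otimes> g"] False h' c d pc by (simp add: m_ac)
      then show thesis using p c 3 by (auto simp: prime_elt_dvd_mult_iff)
    qed
  qed
qed

text \<open>
  If \<open>E\<^sup>2\<close> divides \<open>f g h\<close>, each prime factor of \<open>E\<close> either has its square dividing one of the three
  factors or divides two of them; sorting the primes accordingly gives six divisors.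
\<close>

definition sixfold :: "'m \<Rightarrow> 'm \<times> 'm \<times> 'm \<times> 'm \<times> 'm \<times> 'm \<Rightarrow> 'm \<times> 'm \<times> 'm \<Rightarrow> 'm \<times> 'm \<times> 'm \<Rightarrow> bool"
  where "sixfold E = (\<lambda>(A, B, C, D, H, K) (f', g', h') (f, g, h).
    {A, B, C, D, H, K, f', g', h'} \<subseteq> carrier G \<and> E = A \<otimes> B \<otimes> C \<otimes> D \<otimes> H \<otimes> K
    \<and> f \<otimes> g \<otimes> h = E \<otimes> E \<otimes> (f' \<otimes> g' \<otimes> h')
    \<and> f = A \<otimes> A \<otimes> D \<otimes> H \<otimes> f' \<and> g = B \<otimes> B \<otimes> D \<otimes> K \<otimes> g' \<and> h = C \<otimes> C \<otimes> H \<otimes> K \<otimes> h')"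

text \<open>One clause for each case of \<open>prime_square_divides_prod\<close>: a square inside
  one factor enlarges \<open>A\<close>, \<open>B\<close> or \<open>C\<close>, a prime shared by two
  factors enlarges \<open>D\<close>, \<open>H\<close> or \<open>K\<close>.\<close>

lemma sixfold_prime_step:
  assumes "p \<in> carrier G" "sixfold E (A, B, C, D, H, K) t (f, g, h)"
  shows "sixfold (p \<otimes> E) (p \<otimes> A, B, C, D, H, K) t (p \<otimes> p \<otimes> f, g, h)"
    "sixfold (p \<otimes> E) (A, p \<otimes> B, C, D, H, K) t (f, p \<otimes> p \<otimes> g, h)"
    "sixfold (p \<otimes> E) (A, B, p \<otimes> C, D, H, K) t (f, g, p \<otimes> p \<otimes> h)"
    "sixfold (p \<otimes> E) (A, B, C, p \<otimes> D, H, K) t (p \<otimes> f, p \<otimes> g, h)"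
    "sixfold (p \<otimes> E) (A, B, C, D, p \<otimes> H, K) t (p \<otimes> f, g, p \<otimes> h)"
    "sixfold (p \<otimes> E) (A, B, C, D, H, p \<otimes> K) t (f, p \<otimes> g, p \<otimes> h)"
proof -
  obtain f' g' h' where t: "t = (f', g', h')" by (cases t)
  have c: "p \<in> carrier G" "A \<in> carrier G" "B \<in> carrier G" "C \<in> carrier G" "D \<in> carrier G"
    "H \<in> carrier G" "K \<in> carrier G" "f' \<in> carrier G" "g' \<in> carrier G" "h' \<in> carrier G"
    using assms unfolding sixfold_def t by simp_all
  have eqs: "E = A \<otimes> B \<otimes> C \<otimes> D \<otimes> H \<otimes> K" "f = A \<otimes> A \<otimes> D \<otimes> H \<otimes> f'"
    "g = B \<otimes> B \<otimes> D \<otimes> K \<otimes> g'" "h = C \<otimes> C \<otimes> H \<otimes> K \<otimes> h'"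
    using assms unfolding sixfold_def t by simp_all
  have c': "E \<in> carrier G" "f \<in> carrier G" "g \<in> carrier G" "h \<in> carrier G"
    unfolding eqs using c by simp_all
  have "f \<otimes> g \<otimes> h = E \<otimes> E \<otimes> (f' \<otimes> g' \<otimes> h')"
    using assms(2) unfolding sixfold_def t prod.case by blast
  then have "p \<otimes> p \<otimes> (f \<otimes> g \<otimes> h) = p \<otimes> p \<otimes> (E \<otimes> E \<otimes> (f' \<otimes> g' \<otimes> h'))" by simp
  also have "\<dots> = p \<otimes> E \<otimes> (p \<otimes> E) \<otimes> (f' \<otimes> g' \<otimes> h')"
    using c(1,8-10) c'(1) by (simp add: m_ac)
  finally have pr0: "p \<otimes> p \<otimes> (f \<otimes> g \<otimes> h) = p \<otimes> E \<otimes> (p \<otimes> E) \<otimes> (f' \<otimes> g' \<otimes> h')" .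
  \<comment> \<open>All six modified products equal p^2 f g h, so the identity with \<open>E\<close>
    is rearranged only once, in \<open>pr0\<close>, while \<open>E\<close> stays folded.\<close>
  have pr: "(p \<otimes> p \<otimes> f) \<otimes> g \<otimes> h = p \<otimes> E \<otimes> (p \<otimes> E) \<otimes> (f' \<otimes> g' \<otimes> h')"
    "f \<otimes> (p \<otimes> p \<otimes> g) \<otimes> h = p \<otimes> E \<otimes> (p \<otimes> E) \<otimes> (f' \<otimes> g' \<otimes> h')"
    "f \<otimes> g \<otimes> (p \<otimes> p \<otimes> h) = p \<otimes> E \<otimes> (p \<otimes> E) \<otimes> (f' \<otimes> g' \<otimes> h')"
    "(p \<otimes> f) \<otimes> (p \<otimes> g) \<otimes> h = p \<otimes> E \<otimes> (p \<otimes> E) \<otimes> (f' \<otimes> g' \<otimes> h')"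
    "(p \<otimes> f) \<otimes> g \<otimes> (p \<otimes> h) = p \<otimes> E \<otimes> (p \<otimes> E) \<otimes> (f' \<otimes> g' \<otimes> h')"
    "f \<otimes> (p \<otimes> g) \<otimes> (p \<otimes> h) = p \<otimes> E \<otimes> (p \<otimes> E) \<otimes> (f' \<otimes> g' \<otimes> h')"
    unfolding pr0[symmetric] using c(1) c' by (simp_all add: m_ac)
  have two: "p \<otimes> p \<otimes> (a \<otimes> a \<otimes> b \<otimes> c \<otimes> d) = (p \<otimes> a) \<otimes> (p \<otimes> a) \<otimes> b \<otimes> c \<otimes> d"
    if "a \<in> carrier G" "b \<in> carrier G" "c \<in> carrier G" "d \<in> carrier G" for a b c d
    using that c(1) by (simp add: m_ac)
  have fst: "p \<otimes> (a \<otimes> a \<otimes> b \<otimes> c \<otimes> d) = a \<otimes> a \<otimes> (p \<otimes> b) \<otimes> c \<otimes> d"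
    if "a \<in> carrier G" "b \<in> carrier G" "c \<in> carrier G" "d \<in> carrier G" for a b c d
    using that c(1) by (simp add: m_ac)
  have snd: "p \<otimes> (a \<otimes> a \<otimes> b \<otimes> c \<otimes> d) = a \<otimes> a \<otimes> b \<otimes> (p \<otimes> c) \<otimes> d"
    if "a \<in> carrier G" "b \<in> carrier G" "c \<in> carrier G" "d \<in> carrier G" for a b c d
    using that c(1) by (simp add: m_ac)
  have E: "p \<otimes> E = (p \<otimes> A) \<otimes> B \<otimes> C \<otimes> D \<otimes> H \<otimes> K" "p \<otimes> E = A \<otimes> (p \<otimes> B) \<otimes> C \<otimes> D \<otimes> H \<otimes> K"
    "p \<otimes> E = A \<otimes> B \<otimes> (p \<otimes> C) \<otimes> D \<otimes> H \<otimes> K" "p \<otimes> E = A \<otimes> B \<otimes> C \<otimes> (p \<otimes> D) \<otimes> H \<otimes> K"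
    "p \<otimes> E = A \<otimes> B \<otimes> C \<otimes> D \<otimes> (p \<otimes> H) \<otimes> K" "p \<otimes> E = A \<otimes> B \<otimes> C \<otimes> D \<otimes> H \<otimes> (p \<otimes> K)"
    unfolding eqs using c by (simp_all add: m_ac)
  note simps = sixfold_def t prod.case
  show "sixfold (p \<otimes> E) (p \<otimes> A, B, C, D, H, K) t (p \<otimes> p \<otimes> f, g, h)"
    unfolding simps pr(1) by (intro conjI) (use c E(1) eqs two in simp_all)
  show "sixfold (p \<otimes> E) (A, p \<otimes> B, C, D, H, K) t (f, p \<otimes> p \<otimes> g, h)"
    unfolding simps pr(2) by (intro conjI) (use c E(2) eqs two in simp_all)
  show "sixfold (p \<otimes> E) (A, B, p \<otimes> C, D, H, K) t (f, g, p \<otimes> p \<otimes> h)"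
    unfolding simps pr(3) by (intro conjI) (use c E(3) eqs two in simp_all)
  show "sixfold (p \<otimes> E) (A, B, C, p \<otimes> D, H, K) t (p \<otimes> f, p \<otimes> g, h)"
    unfolding simps pr(4) by (intro conjI) (use c E(4) eqs fst in simp_all)
  show "sixfold (p \<otimes> E) (A, B, C, D, p \<otimes> H, K) t (p \<otimes> f, g, p \<otimes> h)"
    unfolding simps pr(5) by (intro conjI) (use c E(5) eqs fst[of C H K h'] snd[of A D H f'] in simp_all)
  show "sixfold (p \<otimes> E) (A, B, C, D, H, p \<otimes> K) t (f, p \<otimes> g, p \<otimes> h)"
    unfolding simps pr(6) by (intro conjI) (use c E(6) eqs snd in simp_all)
qed

text \<open>Induction on the degree of \<open>E\<close>: a prime of \<open>E\<close> is removed once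
  from \<open>E\<close> and twice from the product, and after the recursive call it is recorded at
  the place where it was found.\<close>

lemma exists_sixfold:
  assumes "E \<in> carrier G" "f \<in> carrier G" "g \<in> carrier G" "h \<in> carrier G"
    and "E \<otimes> E divides f \<otimes> g \<otimes> h"
  shows "\<exists>s t. sixfold E s t (f, g, h)"
  using assms
proof (induction "deg E" arbitrary: E f g h rule: less_induct)
  case less
  show ?case
  proof (cases "E = \<one>")
    case True
    then have "sixfold E (\<one>, \<one>, \<one>, \<one>, \<one>, \<one>) (f, g, h) (f, g, h)"
      using less.prems by (simp add: sixfold_def)
    then show ?thesis by blast
  next
    case False
    then obtain p where p: "prime_elt p" "p divides E" using exists_prime_elt less.prems by blast
    have pc: "p \<in> carrier G" using p prime_elt_closed by blast
    obtain E' where E': "E' \<in> carrier G" "E = p \<otimes> E'" using p by (elim dividesE')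
    have "deg p \<noteq> 0" using p deg_0[of p] by (auto simp: prime_elt_def)
    then have lt: "deg E' < deg E" using E' pc by (simp add: deg_mult)
    obtain d where d: "d \<in> carrier G" "f \<otimes> g \<otimes> h = E \<otimes> E \<otimes> d"
      using less.prems by (elim dividesE')
    have cancel: "E' \<otimes> E' divides x" if "x \<in> carrier G" "p \<otimes> p \<otimes> x = f \<otimes> g \<otimes> h" for x
    proof -
      have "p \<otimes> p \<otimes> x = p \<otimes> p \<otimes> (E' \<otimes> E' \<otimes> d)"
        using that d E' pc by (simp add: m_ac)
      then have "x = E' \<otimes> E' \<otimes> d" using that d E' pc l_cancel[of "p \<otimes> p"] by simp
      then show ?thesis using d by (auto intro: dividesI')
    qed
    have step: "\<exists>A B C D H K t. sixfold E' (A, B, C, D, H, K) t (f', g', h')"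
      if "f' \<in> carrier G" "g' \<in> carrier G" "h' \<in> carrier G"
        "p \<otimes> p \<otimes> (f' \<otimes> g' \<otimes> h') = f \<otimes> g \<otimes> h" for f' g' h'
      using less.hyps[OF lt E'(1) that(1-3) cancel[OF _ that(4)]] that by auto
    have "p \<otimes> p divides f \<otimes> g \<otimes> h"
      using d E' pc by (intro dividesI'[of "E' \<otimes> E' \<otimes> d"]) (auto simp: m_ac)
    from p(1) less.prems(2-4) this show ?thesis
    proof (cases rule: prime_square_divides_prod)
      case (1 f')
      then have "p \<otimes> p \<otimes> (f' \<otimes> g \<otimes> h) = f \<otimes> g \<otimes> h"
        using less.prems(2-4) pc by (simp add: m_ac)
      with step[of f' g h] 1 less.prems(2-4) obtain A B C D H K t
        where "sixfold E' (A, B, C, D, H, K) t (f', g, h)" by blast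
      from sixfold_prime_step(1)[OF pc this] show ?thesis unfolding E'(2) 1(2) by blast
    next
      case (2 g')
      then have "p \<otimes> p \<otimes> (f \<otimes> g' \<otimes> h) = f \<otimes> g \<otimes> h"
        using less.prems(2-4) pc by (simp add: m_ac)
      with step[of f g' h] 2 less.prems(2-4) obtain A B C D H K t
        where "sixfold E' (A, B, C, D, H, K) t (f, g', h)" by blast
      from sixfold_prime_step(2)[OF pc this] show ?thesis unfolding E'(2) 2(2) by blast
    next
      case (3 h')
      then have "p \<otimes> p \<otimes> (f \<otimes> g \<otimes> h') = f \<otimes> g \<otimes> h"
        using less.prems(2-4) pc by (simp add: m_ac)
      with step[of f g h'] 3 less.prems(2-4) obtain A B C D H K t
        where "sixfold E' (A, B, C, D, H, K) t (f, g, h')" by blast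
      from sixfold_prime_step(3)[OF pc this] show ?thesis unfolding E'(2) 3(2) by blast
    next
      case (4 f' g')
      then have "p \<otimes> p \<otimes> (f' \<otimes> g' \<otimes> h) = f \<otimes> g \<otimes> h"
        using less.prems(2-4) pc by (simp add: m_ac)
      with step[of f' g' h] 4 less.prems(2-4) obtain A B C D H K t
        where "sixfold E' (A, B, C, D, H, K) t (f', g', h)" by blast
      from sixfold_prime_step(4)[OF pc this] show ?thesis unfolding E'(2) 4(3,4) by blast
    next
      case (5 f' h')
      then have "p \<otimes> p \<otimes> (f' \<otimes> g \<otimes> h') = f \<otimes> g \<otimes> h"
        using less.prems(2-4) pc by (simp add: m_ac)
      with step[of f' g h'] 5 less.prems(2-4) obtain A B C D H K t
        where "sixfold E' (A, B, C, D, H, K) t (f', g, h')" by blast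
      from sixfold_prime_step(5)[OF pc this] show ?thesis unfolding E'(2) 5(3,4) by blast
    next
      case (6 g' h')
      then have "p \<otimes> p \<otimes> (f \<otimes> g' \<otimes> h') = f \<otimes> g \<otimes> h"
        using less.prems(2-4) pc by (simp add: m_ac)
      with step[of f g' h'] 6 less.prems(2-4) obtain A B C D H K t
        where "sixfold E' (A, B, C, D, H, K) t (f, g', h')" by blast
      from sixfold_prime_step(6)[OF pc this] show ?thesis unfolding E'(2) 6(3,4) by blast
    qed
  qed
qed

section \<open>Counting by sixfold decompositions\<close>

definition tuples :: "nat \<Rightarrow> ('m \<times> 'm \<times> 'm \<times> 'm \<times> 'm \<times> 'm) set" where
  "tuples j = {(A, B, C, D, H, K). {A, B, C, D, H, K} \<subseteq> carrier G
     \<and> deg A + deg B + deg C + deg D + deg H + deg K = j}"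

text \<open>The amounts by which the six divisors lower the three degrees.\<close>

definition shift1 :: "'m \<times> 'm \<times> 'm \<times> 'm \<times> 'm \<times> 'm \<Rightarrow> int" where
  "shift1 = (\<lambda>(A, B, C, D, H, K). int (2 * deg A + deg D + deg H))"

definition shift2 :: "'m \<times> 'm \<times> 'm \<times> 'm \<times> 'm \<times> 'm \<Rightarrow> int" where
  "shift2 = (\<lambda>(A, B, C, D, H, K). int (2 * deg B + deg D + deg K))"

definition shift3 :: "'m \<times> 'm \<times> 'm \<times> 'm \<times> 'm \<times> 'm \<Rightarrow> int" where
  "shift3 = (\<lambda>(A, B, C, D, H, K). int (2 * deg C + deg H + deg K))"

text \<open>Undoes the sixfold decomposition. It need not be injective: the counts below are upper
  bounds and rest on every pair (E, t) being hit.\<close>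

definition combine :: "('m \<times> 'm \<times> 'm \<times> 'm \<times> 'm \<times> 'm) \<times> ('m \<times> 'm \<times> 'm) \<Rightarrow> 'm \<times> 'm \<times> 'm \<times> 'm"
  where "combine = (\<lambda>((A, B, C, D, H, K), (f, g, h)). (A \<otimes> B \<otimes> C \<otimes> D \<otimes> H \<otimes> K,
    A \<otimes> A \<otimes> D \<otimes> H \<otimes> f, B \<otimes> B \<otimes> D \<otimes> K \<otimes> g, C \<otimes> C \<otimes> H \<otimes> K \<otimes> h))"

lemma shift_nonneg: "shift1 s \<ge> 0" "shift2 s \<ge> 0" "shift3 s \<ge> 0"
  by (auto simp: shift1_def shift2_def shift3_def split: prod.split)

lemma shift_sum: "s \<in> tuples j \<Longrightarrow> shift1 s + shift2 s + shift3 s = 2 * int j"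
  by (auto simp: shift1_def shift2_def shift3_def tuples_def)

lemma sixfoldD:
  assumes "sixfold E s t' t" "t \<in> tri n1 n2 n3"
  shows "s \<in> tuples (deg E)" "t' \<in> tri (n1 - shift1 s) (n2 - shift2 s) (n3 - shift3 s)"
    "combine (s, t') = (E, t)"
proof -
  obtain A B C D H K f' g' h' f g h
    where s: "s = (A, B, C, D, H, K)" "t' = (f', g', h')" "t = (f, g, h)"
    by (cases s, cases t', cases t) blast
  have c: "A \<in> carrier G" "B \<in> carrier G" "C \<in> carrier G" "D \<in> carrier G" "H \<in> carrier G"
    "K \<in> carrier G" "f' \<in> carrier G" "g' \<in> carrier G" "h' \<in> carrier G"
    and eqs: "E = A \<otimes> B \<otimes> C \<otimes> D \<otimes> H \<otimes> K" "f = A \<otimes> A \<otimes> D \<otimes> H \<otimes> f'"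
    "g = B \<otimes> B \<otimes> D \<otimes> K \<otimes> g'" "h = C \<otimes> C \<otimes> H \<otimes> K \<otimes> h'"
    using assms unfolding s sixfold_def by simp_all
  show "s \<in> tuples (deg E)" unfolding eqs s tuples_def using c by (simp add: deg_mult)
  show "t' \<in> tri (n1 - shift1 s) (n2 - shift2 s) (n3 - shift3 s)"
    using assms(2) c unfolding s tri_def eqs shift1_def shift2_def shift3_def
    by (auto simp: deg_mult)
  show "combine (s, t') = (E, t)" unfolding combine_def s eqs by simp
qed

text \<open>There are at most (j + 1)^6 vectors of six degrees with sum j, and each of them is
  realised by q^j tuples.\<close>

lemma
  shows finite_tuples: "finite (tuples j)"
    and card_tuples_le: "real (card (tuples j)) \<le> real (j + 1) ^ 6 * real q ^ j"
proof -
  let ?V = "{..j} \<times> {..j} \<times> {..j} \<times> {..j} \<times> {..j} \<times> {..j}"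
  let ?W = "{(a, b, c, d, e, k) \<in> ?V. a + b + c + d + e + k = j}"
  let ?M = "\<lambda>n. {f \<in> carrier G. deg f = n}"
  let ?F = "\<lambda>(a, b, c, d, e, k). ?M a \<times> ?M b \<times> ?M c \<times> ?M d \<times> ?M e \<times> ?M k"
  have sub: "tuples j \<subseteq> (\<Union>v\<in>?W. ?F v)"
  proof
    fix x assume x: "x \<in> tuples j"
    obtain A B C D H K where "x = (A, B, C, D, H, K)" by (cases x)
    with x show "x \<in> (\<Union>v\<in>?W. ?F v)"
      by (intro UN_I[of "(deg A, deg B, deg C, deg D, deg H, deg K)"]) (simp_all add: tuples_def)
  qed
  have finW: "finite ?W" by (rule finite_subset[of _ ?V]) auto
  have finF: "finite (?F v)" for v using finite_deg by (cases v) simp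
  show fin: "finite (tuples j)"
    by (rule finite_subset[OF sub]) (use finW finF in blast)
  have "card (tuples j) \<le> card (\<Union>v\<in>?W. ?F v)"
    by (rule card_mono[OF _ sub]) (use finW finF in blast)
  also have "\<dots> \<le> (\<Sum>v\<in>?W. card (?F v))" by (rule card_UN_le[OF finW])
  also have "\<dots> = (\<Sum>v\<in>?W. q ^ j)"
    by (rule sum.cong) (auto simp: card_cartesian_product card_deg power_add[symmetric] add_ac)
  also have "\<dots> = card ?W * q ^ j" by simp
  also have "card ?W \<le> card ?V" by (rule card_mono) auto
  also have "card ?V = (j + 1) ^ 6" by (simp add: card_cartesian_product eval_nat_numeral)
  finally have "card (tuples j) \<le> (j + 1) ^ 6 * q ^ j" by simp
  then have "real (card (tuples j)) \<le> real ((j + 1) ^ 6 * q ^ j)" by (rule of_nat_mono)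
  then show "real (card (tuples j)) \<le> real (j + 1) ^ 6 * real q ^ j" by simp
qed

text \<open>A tuple of total degree j lowers the three degrees by 2 j altogether, so it leaves at
  most q^(n1 + n2 + n3 - 2 j) cofactors; against at most (j + 1)^6 q^j tuples this saves q^(-j). No
  relation between \<open>j\<close> and the degrees is assumed, so the bound reaches those E for
  which equidistribution is out of reach.\<close>

lemma sum_card_square_divides_le:
  "(\<Sum>E | E \<in> carrier G \<and> deg E = j. real (card {t \<in> tri n1 n2 n3. E \<otimes> E divides prod3 t}))
     \<le> real (j + 1) ^ 6 / real q ^ j * real q powr real_of_int (n1 + n2 + n3)"
proof -
  let ?D = "{E \<in> carrier G. deg E = j}"
  let ?S = "SIGMA E:?D. {t \<in> tri n1 n2 n3. E \<otimes> E divides prod3 t}"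
  let ?T = "\<lambda>s. tri (n1 - shift1 s) (n2 - shift2 s) (n3 - shift3 s)"
  let ?Z = "SIGMA s:tuples j. ?T s"
  have finZ: "finite ?Z" using finite_tuples finite_tri by auto
  have "?S \<subseteq> combine ` ?Z"
  proof
    fix x assume "x \<in> ?S"
    then obtain E t where x: "x = (E, t)" "E \<in> carrier G" "deg E = j" "t \<in> tri n1 n2 n3"
      "E \<otimes> E divides prod3 t" by auto
    obtain f g h where t: "t = (f, g, h)" by (cases t)
    obtain s t' where "sixfold E s t' t"
      using exists_sixfold[of E f g h] x t by (auto simp: tri_def prod3_def)
    from sixfoldD[OF this x(4)] show "x \<in> combine ` ?Z"
      using x by (intro image_eqI[of _ _ "(s, t')"]) auto
  qed
  then have "card ?S \<le> card ?Z" using finZ by (rule surj_card_le[rotated])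
  moreover have "card ?S = (\<Sum>E\<in>?D. card {t \<in> tri n1 n2 n3. E \<otimes> E divides prod3 t})"
    by (rule card_SigmaI) (simp_all add: finite_deg finite_tri)
  moreover have "card ?Z = (\<Sum>s\<in>tuples j. card (?T s))"
    by (rule card_SigmaI) (simp_all add: finite_tuples finite_tri)
  ultimately have "(\<Sum>E\<in>?D. real (card {t \<in> tri n1 n2 n3. E \<otimes> E divides prod3 t}))
      \<le> (\<Sum>s\<in>tuples j. real (card (?T s)))"
    by (simp add: of_nat_sum[symmetric] del: of_nat_sum)
  also have "\<dots> \<le> (\<Sum>s\<in>tuples j. real q powr real_of_int (n1 + n2 + n3 - 2 * int j))"
  proof (rule sum_mono)
    fix s assume "s \<in> tuples j"
    then have "n1 - shift1 s + (n2 - shift2 s) + (n3 - shift3 s) = n1 + n2 + n3 - 2 * int j"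
      using shift_sum by fastforce
    then show "real (card (?T s)) \<le> real q powr real_of_int (n1 + n2 + n3 - 2 * int j)"
      using card_tri_le by metis
  qed
  also have "\<dots> = real (card (tuples j)) * real q powr real_of_int (n1 + n2 + n3 - 2 * int j)" by simp
  also have "\<dots> \<le> (real (j + 1) ^ 6 * real q ^ j) * real q powr real_of_int (n1 + n2 + n3 - 2 * int j)"
    by (intro mult_right_mono card_tuples_le) simp
  also have "\<dots> = real (j + 1) ^ 6 / real q ^ j * real q powr real_of_int (n1 + n2 + n3)"
  proof -
    have "real q powr (2 * real j) = real q ^ j * real q ^ j"
      using q_ge_3 powr_add[of "real q" "real j" "real j"] by (simp add: powr_realpow)
    then have "real q powr real_of_int (n1 + n2 + n3 - 2 * int j)
        = real q powr real_of_int (n1 + n2 + n3) / (real q ^ j * real q ^ j)"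
      using q_ge_3 by (simp add: powr_diff)
    then show ?thesis using q_ge_3 by simp
  qed
  finally show ?thesis by simp
qed

text \<open>Every triple arises from a squarefree one by inserting a sixfold product. Since all
  triples are thereby accounted for, squarefree triples cannot be rare; \<open>dens_empty_ge\<close>
  makes this quantitative.\<close>

lemma card_tri_le_sum_sqtri:
  "card (tri n1 n2 n3) \<le> (\<Sum>j\<le>nat (n1 + n2 + n3). \<Sum>s\<in>tuples j.
     card (sqtri (n1 - shift1 s) (n2 - shift2 s) (n3 - shift3 s)))"
proof -
  let ?T = "\<lambda>s. sqtri (n1 - shift1 s) (n2 - shift2 s) (n3 - shift3 s)"
  let ?U = "\<Union>j\<le>nat (n1 + n2 + n3). tuples j"
  let ?Z = "SIGMA s:?U. ?T s"
  have finZ: "finite ?Z" using finite_tuples finite_sqtri by auto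
  have "tri n1 n2 n3 \<subseteq> (snd \<circ> combine) ` ?Z"
  proof
    fix t assume t: "t \<in> tri n1 n2 n3"
    define S where "S = {E \<in> carrier G. E \<otimes> E divides prod3 t}"
    have F: "prod3 t \<in> carrier G" using t prod3_closed by blast
    have "\<one> \<in> S" using F unfolding S_def by (auto intro!: dividesI'[of "prod3 t"])
    moreover have "finite S" unfolding S_def by (rule finite_square_divisors[OF F])
    ultimately obtain E where E: "E \<in> S" and max: "\<And>E'. E' \<in> S \<Longrightarrow> deg E' \<le> deg E"
      using Max_in[of "deg ` S"] Max_ge[of "deg ` S"] by fastforce
    have Ec: "E \<in> carrier G" "E \<otimes> E divides prod3 t" using E by (auto simp: S_def)
    obtain f g h where fgh: "t = (f, g, h)" by (cases t)
    obtain s t' where st: "sixfold E s t' t"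
      using exists_sixfold[of E f g h] Ec t fgh by (auto simp: tri_def prod3_def)
    note D = sixfoldD[OF st t]
    have F': "prod3 t' \<in> carrier G" using D(2) prod3_closed by blast
    have prod: "prod3 t = E \<otimes> E \<otimes> prod3 t'"
    proof -
      obtain A B C D H K f' g' h' where s: "s = (A, B, C, D, H, K)" "t' = (f', g', h')"
        by (cases s, cases t') blast
      show ?thesis using st unfolding s fgh sixfold_def prod3_def prod.case by blast
    qed
    \<comment> \<open>A square a^2 left in the cofactor would make E a a square divisor of larger
      degree than the maximal \<open>E\<close>.\<close>
    have "sqfree (prod3 t')"
      unfolding sqfree_def
    proof (intro ballI impI)
      fix a assume a: "a \<in> carrier G" "a \<otimes> a divides prod3 t'"
      then obtain b where b: "b \<in> carrier G" "prod3 t' = a \<otimes> a \<otimes> b" by (elim dividesE')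
      have "prod3 t = (E \<otimes> a) \<otimes> (E \<otimes> a) \<otimes> b"
        unfolding prod b(2) using a b Ec by (simp add: m_ac)
      then have "E \<otimes> a \<in> S" unfolding S_def using a b Ec by (auto intro: dividesI')
      then have "deg (E \<otimes> a) \<le> deg E" by (rule max)
      then have "deg a = 0" using a Ec by (simp add: deg_mult)
      then show "a = \<one>" using a deg_0 by blast
    qed
    then have t': "t' \<in> ?T s" using D by (simp add: sqtri_def)
    have "int (deg (prod3 t)) = n1 + n2 + n3" using deg_prod3[OF t] .
    moreover have "deg E \<le> deg (prod3 t)" unfolding prod using Ec F' by (simp add: deg_mult)
    ultimately have "deg E \<le> nat (n1 + n2 + n3)" by linarith
    then have "(s, t') \<in> ?Z" using D(1) t' by auto
    then show "t \<in> (snd \<circ> combine) ` ?Z" using D(3) by (intro image_eqI[of _ _ "(s, t')"]) simp_all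
  qed
  then have "card (tri n1 n2 n3) \<le> card ?Z"
    using finZ by (rule surj_card_le[rotated])
  also have "\<dots> = (\<Sum>s\<in>?U. card (?T s))"
    by (rule card_SigmaI) (simp_all add: finite_tuples finite_sqtri)
  also have "\<dots> = (\<Sum>j\<le>nat (n1 + n2 + n3). \<Sum>s\<in>tuples j. card (?T s))"
    by (rule sum.UNION_disjoint) (use finite_tuples in \<open>auto simp: tuples_def\<close>)
  finally show ?thesis .
qed

end

section \<open>The constant that absorbs all tails\<close>

text \<open>The base 3 stands in for q, which is at least 3, so that the value does not depend on
  the field.\<close>

definition tail_const :: "real \<Rightarrow> real" where
  "tail_const \<epsilon> = (\<Sum>j. real (j + 1) ^ 6 * 3 powr (- \<epsilon> * real j))"

lemma summable_tail_const:
  assumes "\<epsilon> > 0"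
  shows "summable (\<lambda>j. real (j + 1) ^ 6 * 3 powr (- \<epsilon> * real j))"
proof (rule summable_comparison_test_bigo)
  show "summable (\<lambda>j. norm (1 / real j ^ 2))"
    using inverse_power_summable[of 2, where ?'a = real] by (simp add: divide_inverse norm_power)
  show "(\<lambda>j. real (j + 1) ^ 6 * 3 powr (- \<epsilon> * real j)) \<in> O(\<lambda>j. 1 / real j ^ 2)"
    using assms by real_asymp
qed

lemma tail_const_ge_1:
  assumes "\<epsilon> > 0" shows "tail_const \<epsilon> \<ge> 1"
proof -
  have "(\<Sum>j\<in>{0}. real (j + 1) ^ 6 * 3 powr (- \<epsilon> * real j)) \<le> tail_const \<epsilon>"
    unfolding tail_const_def by (rule sum_le_suminf[OF summable_tail_const[OF assms]]) auto
  then show ?thesis by simp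
qed

context monic_monoid
begin

section \<open>Weighted sums over squarefree triples\<close>

definition wt :: "'x set \<Rightarrow> ('x \<Rightarrow> real \<Rightarrow> real \<Rightarrow> real \<Rightarrow> real) \<Rightarrow> 'm \<times> 'm \<times> 'm \<Rightarrow> real" where
  "wt T \<phi> = (\<lambda>(f, g, h). \<Prod>x\<in>T. \<phi> x (chi f x) (chi g x) (chi h x))"

definition nonvan :: "'x set \<Rightarrow> 'm \<times> 'm \<times> 'm \<Rightarrow> bool" where
  "nonvan U t \<longleftrightarrow> (\<forall>x\<in>U. chi (prod3 t) x \<noteq> 0)"

text \<open>The points of \<open>U\<close> are those at which vanishing has already been excluded.\<close>

definition wsum :: "'x set \<Rightarrow> 'x set \<Rightarrow> int \<Rightarrow> int \<Rightarrow> int \<Rightarrow> ('x \<Rightarrow> real \<Rightarrow> real \<Rightarrow> real \<Rightarrow> real) \<Rightarrow> real"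
  where "wsum U T n1 n2 n3 \<phi> = (\<Sum>t | t \<in> sqtri n1 n2 n3 \<and> nonvan U t. wt T \<phi> t)"

text \<open>The constant is the density of each sign pattern of nonzero values at a point.\<close>

definition avg :: "(real \<Rightarrow> real \<Rightarrow> real \<Rightarrow> real) \<Rightarrow> real" where
  "avg \<phi> = ((real q - 1) / (2 * real q)) ^ 3 *
     (\<Sum>(a, b, c)\<in>{1, -1} \<times> {1, -1} \<times> {1, -1}. \<phi> a b c)"

text \<open>\<open>dens U\<close> is the density of triples whose product has no square factor prime to \<open>U\<close>.\<close>

definition dens_term :: "'x set \<Rightarrow> nat \<Rightarrow> real" where
  "dens_term U j = (\<Sum>E | E \<in> carrier G \<and> deg E = j \<and> (\<forall>x\<in>U. chi E x \<noteq> 0). moebius E * rho E)"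

definition dens :: "'x set \<Rightarrow> real" where
  "dens U = (\<Sum>j. dens_term U j)"

text \<open>The argument 0 is included because members of a triple may vanish at points of
  \<open>T\<close>, and because \<open>wsum_split\<close> multiplies an argument by
  \<open>chi (lin x) y\<close>, which is 0 for y = x.\<close>

definition bounded_wt :: "'x set \<Rightarrow> ('x \<Rightarrow> real \<Rightarrow> real \<Rightarrow> real \<Rightarrow> real) \<Rightarrow> bool" where
  "bounded_wt T \<phi> \<longleftrightarrow> (\<forall>x\<in>T. \<forall>a\<in>{-1, 0, 1}. \<forall>b\<in>{-1, 0, 1}. \<forall>c\<in>{-1, 0, 1}. \<bar>\<phi> x a b c\<bar> \<le> 1)"

lemma abs_wt_le:
  assumes "bounded_wt T \<phi>" "T \<subseteq> Pts" "t \<in> tri n1 n2 n3"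
  shows "\<bar>wt T \<phi> t\<bar> \<le> 1"
proof -
  obtain f g h where t: "t = (f, g, h)" by (cases t)
  have c: "f \<in> carrier G" "g \<in> carrier G" "h \<in> carrier G" using assms t by (auto simp: tri_def)
  have "\<bar>wt T \<phi> t\<bar> = (\<Prod>x\<in>T. \<bar>\<phi> x (chi f x) (chi g x) (chi h x)\<bar>)"
    by (simp add: wt_def t abs_prod)
  also have "\<dots> \<le> 1"
  proof (rule prod_le_1)
    fix x assume x: "x \<in> T"
    then have "x \<in> Pts" using assms by blast
    then have "chi f x \<in> {-1, 0, 1}" "chi g x \<in> {-1, 0, 1}" "chi h x \<in> {-1, 0, 1}"
      using c chi_values by blast+
    then show "0 \<le> \<bar>\<phi> x (chi f x) (chi g x) (chi h x)\<bar> \<and> \<bar>\<phi> x (chi f x) (chi g x) (chi h x)\<bar> \<le> 1"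
      using assms(1) x unfolding bounded_wt_def by (metis abs_ge_zero)
  qed
  finally show ?thesis .
qed

text \<open>Eight sign patterns, each of density at most 1/8.\<close>

lemma abs_avg_le:
  assumes "\<And>a b c. \<lbrakk>a \<in> {1, -1}; b \<in> {1, -1}; c \<in> {1, -1}\<rbrakk> \<Longrightarrow> \<bar>\<phi> a b c\<bar> \<le> 1"
  shows "\<bar>avg \<phi>\<bar> \<le> 1"
proof -
  let ?S = "{1::real, -1} \<times> {1::real, -1} \<times> {1::real, -1}"
  have "\<bar>\<Sum>(a, b, c)\<in>?S. \<phi> a b c\<bar> \<le> (\<Sum>(a, b, c)\<in>?S. \<bar>\<phi> a b c\<bar>)"
    by (rule order_trans[OF sum_abs]) (simp add: case_prod_unfold)
  also have "\<dots> \<le> (\<Sum>s\<in>?S. 1)" using assms by (intro sum_mono) auto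
  also have "\<dots> = 8" by (simp add: card_cartesian_product)
  finally have 1: "\<bar>\<Sum>(a, b, c)\<in>?S. \<phi> a b c\<bar> \<le> 8" .
  have "(real q - 1) / (2 * real q) \<le> 1 / 2" "(real q - 1) / (2 * real q) \<ge> 0"
    using q_ge_3 by (auto simp: field_simps)
  then have 2: "((real q - 1) / (2 * real q)) ^ 3 \<le> (1 / 2) ^ 3" "0 \<le> ((real q - 1) / (2 * real q)) ^ 3"
    by (auto intro: power_mono)
  have "\<bar>avg \<phi>\<bar> = ((real q - 1) / (2 * real q)) ^ 3 * \<bar>\<Sum>(a, b, c)\<in>?S. \<phi> a b c\<bar>"
    unfolding avg_def abs_mult using 2 by simp
  also have "\<dots> \<le> (1 / 2) ^ 3 * 8" using 1 2 by (intro mult_mono) auto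
  finally show ?thesis by (simp add: power3_eq_cube)
qed

text \<open>\<open>equidistribution\<close> without points. The sign and the size of
  \<open>rho\<close> are read off from this count in \<open>rho_nonneg\<close> and
  \<open>sum_rho_le\<close>.\<close>

lemma rho_eq:
  assumes E: "E \<in> carrier G" and "2 * int (deg E) \<le> n1" "2 * int (deg E) \<le> n2" "2 * int (deg E) \<le> n3"
  shows "real (card {t \<in> tri n1 n2 n3. E \<otimes> E divides prod3 t})
    = rho E * real q powr real_of_int (n1 + n2 + n3)"
proof -
  have "{t \<in> tri n1 n2 n3. E \<otimes> E divides prod3 t} = {(f, g, h). f \<in> carrier G \<and> g \<in> carrier G \<and> h \<in> carrier G
        \<and> deg f = nat n1 \<and> deg g = nat n2 \<and> deg h = nat n3 \<and> E \<otimes> E divides f \<otimes> g \<otimes> h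
        \<and> (\<forall>x\<in>{}. (chi f x, chi g x, chi h x) = s x)}" for s
    using assms by (auto simp: tri_def prod3_def)
  then have "real (card {t \<in> tri n1 n2 n3. E \<otimes> E divides prod3 t})
      = rho E * real q ^ (nat n1 + nat n2 + nat n3)"
    using equidistribution[OF E, of "{}" _ "nat n1" "nat n2" "nat n3"] assms by auto
  also have "real q ^ (nat n1 + nat n2 + nat n3) = real q powr real_of_int (n1 + n2 + n3)"
    using assms q_ge_3 by (simp add: powr_realpow[symmetric])
  finally show ?thesis .
qed

lemma rho_nonneg: "E \<in> carrier G \<Longrightarrow> rho E \<ge> 0"
proof -
  assume E: "E \<in> carrier G"
  let ?n = "2 * int (deg E)"
  have "0 \<le> rho E * real q powr real_of_int (?n + ?n + ?n)"
    unfolding rho_eq[OF E order_refl order_refl order_refl, symmetric] by simp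
  moreover have "real q powr real_of_int (?n + ?n + ?n) > 0" using q_ge_3 by simp
  ultimately show ?thesis by (simp only: zero_le_mult_iff) linarith
qed

lemma sum_rho_le: "(\<Sum>E | E \<in> carrier G \<and> deg E = j. rho E) \<le> real (j + 1) ^ 6 / real q ^ j"
proof -
  \<comment> \<open>The smallest degrees at which \<open>rho_eq\<close> applies to every E of degree
    j.\<close>
  let ?n = "2 * int j" and ?N = "2 * int j + 2 * int j + 2 * int j"
  have pos: "real q powr real_of_int ?N > 0" using q_ge_3 by simp
  have "(\<Sum>E | E \<in> carrier G \<and> deg E = j. rho E) * real q powr real_of_int ?N
     = (\<Sum>E | E \<in> carrier G \<and> deg E = j. real (card {t \<in> tri ?n ?n ?n. E \<otimes> E divides prod3 t}))"
    unfolding sum_distrib_right by (rule sum.cong) (auto simp: rho_eq)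
  also have "\<dots> \<le> real (j + 1) ^ 6 / real q ^ j * real q powr real_of_int ?N"
    by (rule sum_card_square_divides_le)
  finally show ?thesis using pos by (simp only: mult_le_cancel_right_pos)
qed

lemma abs_dens_term_le: "\<bar>dens_term U j\<bar> \<le> real (j + 1) ^ 6 / real q ^ j"
proof -
  have "\<bar>dens_term U j\<bar> \<le> (\<Sum>E | E \<in> carrier G \<and> deg E = j \<and> (\<forall>x\<in>U. chi E x \<noteq> 0). \<bar>moebius E * rho E\<bar>)"
    unfolding dens_term_def by (rule sum_abs)
  also have "\<dots> \<le> (\<Sum>E | E \<in> carrier G \<and> deg E = j \<and> (\<forall>x\<in>U. chi E x \<noteq> 0). rho E)"
    using rho_nonneg abs_moebius_le by (intro sum_mono) (auto simp: abs_mult intro: mult_left_le_one_le)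
  also have "\<dots> \<le> (\<Sum>E | E \<in> carrier G \<and> deg E = j. rho E)"
    using rho_nonneg finite_deg by (intro sum_mono2) auto
  also have "\<dots> \<le> real (j + 1) ^ 6 / real q ^ j" by (rule sum_rho_le)
  finally show ?thesis .
qed

text \<open>With q^(-j) split into powers with exponents -\<epsilon> j and -(1 - \<epsilon>) j, the
  first factor pays for convergence uniformly in q and the second becomes the error as soon as 2 j
  reaches \<open>i\<close>. The index \<open>i\<close> is an integer since it will be a minimum of
  degrees less a number of points, which may be negative.\<close>

lemma q_tail_le:
  assumes "0 < \<epsilon>" "\<epsilon> < 1" "real_of_int i \<le> 2 * real j"
  shows "real (j + 1) ^ 6 / real q ^ j
    \<le> real (j + 1) ^ 6 * 3 powr (- \<epsilon> * real j) * real q powr (- ((1 - \<epsilon>) / 2) * real_of_int i)"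
proof -
  have "1 / real q ^ j = real q powr (- real j)"
    using q_ge_3 by (simp add: powr_minus powr_realpow divide_inverse)
  also have "- real j = - \<epsilon> * real j + - (1 - \<epsilon>) * real j" by (simp add: algebra_simps)
  also have "real q powr \<dots> = real q powr (- \<epsilon> * real j) * real q powr (- (1 - \<epsilon>) * real j)"
    by (rule powr_add)
  also have "\<dots> \<le> 3 powr (- \<epsilon> * real j) * real q powr (- ((1 - \<epsilon>) / 2) * real_of_int i)"
  proof (rule mult_mono)
    show "real q powr (- \<epsilon> * real j) \<le> 3 powr (- \<epsilon> * real j)"
      using assms q_ge_3 by (intro powr_mono2') auto
    have "(1 - \<epsilon>) / 2 * real_of_int i \<le> (1 - \<epsilon>) / 2 * (2 * real j)"
      using assms by (intro mult_left_mono) auto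
    then have "- (1 - \<epsilon>) * real j \<le> - ((1 - \<epsilon>) / 2) * real_of_int i" by (simp add: field_simps)
    then show "real q powr (- (1 - \<epsilon>) * real j) \<le> real q powr (- ((1 - \<epsilon>) / 2) * real_of_int i)"
      using q_ge_3 by (intro powr_mono) auto
  qed auto
  finally have "real (j + 1) ^ 6 * (1 / real q ^ j) \<le> real (j + 1) ^ 6 *
    (3 powr (- \<epsilon> * real j) * real q powr (- ((1 - \<epsilon>) / 2) * real_of_int i))"
    by (rule mult_left_mono) simp
  then show ?thesis by (simp add: mult.assoc)
qed

lemma summable_dens_term: "summable (dens_term U)"
proof (rule summable_comparison_test)
  \<comment> \<open>For \<open>i = 0\<close> the power of q in \<open>q_tail_le\<close> is 1, and
    the choice 1/2 for \<epsilon> is arbitrary.\<close>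
  have "\<bar>dens_term U j\<bar> \<le> real (j + 1) ^ 6 * 3 powr (- (1/2) * real j)" for j
    using abs_dens_term_le[of U j] q_tail_le[of "1/2" 0 j] q_ge_3 by simp
  then show "\<exists>N. \<forall>n\<ge>N. norm (dens_term U n) \<le> real (n + 1) ^ 6 * 3 powr (- (1/2) * real n)" by auto
  show "summable (\<lambda>n. real (n + 1) ^ 6 * 3 powr (- (1/2) * real n))"
    using summable_tail_const[of "1/2"] by simp
qed

lemma chi_prod3:
  "\<lbrakk>(f, g, h) \<in> tri n1 n2 n3; x \<in> Pts\<rbrakk> \<Longrightarrow> chi (prod3 (f, g, h)) x = chi f x * chi g x * chi h x"
  by (auto simp: prod3_def tri_def chi_mult)

text \<open>The triples are sorted by their sign patterns on \<open>T\<close>. By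
  \<open>equidistribution\<close> all patterns occur equally often, so the sum of the weights over
  the patterns factors into local averages.\<close>

lemma sum_wt_square_divides:
  assumes E: "E \<in> carrier G" and T: "T \<subseteq> Pts" and nz: "\<And>x. x \<in> T \<Longrightarrow> chi E x \<noteq> 0"
    and n: "2 * int (deg E) + int (card T) \<le> n1" "2 * int (deg E) + int (card T) \<le> n2"
      "2 * int (deg E) + int (card T) \<le> n3"
  shows "(\<Sum>t | t \<in> tri n1 n2 n3 \<and> E \<otimes> E divides prod3 t \<and> nonvan T t. wt T \<phi> t)
    = rho E * real q powr real_of_int (n1 + n2 + n3) * (\<Prod>x\<in>T. avg (\<phi> x))"
proof -
  let ?S = "{1::real, -1} \<times> {1::real, -1} \<times> {1::real, -1}"
  let ?A = "{t. t \<in> tri n1 n2 n3 \<and> E \<otimes> E divides prod3 t \<and> nonvan T t}"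
  let ?sig = "\<lambda>(f, g, h). restrict (\<lambda>x. (chi f x, chi g x, chi h x)) T"
  let ?p = "\<lambda>s::'x \<Rightarrow> real \<times> real \<times> real. \<Prod>x\<in>T. (\<lambda>(a, b, c). \<phi> x a b c) (s x)"
  let ?c = "(real q - 1) / (2 * real q)"
  have finT: "finite T" using T finite_Pts finite_subset by blast
  have finA: "finite ?A" by (rule finite_subset[OF _ finite_tri]) auto
  have sig: "?sig ` ?A \<subseteq> PiE T (\<lambda>_. ?S)"
  proof
    fix s assume "s \<in> ?sig ` ?A"
    then obtain f g h where t: "(f, g, h) \<in> ?A" and s: "s = ?sig (f, g, h)" by auto
    have c: "f \<in> carrier G" "g \<in> carrier G" "h \<in> carrier G" using t by (auto simp: tri_def)
    have "(chi f x, chi g x, chi h x) \<in> ?S" if x: "x \<in> T" for x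
    proof -
      have xP: "x \<in> Pts" using x T by blast
      have "chi f x * chi g x * chi h x \<noteq> 0"
        using t x xP chi_prod3 by (fastforce simp: nonvan_def)
      then show ?thesis using chi_values[OF c(1) xP] chi_values[OF c(2) xP] chi_values[OF c(3) xP] by auto
    qed
    then show "s \<in> PiE T (\<lambda>_. ?S)" unfolding s by auto
  qed
  have "(\<Sum>t\<in>?A. wt T \<phi> t) = (\<Sum>s\<in>PiE T (\<lambda>_. ?S). \<Sum>t\<in>{t \<in> ?A. ?sig t = s}. wt T \<phi> t)"
    by (rule sum.group[symmetric]) (use finA finT sig in \<open>auto intro: finite_PiE\<close>)
  also have "\<dots> = (\<Sum>s\<in>PiE T (\<lambda>_. ?S). \<Sum>t\<in>{t \<in> ?A. ?sig t = s}. ?p s)"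
    by (intro sum.cong refl) (auto simp: wt_def intro!: prod.cong)
  also have "\<dots> = (\<Sum>s\<in>PiE T (\<lambda>_. ?S). rho E * real q powr real_of_int (n1 + n2 + n3) * ?c ^ (3 * card T) * ?p s)"
  proof (intro sum.cong refl)
    fix s assume s: "s \<in> PiE T (\<lambda>_. ?S)"
    have eq: "{t \<in> ?A. ?sig t = s} = {(f, g, h). f \<in> carrier G \<and> g \<in> carrier G \<and> h \<in> carrier G
        \<and> deg f = nat n1 \<and> deg g = nat n2 \<and> deg h = nat n3 \<and> E \<otimes> E divides f \<otimes> g \<otimes> h
        \<and> (\<forall>x\<in>T. (chi f x, chi g x, chi h x) = s x)}" (is "?L = ?R")
    proof (intro equalityI subsetI)
      fix t assume "t \<in> ?L"
      then show "t \<in> ?R" by (auto simp: tri_def prod3_def)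
    next
      fix t assume t: "t \<in> ?R"
      obtain f g h where fgh: "t = (f, g, h)" by (cases t)
      have tri: "(f, g, h) \<in> tri n1 n2 n3" using t n unfolding fgh tri_def by auto
      have "nonvan T (f, g, h)" unfolding nonvan_def
      proof
        fix x assume x: "x \<in> T"
        have "s x \<in> ?S" using s x by blast
        moreover have "(chi f x, chi g x, chi h x) = s x" using t x unfolding fgh by blast
        ultimately have "(chi f x, chi g x, chi h x) \<in> ?S" by simp
        then have "chi f x \<noteq> 0 \<and> chi g x \<noteq> 0 \<and> chi h x \<noteq> 0" by auto
        then show "chi (prod3 (f, g, h)) x \<noteq> 0" using chi_prod3[OF tri] x T by auto
      qed
      moreover have "?sig (f, g, h) = s"
        using t s unfolding fgh by (auto simp: fun_eq_iff PiE_def extensional_def)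
      ultimately show "t \<in> ?L" using t tri unfolding fgh by (simp add: prod3_def)
    qed
    have sv: "s x \<in> {1, - 1} \<times> {1, - 1} \<times> {1, - 1}" if "x \<in> T" for x using s that by blast
    have "real (card {t \<in> ?A. ?sig t = s}) = rho E * real q ^ (nat n1 + nat n2 + nat n3) * ?c ^ (3 * card T)"
      unfolding eq by (rule equidistribution[OF E T nz sv]) (use n in auto)
    also have "real q ^ (nat n1 + nat n2 + nat n3) = real q powr real_of_int (n1 + n2 + n3)"
      using n q_ge_3 by (simp add: powr_realpow[symmetric])
    finally have count: "real (card {t \<in> ?A. ?sig t = s})
      = rho E * real q powr real_of_int (n1 + n2 + n3) * ?c ^ (3 * card T)" .
    show "(\<Sum>t\<in>{t \<in> ?A. ?sig t = s}. ?p s)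
        = rho E * real q powr real_of_int (n1 + n2 + n3) * ?c ^ (3 * card T) * ?p s"
      by (simp only: sum_constant count)
  qed
  also have "\<dots> = rho E * real q powr real_of_int (n1 + n2 + n3) * (?c ^ (3 * card T) * (\<Sum>s\<in>PiE T (\<lambda>_. ?S). ?p s))"
    by (simp add: sum_distrib_left mult.assoc)
  also have "(\<Sum>s\<in>PiE T (\<lambda>_. ?S). ?p s) = (\<Prod>x\<in>T. \<Sum>s\<in>?S. (\<lambda>(a, b, c). \<phi> x a b c) s)"
    by (rule prod_sum_PiE[symmetric]) (use finT in auto)
  also have "?c ^ (3 * card T) * \<dots> = (\<Prod>x\<in>T. avg (\<phi> x))"
    unfolding avg_def prod.distrib by (simp add: power_mult)
  finally show ?thesis .
qed

text \<open>The indicator of squarefreeness is replaced by the Moebius sum and the summations are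
  interchanged. Grouping the E by degree allows a comparison with the series \<open>dens\<close>
  term by term; the range of \<open>j\<close> is generous, as E^2 dividing the product already
  bounds 2 deg E by the total degree.\<close>

lemma wsum_eq_sum_moebius:
  "wsum U T n1 n2 n3 \<phi> = (\<Sum>j\<le>nat (n1 + n2 + n3). \<Sum>E | E \<in> carrier G \<and> deg E = j.
     moebius E * (\<Sum>t | t \<in> tri n1 n2 n3 \<and> E \<otimes> E divides prod3 t \<and> nonvan U t. wt T \<phi> t))"
proof -
  let ?B = "{t \<in> tri n1 n2 n3. nonvan U t}"
  let ?C = "{E \<in> carrier G. deg E \<le> nat (n1 + n2 + n3)}"
  have finB: "finite ?B" using finite_tri by simp
  have "wsum U T n1 n2 n3 \<phi> = (\<Sum>t\<in>?B. of_bool (sqfree (prod3 t)) * wt T \<phi> t)"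
    unfolding wsum_def by (rule sum.mono_neutral_cong_left) (use finB in \<open>auto simp: sqtri_def\<close>)
  also have "\<dots> = (\<Sum>t\<in>?B. \<Sum>E\<in>?C. if E \<otimes> E divides prod3 t then moebius E * wt T \<phi> t else 0)"
  proof (intro sum.cong refl)
    fix t assume t: "t \<in> ?B"
    then have F: "prod3 t \<in> carrier G" using prod3_closed by blast
    have sub: "{E \<in> carrier G. E \<otimes> E divides prod3 t} \<subseteq> ?C"
    proof
      fix E assume E: "E \<in> {E \<in> carrier G. E \<otimes> E divides prod3 t}"
      then have "deg (E \<otimes> E) \<le> deg (prod3 t)" using F deg_divides by simp
      then show "E \<in> ?C" using E t deg_prod3[of t n1 n2 n3] by (auto simp: deg_mult)
    qed
    have "of_bool (sqfree (prod3 t)) * wt T \<phi> t = (\<Sum>E | E \<in> carrier G \<and> E \<otimes> E divides prod3 t. moebius E * wt T \<phi> t)"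
      unfolding sum_moebius_square_divisors[OF F, symmetric] sum_distrib_right ..
    also have "\<dots> = (\<Sum>E\<in>?C. if E \<otimes> E divides prod3 t then moebius E * wt T \<phi> t else 0)"
      by (rule sum.mono_neutral_cong_left) (use sub finite_deg_le in auto)
    finally show "of_bool (sqfree (prod3 t)) * wt T \<phi> t = \<dots>" .
  qed
  also have "\<dots> = (\<Sum>E\<in>?C. \<Sum>t\<in>?B. if E \<otimes> E divides prod3 t then moebius E * wt T \<phi> t else 0)"
    by (rule sum.swap)
  also have "\<dots> = (\<Sum>E\<in>?C. moebius E * (\<Sum>t | t \<in> tri n1 n2 n3 \<and> E \<otimes> E divides prod3 t \<and> nonvan U t. wt T \<phi> t))"
  proof (intro sum.cong refl)
    fix E
    show "(\<Sum>t\<in>?B. if E \<otimes> E divides prod3 t then moebius E * wt T \<phi> t else 0) = moebius E *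
      (\<Sum>t | t \<in> tri n1 n2 n3 \<and> E \<otimes> E divides prod3 t \<and> nonvan U t. wt T \<phi> t)"
      unfolding sum_distrib_left by (rule sum.mono_neutral_cong_right) (use finB in auto)
  qed
  also have "?C = (\<Union>j\<le>nat (n1 + n2 + n3). {E \<in> carrier G. deg E = j})" by auto
  also have "(\<Sum>E\<in>\<dots>. moebius E * (\<Sum>t | t \<in> tri n1 n2 n3 \<and> E \<otimes> E divides prod3 t \<and> nonvan U t. wt T \<phi> t))
    = (\<Sum>j\<le>nat (n1 + n2 + n3). \<Sum>E | E \<in> carrier G \<and> deg E = j.
     moebius E * (\<Sum>t | t \<in> tri n1 n2 n3 \<and> E \<otimes> E divides prod3 t \<and> nonvan U t. wt T \<phi> t))"
    by (rule sum.UNION_disjoint) (use finite_deg in auto)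
  finally show ?thesis .
qed

lemma wsum_estimate_nonvanishing:
  assumes eps: "0 < \<epsilon>" "\<epsilon> < 1" and T: "T \<subseteq> Pts" and bd: "bounded_wt T \<phi>"
  shows "\<bar>wsum T T n1 n2 n3 \<phi> / real q powr real_of_int (n1 + n2 + n3) - dens T * (\<Prod>x\<in>T. avg (\<phi> x))\<bar>
    \<le> 2 * tail_const \<epsilon> * real q powr (- ((1 - \<epsilon>) / 2) * real_of_int (min n1 (min n2 n3) - int (card T)))"
proof -
  define i where "i = min n1 (min n2 n3) - int (card T)"
  define Q where "Q = real q powr real_of_int (n1 + n2 + n3)"
  define P where "P = (\<Prod>x\<in>T. avg (\<phi> x))"
  define \<delta> where "\<delta> = real q powr (- ((1 - \<epsilon>) / 2) * real_of_int i)"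
  define u where "u = (\<lambda>j. real (j + 1) ^ 6 * 3 powr (- \<epsilon> * real j))"
  let ?A = "\<lambda>E. {t. t \<in> tri n1 n2 n3 \<and> E \<otimes> E divides prod3 t \<and> nonvan T t}"
  define al where "al = (\<lambda>j. \<Sum>E | E \<in> carrier G \<and> deg E = j. moebius E * (\<Sum>t\<in>?A E. wt T \<phi> t))"
  have Q: "Q > 0" unfolding Q_def using q_ge_3 by simp
  have finT: "finite T" using T finite_Pts finite_subset by blast
  have finA: "finite (?A E)" for E by (rule finite_subset[OF _ finite_tri]) auto
  have P: "\<bar>P\<bar> \<le> 1"
    unfolding P_def abs_prod using bd by (intro prod_le_1) (auto intro!: abs_avg_le simp: bounded_wt_def)
  \<comment> \<open>Equidistribution is silent about an E that vanishes at a point of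
    \<open>T\<close>, but such an E contributes nothing: the product would vanish at that point too.
    This is why \<open>dens T\<close> skips these E.\<close>
  have van: "(\<Sum>t\<in>?A E. wt T \<phi> t) = 0" if "E \<in> carrier G" "x \<in> T" "chi E x = 0" for E x
  proof -
    have "?A E = {}"
    proof (rule ccontr)
      assume "?A E \<noteq> {}"
      then obtain t where t: "t \<in> tri n1 n2 n3" "E \<otimes> E divides prod3 t" "nonvan T t" by auto
      then obtain c where c: "c \<in> carrier G" "prod3 t = E \<otimes> E \<otimes> c" by (auto elim: dividesE')
      have "chi (prod3 t) x = 0" using c that T by (auto simp: chi_mult)
      then show False using t that by (auto simp: nonvan_def)
    qed
    then show ?thesis by (simp only: sum.empty)
  qed
  \<comment> \<open>the terms with \<open>2 deg E \<le> i\<close> are exact (\<open>al_eq\<close>), all others belong to the tail (\<open>al_le\<close>)\<close>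
  have al_le: "\<bar>al j / Q\<bar> \<le> real (j + 1) ^ 6 / real q ^ j" for j
  proof -
    have "\<bar>al j\<bar> \<le> (\<Sum>E | E \<in> carrier G \<and> deg E = j. real (card {t \<in> tri n1 n2 n3. E \<otimes> E divides prod3 t}))"
      unfolding al_def
    proof (rule order_trans[OF sum_abs], rule sum_mono)
      fix E assume "E \<in> {E \<in> carrier G. deg E = j}"
      have "\<bar>\<Sum>t\<in>?A E. wt T \<phi> t\<bar> \<le> (\<Sum>t\<in>?A E. \<bar>wt T \<phi> t\<bar>)" by (rule sum_abs)
      also have "\<dots> \<le> (\<Sum>t\<in>?A E. 1)" using abs_wt_le[OF bd T] by (intro sum_mono) auto
      also have "\<dots> = real (card (?A E))" by simp
      also have "\<dots> \<le> real (card {t \<in> tri n1 n2 n3. E \<otimes> E divides prod3 t})"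
        using finite_tri by (intro of_nat_mono card_mono) auto
      finally have "\<bar>\<Sum>t\<in>?A E. wt T \<phi> t\<bar> \<le> real (card {t \<in> tri n1 n2 n3. E \<otimes> E divides prod3 t})" .
      moreover have "\<bar>moebius E * (\<Sum>t\<in>?A E. wt T \<phi> t)\<bar> \<le> \<bar>\<Sum>t\<in>?A E. wt T \<phi> t\<bar>"
        unfolding abs_mult using abs_moebius_le by (intro mult_left_le_one_le) auto
      ultimately show "\<bar>moebius E * (\<Sum>t\<in>?A E. wt T \<phi> t)\<bar> \<le> real (card {t \<in> tri n1 n2 n3. E \<otimes> E divides prod3 t})"
        by linarith
    qed
    also have "\<dots> \<le> real (j + 1) ^ 6 / real q ^ j * Q"
      unfolding Q_def by (rule sum_card_square_divides_le)
    finally show ?thesis using Q by (simp add: pos_divide_le_eq)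
  qed
  have al_eq: "al j / Q = dens_term T j * P" if j: "2 * int j \<le> i" for j
  proof -
    have "al j = (\<Sum>E | E \<in> carrier G \<and> deg E = j \<and> (\<forall>x\<in>T. chi E x \<noteq> 0). moebius E * (\<Sum>t\<in>?A E. wt T \<phi> t))"
      unfolding al_def by (rule sum.mono_neutral_right) (use finite_deg van in auto)
    also have "\<dots> = (\<Sum>E | E \<in> carrier G \<and> deg E = j \<and> (\<forall>x\<in>T. chi E x \<noteq> 0). moebius E * rho E * (Q * P))"
      unfolding Q_def P_def
      by (intro sum.cong refl, subst sum_wt_square_divides) (use T j in \<open>auto simp: i_def\<close>)
    also have "\<dots> = dens_term T j * P * Q" unfolding dens_term_def sum_distrib_right by (simp add: mult_ac)
    finally show ?thesis using Q by simp
  qed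
  \<comment> \<open>Beyond the exact range the two series are unrelated; the factor 2 pays for one
    tail term of each.\<close>
  have term_le: "\<bar>al j / Q - dens_term T j * P\<bar> \<le> 2 * u j * \<delta>" for j
  proof (cases "2 * int j \<le> i")
    case True
    then show ?thesis by (simp add: al_eq u_def \<delta>_def)
  next
    case False
    then have "real_of_int i \<le> 2 * real j" by linarith
    from q_tail_le[OF eps this] have le: "real (j + 1) ^ 6 / real q ^ j \<le> u j * \<delta>"
      by (simp add: u_def \<delta>_def)
    have "\<bar>dens_term T j * P\<bar> \<le> \<bar>dens_term T j\<bar>"
      unfolding abs_mult using P by (intro mult_right_le_one_le) auto
    then show ?thesis using al_le[of j] abs_dens_term_le[of T j] le by linarith
  qed
  have al_0: "al j = 0" if "j > nat (n1 + n2 + n3)" for j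
  proof -
    have "?A E = {}" if E: "E \<in> carrier G" "deg E = j" for E
    proof (rule ccontr)
      assume "?A E \<noteq> {}"
      then obtain t where t: "t \<in> tri n1 n2 n3" "E \<otimes> E divides prod3 t" by auto
      then have "deg (E \<otimes> E) \<le> deg (prod3 t)" using E prod3_closed deg_divides by simp
      then show False using E \<open>j > _\<close> deg_prod3[OF t(1)] by (simp add: deg_mult)
    qed
    then show ?thesis unfolding al_def by (intro sum.neutral ballI) (simp only: mem_Collect_eq sum.empty mult_zero_right)
  qed
  have al_sums: "(\<lambda>j. al j / Q) sums (wsum T T n1 n2 n3 \<phi> / Q)"
  proof -
    have "(\<lambda>j. al j / Q) sums (\<Sum>j\<le>nat (n1 + n2 + n3). al j / Q)"
      by (rule sums_finite) (use al_0 in auto)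
    then show ?thesis unfolding wsum_eq_sum_moebius al_def by (simp add: sum_divide_distrib)
  qed
  have dens_sums: "(\<lambda>j. dens_term T j * P) sums (dens T * P)"
    unfolding dens_def by (intro sums_mult2 summable_sums summable_dens_term)
  have diff: "(\<lambda>j. al j / Q - dens_term T j * P) sums (wsum T T n1 n2 n3 \<phi> / Q - dens T * P)"
    by (rule sums_diff[OF al_sums dens_sums])
  have u_sums: "(\<lambda>j. 2 * u j * \<delta>) sums (2 * tail_const \<epsilon> * \<delta>)"
    unfolding u_def tail_const_def
    by (intro sums_mult2 sums_mult summable_sums summable_tail_const eps)
  have "norm (\<Sum>j. al j / Q - dens_term T j * P) \<le> (\<Sum>j. 2 * u j * \<delta>)"
    by (rule norm_suminf_le) (use term_le u_sums in \<open>auto simp: sums_iff\<close>)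
  then show ?thesis
    using sums_unique[OF diff] sums_unique[OF u_sums] by (simp add: Q_def P_def \<delta>_def i_def)
qed

section \<open>Local factors\<close>

text \<open>The last three terms come from the triples in which exactly one member vanishes at the point.\<close>

definition loc :: "(real \<Rightarrow> real \<Rightarrow> real \<Rightarrow> real) \<Rightarrow> real" where
  "loc \<phi> = avg \<phi> + (avg (\<lambda>a b c. \<phi> 0 b c) + avg (\<lambda>a b c. \<phi> a 0 c) + avg (\<lambda>a b c. \<phi> a b 0)) / real q"

lemma avg_expand:
  "avg \<phi> = ((real q - 1) / (2 * real q)) ^ 3 *
    (\<phi> 1 1 1 + \<phi> 1 1 (-1) + \<phi> 1 (-1) 1 + \<phi> 1 (-1) (-1)
     + \<phi> (-1) 1 1 + \<phi> (-1) 1 (-1) + \<phi> (-1) (-1) 1 + \<phi> (-1) (-1) (-1))"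
  unfolding avg_def sum.cartesian_product[symmetric] by simp

text \<open>Sign changes permute the eight patterns. They occur because splitting off t - x
  multiplies the character values at the other points by the signs
  \<open>chi (lin x) y\<close>.\<close>

lemma avg_scale:
  assumes "s \<in> {1, -1}"
  shows "avg (\<lambda>a b c. \<phi> (s * a) b c) = avg \<phi>" "avg (\<lambda>a b c. \<phi> a (s * b) c) = avg \<phi>"
    "avg (\<lambda>a b c. \<phi> a b (s * c)) = avg \<phi>"
  using assms by (auto simp: avg_expand)

lemma loc_scale:
  assumes "s \<in> {1, -1}"
  shows "loc (\<lambda>a b c. \<phi> (s * a) b c) = loc \<phi>" "loc (\<lambda>a b c. \<phi> a (s * b) c) = loc \<phi>"
    "loc (\<lambda>a b c. \<phi> a b (s * c)) = loc \<phi>"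
  using assms by (auto simp: loc_def avg_expand add_ac)

section \<open>Splitting off a linear factor\<close>

lemma prime_elt_lin: "x \<in> Pts \<Longrightarrow> prime_elt (lin x)"
  unfolding prime_elt_def
proof (intro conjI ballI impI)
  assume x: "x \<in> Pts"
  show "lin x \<in> carrier G" using x lin_closed by blast
  show "lin x \<noteq> \<one>" using deg_lin[OF x] deg_one by auto
  fix a b assume ab: "a \<in> carrier G" "b \<in> carrier G" "lin x = a \<otimes> b"
  have "deg a + deg b = 1" using deg_mult[OF ab(1,2)] deg_lin[OF x] ab(3) by simp
  then have "deg a = 0 \<or> deg b = 0" by linarith
  then show "a = \<one> \<or> b = \<one>" using ab deg_0 by blast
qed

text \<open>Here \<open>m\<close> multiplies one member by t - x and \<open>cond\<close> says that
  this member vanishes at x. Squarefreeness forbids the smaller product to vanish at x again, and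
  therefore x joins the excluded points on the left. Leaving \<open>m\<close> and
  \<open>cond\<close> open lets one proof serve all three members.\<close>

lemma bij_betw_lin_factor:
  assumes x: "x \<in> Pts" "x \<notin> U" and U: "U \<subseteq> Pts"
    and bij: "bij_betw m (tri a1 a2 a3) {t \<in> tri n1 n2 n3. cond t}"
    and prod: "\<And>t. t \<in> tri a1 a2 a3 \<Longrightarrow> prod3 (m t) = lin x \<otimes> prod3 t"
  shows "bij_betw m {t. t \<in> sqtri a1 a2 a3 \<and> nonvan (insert x U) t}
    {t. t \<in> sqtri n1 n2 n3 \<and> nonvan U t \<and> cond t}"
proof (rule bij_betw_subset[OF bij])
  have iff: "(sqfree (prod3 (m t)) \<and> nonvan U (m t)) \<longleftrightarrow> (sqfree (prod3 t) \<and> nonvan (insert x U) t)"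
    if t: "t \<in> tri a1 a2 a3" for t
  proof -
    have F: "prod3 t \<in> carrier G" using t prod3_closed by blast
    have "sqfree (prod3 (m t)) \<longleftrightarrow> sqfree (prod3 t) \<and> chi (prod3 t) x \<noteq> 0"
      using prod[OF t] sqfree_prime_elt_mult_iff[OF prime_elt_lin[OF x(1)] F] chi_eq_0_iff[OF F x(1)] by simp
    moreover have "nonvan U (m t) \<longleftrightarrow> nonvan U t"
      unfolding nonvan_def prod[OF t]
    proof (intro ball_cong refl)
      fix y assume y: "y \<in> U"
      have "chi (lin x \<otimes> prod3 t) y = chi (lin x) y * chi (prod3 t) y"
        using F x y U lin_closed by (intro chi_mult) auto
      moreover have "chi (lin x) y \<noteq> 0" using x y U by (intro chi_lin) auto
      ultimately show "(chi (lin x \<otimes> prod3 t) y \<noteq> 0) = (chi (prod3 t) y \<noteq> 0)" by simp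
    qed
    ultimately show ?thesis by (auto simp: nonvan_def)
  qed
  show "{t. t \<in> sqtri a1 a2 a3 \<and> nonvan (insert x U) t} \<subseteq> tri a1 a2 a3" by (auto simp: sqtri_def)
  have img: "m ` tri a1 a2 a3 = {t \<in> tri n1 n2 n3. cond t}" using bij by (simp add: bij_betw_def)
  show "m ` {t. t \<in> sqtri a1 a2 a3 \<and> nonvan (insert x U) t}
    = {t. t \<in> sqtri n1 n2 n3 \<and> nonvan U t \<and> cond t}" (is "?L = ?R")
  proof (intro equalityI subsetI)
    fix y assume "y \<in> ?L"
    then obtain t where t: "t \<in> tri a1 a2 a3" "sqfree (prod3 t)" "nonvan (insert x U) t" "y = m t"
      by (auto simp: sqtri_def)
    then show "y \<in> ?R" using iff[OF t(1)] img by (auto simp: sqtri_def)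
  next
    fix y assume y: "y \<in> ?R"
    then have "y \<in> m ` tri a1 a2 a3" using img by (auto simp: sqtri_def)
    then obtain t where t: "t \<in> tri a1 a2 a3" "y = m t" by blast
    then show "y \<in> ?L" using iff[OF t(1)] y by (auto simp: sqtri_def)
  qed
qed

lemma bij_betw_mult_deg:
  assumes "p \<in> carrier G"
  shows "bij_betw (\<lambda>f. p \<otimes> f) {f \<in> carrier G. int (deg f) = n - int (deg p)}
    {f \<in> {f \<in> carrier G. int (deg f) = n}. p divides f}"
proof (rule bij_betw_imageI)
  show "inj_on (\<lambda>f. p \<otimes> f) {f \<in> carrier G. int (deg f) = n - int (deg p)}"
    using assms l_cancel by (auto simp: inj_on_def)
  show "(\<lambda>f. p \<otimes> f) ` {f \<in> carrier G. int (deg f) = n - int (deg p)}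
    = {f \<in> {f \<in> carrier G. int (deg f) = n}. p divides f}" (is "?L = ?R")
  proof (intro equalityI subsetI)
    fix f assume "f \<in> ?L"
    then show "f \<in> ?R" using assms by (auto simp: deg_mult intro: dividesI')
  next
    fix f assume f: "f \<in> ?R"
    then obtain c where "c \<in> carrier G" "f = p \<otimes> c" by (auto elim: dividesE')
    then show "f \<in> ?L" using f assms by (auto simp: deg_mult)
  qed
qed

text \<open>In a squarefree product at most one member vanishes at x, so the four cases (none, or
  exactly one of three) are disjoint. In the last three the factor t - x is taken out of the
  vanishing member, which lowers its degree and changes its character at every y by
  \<open>chi (lin x) y\<close>. At y = x this factor is 0, so the weight at x still sees the value 0
  that the original member had there.\<close>

lemma wsum_split:
  assumes x: "x \<in> Pts" "x \<notin> U" and U: "U \<subseteq> Pts" and T: "T \<subseteq> Pts"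
  shows "wsum U T n1 n2 n3 \<phi> = wsum (insert x U) T n1 n2 n3 \<phi>
    + wsum (insert x U) T (n1 - 1) n2 n3 (\<lambda>y a b c. \<phi> y (chi (lin x) y * a) b c)
    + wsum (insert x U) T n1 (n2 - 1) n3 (\<lambda>y a b c. \<phi> y a (chi (lin x) y * b) c)
    + wsum (insert x U) T n1 n2 (n3 - 1) (\<lambda>y a b c. \<phi> y a b (chi (lin x) y * c))"
proof -
  let ?L = "lin x"
  have Lc: "?L \<in> carrier G" using x lin_closed by blast
  have pL: "prime_elt ?L" using prime_elt_lin x by blast
  let ?S = "\<lambda>P. {t. t \<in> sqtri n1 n2 n3 \<and> nonvan U t \<and> P t}"
  let ?d1 = "\<lambda>t::'m \<times> 'm \<times> 'm. ?L divides fst t"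
  let ?d2 = "\<lambda>t::'m \<times> 'm \<times> 'm. ?L divides fst (snd t)"
  let ?d3 = "\<lambda>t::'m \<times> 'm \<times> 'm. ?L divides snd (snd t)"
  have fin: "finite (?S P)" for P by (rule finite_subset[OF _ finite_sqtri[of n1 n2 n3]]) auto
  have chi_x: "chi (prod3 t) x = 0 \<longleftrightarrow> ?d1 t \<or> ?d2 t \<or> ?d3 t" if "t \<in> tri n1 n2 n3" for t
  proof -
    obtain f g h where t: "t = (f, g, h)" by (cases t)
    have "f \<in> carrier G" "g \<in> carrier G" "h \<in> carrier G" using that t by (auto simp: tri_def)
    then show ?thesis using x pL unfolding t
      by (auto simp: prod3_def chi_eq_0_iff prime_elt_dvd_mult_iff)
  qed
  have two: "\<not> (?L divides a \<and> ?L divides b)"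
    if sq: "sqfree F" and ab: "a \<in> carrier G" "b \<in> carrier G" "c \<in> carrier G" "F = a \<otimes> b \<otimes> c" for a b c F
  proof
    assume "?L divides a \<and> ?L divides b"
    then obtain a' b' where ab': "a' \<in> carrier G" "a = ?L \<otimes> a'" "b' \<in> carrier G" "b = ?L \<otimes> b'"
      by (auto elim!: dividesE')
    have "F = ?L \<otimes> ?L \<otimes> (a' \<otimes> b' \<otimes> c)" using ab ab' Lc by (simp add: m_ac)
    then have "?L \<otimes> ?L divides F" using ab ab' by (auto intro: dividesI')
    then have "?L = \<one>" using sq Lc unfolding sqfree_def by blast
    then show False using deg_lin[OF x(1)] deg_one by simp
  qed
  have excl: "\<not> (?d1 t \<and> ?d2 t)" "\<not> (?d1 t \<and> ?d3 t)" "\<not> (?d2 t \<and> ?d3 t)" if "t \<in> sqtri n1 n2 n3" for t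
  proof -
    obtain f g h where t: "t = (f, g, h)" by (cases t)
    have c: "f \<in> carrier G" "g \<in> carrier G" "h \<in> carrier G" and sq: "sqfree (f \<otimes> g \<otimes> h)"
      using that t by (auto simp: sqtri_def tri_def prod3_def)
    show "\<not> (?d1 t \<and> ?d2 t)" using two[OF sq c(1,2,3)] t by simp
    show "\<not> (?d1 t \<and> ?d3 t)" using two[OF sq c(1,3,2)] t c by (simp add: m_ac)
    show "\<not> (?d2 t \<and> ?d3 t)" using two[OF sq c(2,3,1)] t c by (simp add: m_ac)
  qed
  have S0: "{t. t \<in> sqtri n1 n2 n3 \<and> nonvan (insert x U) t} = ?S (\<lambda>t. \<not> (?d1 t \<or> ?d2 t \<or> ?d3 t))"
    using chi_x by (auto simp: nonvan_def sqtri_def)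
  have "{t. t \<in> sqtri n1 n2 n3 \<and> nonvan U t}
      = ?S (\<lambda>t. \<not> (?d1 t \<or> ?d2 t \<or> ?d3 t)) \<union> (?S ?d1 \<union> (?S ?d2 \<union> ?S ?d3))" by blast
  then have "wsum U T n1 n2 n3 \<phi> = sum (wt T \<phi>) (?S (\<lambda>t. \<not> (?d1 t \<or> ?d2 t \<or> ?d3 t)) \<union> (?S ?d1 \<union> (?S ?d2 \<union> ?S ?d3)))"
    unfolding wsum_def by simp
  also have "\<dots> = sum (wt T \<phi>) (?S (\<lambda>t. \<not> (?d1 t \<or> ?d2 t \<or> ?d3 t)))
      + (sum (wt T \<phi>) (?S ?d1) + (sum (wt T \<phi>) (?S ?d2) + sum (wt T \<phi>) (?S ?d3)))"
  proof -
    have fins: "finite (?S ?d1 \<union> (?S ?d2 \<union> ?S ?d3))" "finite (?S ?d2 \<union> ?S ?d3)" by (intro finite_UnI fin)+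
    have "?S (\<lambda>t. \<not> (?d1 t \<or> ?d2 t \<or> ?d3 t)) \<inter> (?S ?d1 \<union> (?S ?d2 \<union> ?S ?d3)) = {}" by blast
    moreover have "?S ?d1 \<inter> (?S ?d2 \<union> ?S ?d3) = {}" using excl by blast
    moreover have "?S ?d2 \<inter> ?S ?d3 = {}" using excl by blast
    ultimately show ?thesis
      by (simp only: sum.union_disjoint[OF fin fins(1)] sum.union_disjoint[OF fin fins(2)]
          sum.union_disjoint[OF fin fin])
  qed
  also have "sum (wt T \<phi>) (?S (\<lambda>t. \<not> (?d1 t \<or> ?d2 t \<or> ?d3 t))) = wsum (insert x U) T n1 n2 n3 \<phi>"
    unfolding wsum_def S0 ..
  also have "sum (wt T \<phi>) (?S ?d1) = wsum (insert x U) T (n1 - 1) n2 n3 (\<lambda>y a b c. \<phi> y (chi ?L y * a) b c)"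
  proof -
    let ?m = "\<lambda>(f, g, h). (?L \<otimes> f, g, h)"
    have "bij_betw ?m (tri (n1 - 1) n2 n3) {t \<in> tri n1 n2 n3. ?d1 t}"
    proof -
      have m: "?m = map_prod (\<lambda>f. ?L \<otimes> f) id" by auto
      have S: "{t \<in> tri n1 n2 n3. ?d1 t} = {f \<in> {f \<in> carrier G. int (deg f) = n1}. ?L divides f}
          \<times> ({g \<in> carrier G. int (deg g) = n2} \<times> {h \<in> carrier G. int (deg h) = n3})"
        by (auto simp: tri_def)
      show ?thesis
        unfolding m S unfolding tri_def
        using bij_betw_map_prod[OF bij_betw_mult_deg[OF Lc, of n1] bij_betw_id] deg_lin[OF x(1)]
        by simp
    qed
    from bij_betw_lin_factor[OF x U this]
    have "bij_betw ?m {t. t \<in> sqtri (n1 - 1) n2 n3 \<and> nonvan (insert x U) t} (?S ?d1)"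
      using Lc by (auto simp: prod3_def tri_def m_ac)
    from sum.reindex_bij_betw[OF this, of "wt T \<phi>"]
    have "sum (wt T \<phi>) (?S ?d1) = (\<Sum>t | t \<in> sqtri (n1 - 1) n2 n3 \<and> nonvan (insert x U) t. wt T \<phi> (?m t))" by simp
    also have "\<dots> = wsum (insert x U) T (n1 - 1) n2 n3 (\<lambda>y a b c. \<phi> y (chi ?L y * a) b c)"
      unfolding wsum_def
      by (intro sum.cong refl) (use T Lc in \<open>auto simp: wt_def sqtri_def tri_def chi_mult subset_iff intro!: prod.cong\<close>)
    finally show ?thesis .
  qed
  also have "sum (wt T \<phi>) (?S ?d2) = wsum (insert x U) T n1 (n2 - 1) n3 (\<lambda>y a b c. \<phi> y a (chi ?L y * b) c)"
  proof -
    let ?m = "\<lambda>(f, g, h). (f, ?L \<otimes> g, h)"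
    have "bij_betw ?m (tri n1 (n2 - 1) n3) {t \<in> tri n1 n2 n3. ?d2 t}"
    proof -
      have m: "?m = map_prod id (map_prod (\<lambda>f. ?L \<otimes> f) id)" by auto
      have S: "{t \<in> tri n1 n2 n3. ?d2 t} = {f \<in> carrier G. int (deg f) = n1} \<times>
          ({g \<in> {g \<in> carrier G. int (deg g) = n2}. ?L divides g} \<times> {h \<in> carrier G. int (deg h) = n3})"
        by (auto simp: tri_def)
      show ?thesis
        unfolding m S unfolding tri_def
        using bij_betw_map_prod[OF bij_betw_id bij_betw_map_prod[OF bij_betw_mult_deg[OF Lc, of n2] bij_betw_id]]
          deg_lin[OF x(1)] by simp
    qed
    from bij_betw_lin_factor[OF x U this]
    have "bij_betw ?m {t. t \<in> sqtri n1 (n2 - 1) n3 \<and> nonvan (insert x U) t} (?S ?d2)"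
      using Lc by (auto simp: prod3_def tri_def m_ac)
    from sum.reindex_bij_betw[OF this, of "wt T \<phi>"]
    have "sum (wt T \<phi>) (?S ?d2) = (\<Sum>t | t \<in> sqtri n1 (n2 - 1) n3 \<and> nonvan (insert x U) t. wt T \<phi> (?m t))" by simp
    also have "\<dots> = wsum (insert x U) T n1 (n2 - 1) n3 (\<lambda>y a b c. \<phi> y a (chi ?L y * b) c)"
      unfolding wsum_def
      by (intro sum.cong refl) (use T Lc in \<open>auto simp: wt_def sqtri_def tri_def chi_mult subset_iff intro!: prod.cong\<close>)
    finally show ?thesis .
  qed
  also have "sum (wt T \<phi>) (?S ?d3) = wsum (insert x U) T n1 n2 (n3 - 1) (\<lambda>y a b c. \<phi> y a b (chi ?L y * c))"
  proof -
    let ?m = "\<lambda>(f, g, h). (f, g, ?L \<otimes> h)"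
    have "bij_betw ?m (tri n1 n2 (n3 - 1)) {t \<in> tri n1 n2 n3. ?d3 t}"
    proof -
      have m: "?m = map_prod id (map_prod id (\<lambda>f. ?L \<otimes> f))" by auto
      have S: "{t \<in> tri n1 n2 n3. ?d3 t} = {f \<in> carrier G. int (deg f) = n1} \<times>
          ({g \<in> carrier G. int (deg g) = n2} \<times> {h \<in> {h \<in> carrier G. int (deg h) = n3}. ?L divides h})"
        by (auto simp: tri_def)
      show ?thesis
        unfolding m S unfolding tri_def
        using bij_betw_map_prod[OF bij_betw_id bij_betw_map_prod[OF bij_betw_id bij_betw_mult_deg[OF Lc, of n3]]]
          deg_lin[OF x(1)] by simp
    qed
    from bij_betw_lin_factor[OF x U this]
    have "bij_betw ?m {t. t \<in> sqtri n1 n2 (n3 - 1) \<and> nonvan (insert x U) t} (?S ?d3)"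
      using Lc by (auto simp: prod3_def tri_def m_ac)
    from sum.reindex_bij_betw[OF this, of "wt T \<phi>"]
    have "sum (wt T \<phi>) (?S ?d3) = (\<Sum>t | t \<in> sqtri n1 n2 (n3 - 1) \<and> nonvan (insert x U) t. wt T \<phi> (?m t))" by simp
    also have "\<dots> = wsum (insert x U) T n1 n2 (n3 - 1) (\<lambda>y a b c. \<phi> y a b (chi ?L y * c))"
      unfolding wsum_def
      by (intro sum.cong refl) (use T Lc in \<open>auto simp: wt_def sqtri_def tri_def chi_mult subset_iff intro!: prod.cong\<close>)
    finally show ?thesis .
  qed
  finally show ?thesis by simp
qed

section \<open>Error terms and the induction over the points\<close>

definition err :: "real \<Rightarrow> int \<Rightarrow> real" where
  "err \<epsilon> i = 2 * tail_const \<epsilon> * real q powr (- ((1 - \<epsilon>) / 2) * real_of_int i)"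

lemma err_nonneg: "0 < \<epsilon> \<Longrightarrow> err \<epsilon> i \<ge> 0"
  using tail_const_ge_1[of \<epsilon>] by (simp add: err_def)

lemma err_antimono:
  assumes "0 < \<epsilon>" "\<epsilon> < 1" "i \<le> j" shows "err \<epsilon> j \<le> err \<epsilon> i"
proof -
  have "(1 - \<epsilon>) / 2 * real_of_int i \<le> (1 - \<epsilon>) / 2 * real_of_int j" using assms by (intro mult_left_mono) auto
  then have "real q powr (- ((1 - \<epsilon>) / 2) * real_of_int j) \<le> real q powr (- ((1 - \<epsilon>) / 2) * real_of_int i)"
    using q_ge_3 by (intro powr_mono) auto
  then show ?thesis unfolding err_def using tail_const_ge_1[OF assms(1)] by (intro mult_left_mono) auto
qed

text \<open>Splitting off \<open>t - x\<close> lowers one degree; the loss in the error is absorbed by the density \<open>1 / q\<close>.\<close>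

lemma err_pred:
  assumes "0 < \<epsilon>" "\<epsilon> < 1" "i - 1 \<le> j" shows "err \<epsilon> j / real q \<le> err \<epsilon> i"
proof -
  have "err \<epsilon> j \<le> err \<epsilon> (i - 1)" using err_antimono assms by blast
  also have "\<dots> = err \<epsilon> i * real q powr ((1 - \<epsilon>) / 2)"
    unfolding err_def by (simp add: powr_add[symmetric] algebra_simps diff_divide_distrib add_divide_distrib)
  also have "\<dots> \<le> err \<epsilon> i * real q"
  proof (rule mult_left_mono[OF _ err_nonneg[OF assms(1)]])
    have "real q powr ((1 - \<epsilon>) / 2) \<le> real q powr 1" using assms q_ge_3 by (intro powr_mono) auto
    then show "real q powr ((1 - \<epsilon>) / 2) \<le> real q" using q_ge_3 by simp
  qed
  finally show ?thesis using q_ge_3 by (simp add: pos_divide_le_eq)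
qed

lemma bounded_wt_shift:
  assumes "bounded_wt T \<phi>" "T \<subseteq> Pts" "x \<in> Pts"
  shows "bounded_wt T (\<lambda>y a b c. \<phi> y (chi (lin x) y * a) b c)"
    "bounded_wt T (\<lambda>y a b c. \<phi> y a (chi (lin x) y * b) c)"
    "bounded_wt T (\<lambda>y a b c. \<phi> y a b (chi (lin x) y * c))"
proof -
  have "chi (lin x) y * a \<in> {-1, 0, 1}" if "y \<in> T" "a \<in> {-1, 0, 1}" for y a
  proof -
    have "chi (lin x) y \<in> {-1, 0, 1}" using chi_values[OF lin_closed] that assms by blast
    then show ?thesis using that by auto
  qed
  then show "bounded_wt T (\<lambda>y a b c. \<phi> y (chi (lin x) y * a) b c)"
    "bounded_wt T (\<lambda>y a b c. \<phi> y a (chi (lin x) y * b) c)"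
    "bounded_wt T (\<lambda>y a b c. \<phi> y a b (chi (lin x) y * c))"
    using assms(1) unfolding bounded_wt_def by blast+
qed

text \<open>Converts the normalisation by total degree N - 1 into that by N. The factor 1 / q that
  appears is the one in \<open>loc\<close>.\<close>

lemma divided_estimate:
  fixes W :: real
  assumes "\<bar>W / real q powr real_of_int (N - 1) - M\<bar> \<le> e" "e / real q \<le> e'"
  shows "\<bar>W / real q powr real_of_int N - M / real q\<bar> \<le> e'"
proof -
  have "real q powr real_of_int N = real q powr real_of_int (N - 1) * real q"
    using q_ge_3 powr_add[of "real q" "real_of_int (N - 1)" 1] by simp
  then have "W / real q powr real_of_int N - M / real q = (W / real q powr real_of_int (N - 1) - M) / real q"
    using q_ge_3 by (simp add: diff_divide_distrib)
  then have "\<bar>W / real q powr real_of_int N - M / real q\<bar> = \<bar>W / real q powr real_of_int (N - 1) - M\<bar> / real q"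
    by (simp add: abs_divide)
  also have "\<dots> \<le> e / real q" using assms(1) by (intro divide_right_mono) auto
  finally show ?thesis using assms(2) by linarith
qed

text \<open>\<open>V\<close> collects the points at which vanishing is still allowed. Adding a point
  to \<open>V\<close> turns its factor \<open>avg\<close> into \<open>loc\<close> and replaces one
  sum by the four of \<open>wsum_split\<close>, whence the power of 4. Degrees and weights vary in
  the induction because the splitting changes both.\<close>

lemma wsum_estimate_aux:
  assumes eps: "0 < \<epsilon>" "\<epsilon> < 1" and T: "T \<subseteq> Pts" and V: "finite V" "V \<subseteq> T" and bd: "bounded_wt T \<phi>"
  shows "\<bar>wsum (T - V) T n1 n2 n3 \<phi> / real q powr real_of_int (n1 + n2 + n3)
      - dens T * (\<Prod>x\<in>T - V. avg (\<phi> x)) * (\<Prod>x\<in>V. loc (\<phi> x))\<bar>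
    \<le> 4 ^ card V * err \<epsilon> (min n1 (min n2 n3) - int (card T))"
  using V bd
proof (induction V arbitrary: n1 n2 n3 \<phi> rule: finite_induct)
  case empty
  then show ?case using wsum_estimate_nonvanishing[OF eps T] by (simp add: err_def)
next
  case (insert x V)
  have x: "x \<in> Pts" "x \<notin> T - insert x V" and U: "T - insert x V \<subseteq> Pts" using insert T by auto
  have ins: "insert x (T - insert x V) = T - V" using insert by auto
  have finT: "finite T" using T finite_Pts finite_subset by blast
  define e where "e = 4 ^ card V * err \<epsilon> (min n1 (min n2 n3) - int (card T))"
  define P where "P = (\<Prod>y\<in>T - insert x V. avg (\<phi> y))"
  define L where "L = (\<Prod>y\<in>V. loc (\<phi> y))"
  define N where "N = n1 + n2 + n3"
  let ?s = "chi (lin x)"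
  have sgn: "?s y \<in> {1, -1}" if "y \<in> T" "y \<noteq> x" for y
  proof -
    have "y \<in> Pts" using that T by blast
    then show ?thesis using chi_values[OF lin_closed[OF x(1)]] chi_lin[OF x(1), of y] that by auto
  qed
  \<comment> \<open>At x itself the recursive average is therefore taken with one argument 0, which
    yields the three extra terms of \<open>loc\<close>.\<close>
  have s0: "?s x = 0" using chi_eq_0_iff[OF lin_closed[OF x(1)] x(1)] lin_closed[OF x(1)] by simp
  have split: "(\<Prod>y\<in>T - V. F y) = F x * (\<Prod>y\<in>T - insert x V. F y)" for F :: "'x \<Rightarrow> real"
    unfolding ins[symmetric] using finT by (subst prod.insert) auto
  have V: "V \<subseteq> T" using insert by auto
  have sgnV: "?s y \<in> {1, -1}" if "y \<in> V" for y using sgn[of y] that V insert.hyps by blast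
  have ePred: "4 ^ card V * err \<epsilon> (i' - int (card T)) / real q \<le> e" if "min n1 (min n2 n3) - 1 \<le> i'" for i'
  proof -
    have "err \<epsilon> (i' - int (card T)) / real q \<le> err \<epsilon> (min n1 (min n2 n3) - int (card T))"
      using that by (intro err_pred eps) auto
    then have "4 ^ card V * (err \<epsilon> (i' - int (card T)) / real q) \<le> e"
      unfolding e_def by (rule mult_left_mono) simp
    then show ?thesis by simp
  qed
  have E0: "\<bar>wsum (T - V) T n1 n2 n3 \<phi> / real q powr real_of_int N - dens T * (avg (\<phi> x) * P) * L\<bar> \<le> e"
    using insert.IH[OF V insert.prems(2), of n1 n2 n3] unfolding e_def P_def L_def N_def split by simp
  have E1: "\<bar>wsum (T - V) T (n1 - 1) n2 n3 (\<lambda>y a b c. \<phi> y (?s y * a) b c) / real q powr real_of_int N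
      - dens T * (avg (\<lambda>a b c. \<phi> x 0 b c) * P) * L / real q\<bar> \<le> e"
  proof (rule divided_estimate)
    have "(\<Prod>y\<in>T - insert x V. avg (\<lambda>a b c. \<phi> y (?s y * a) b c)) = P"
      unfolding P_def using sgn by (intro prod.cong refl avg_scale(1)[where \<phi> = "\<phi> _"]) auto
    moreover have "(\<Prod>y\<in>V. loc (\<lambda>a b c. \<phi> y (?s y * a) b c)) = L"
      unfolding L_def using sgnV by (intro prod.cong refl loc_scale(1)[where \<phi> = "\<phi> _"]) auto
    ultimately show "\<bar>wsum (T - V) T (n1 - 1) n2 n3 (\<lambda>y a b c. \<phi> y (?s y * a) b c) / real q powr real_of_int (N - 1)
        - dens T * (avg (\<lambda>a b c. \<phi> x 0 b c) * P) * L\<bar> \<le> 4 ^ card V * err \<epsilon> (min (n1 - 1) (min n2 n3) - int (card T))"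
      using insert.IH[OF V bounded_wt_shift(1)[OF insert.prems(2) T x(1)], of "n1 - 1" n2 n3]
      unfolding split N_def by (simp add: s0 algebra_simps)
    show "4 ^ card V * err \<epsilon> (min (n1 - 1) (min n2 n3) - int (card T)) / real q \<le> e"
      by (rule ePred) linarith
  qed
  have E2: "\<bar>wsum (T - V) T n1 (n2 - 1) n3 (\<lambda>y a b c. \<phi> y a (?s y * b) c) / real q powr real_of_int N
      - dens T * (avg (\<lambda>a b c. \<phi> x a 0 c) * P) * L / real q\<bar> \<le> e"
  proof (rule divided_estimate)
    have "(\<Prod>y\<in>T - insert x V. avg (\<lambda>a b c. \<phi> y a (?s y * b) c)) = P"
      unfolding P_def using sgn by (intro prod.cong refl avg_scale(2)[where \<phi> = "\<phi> _"]) auto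
    moreover have "(\<Prod>y\<in>V. loc (\<lambda>a b c. \<phi> y a (?s y * b) c)) = L"
      unfolding L_def using sgnV by (intro prod.cong refl loc_scale(2)[where \<phi> = "\<phi> _"]) auto
    ultimately show "\<bar>wsum (T - V) T n1 (n2 - 1) n3 (\<lambda>y a b c. \<phi> y a (?s y * b) c) / real q powr real_of_int (N - 1)
        - dens T * (avg (\<lambda>a b c. \<phi> x a 0 c) * P) * L\<bar> \<le> 4 ^ card V * err \<epsilon> (min n1 (min (n2 - 1) n3) - int (card T))"
      using insert.IH[OF V bounded_wt_shift(2)[OF insert.prems(2) T x(1)], of n1 "n2 - 1" n3]
      unfolding split N_def by (simp add: s0 algebra_simps)
    show "4 ^ card V * err \<epsilon> (min n1 (min (n2 - 1) n3) - int (card T)) / real q \<le> e"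
      by (rule ePred) linarith
  qed
  have E3: "\<bar>wsum (T - V) T n1 n2 (n3 - 1) (\<lambda>y a b c. \<phi> y a b (?s y * c)) / real q powr real_of_int N
      - dens T * (avg (\<lambda>a b c. \<phi> x a b 0) * P) * L / real q\<bar> \<le> e"
  proof (rule divided_estimate)
    have "(\<Prod>y\<in>T - insert x V. avg (\<lambda>a b c. \<phi> y a b (?s y * c))) = P"
      unfolding P_def using sgn by (intro prod.cong refl avg_scale(3)[where \<phi> = "\<phi> _"]) auto
    moreover have "(\<Prod>y\<in>V. loc (\<lambda>a b c. \<phi> y a b (?s y * c))) = L"
      unfolding L_def using sgnV by (intro prod.cong refl loc_scale(3)[where \<phi> = "\<phi> _"]) auto
    ultimately show "\<bar>wsum (T - V) T n1 n2 (n3 - 1) (\<lambda>y a b c. \<phi> y a b (?s y * c)) / real q powr real_of_int (N - 1)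
        - dens T * (avg (\<lambda>a b c. \<phi> x a b 0) * P) * L\<bar> \<le> 4 ^ card V * err \<epsilon> (min n1 (min n2 (n3 - 1)) - int (card T))"
      using insert.IH[OF V bounded_wt_shift(3)[OF insert.prems(2) T x(1)], of n1 n2 "n3 - 1"]
      unfolding split N_def by (simp add: s0 algebra_simps)
    show "4 ^ card V * err \<epsilon> (min n1 (min n2 (n3 - 1)) - int (card T)) / real q \<le> e"
      by (rule ePred) linarith
  qed
  have main: "dens T * P * (loc (\<phi> x) * L) = dens T * (avg (\<phi> x) * P) * L
      + dens T * (avg (\<lambda>a b c. \<phi> x 0 b c) * P) * L / real q
      + dens T * (avg (\<lambda>a b c. \<phi> x a 0 c) * P) * L / real q
      + dens T * (avg (\<lambda>a b c. \<phi> x a b 0) * P) * L / real q"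
    unfolding loc_def by (simp add: algebra_simps add_divide_distrib)
  have "\<bar>wsum (T - insert x V) T n1 n2 n3 \<phi> / real q powr real_of_int N - dens T * P * (loc (\<phi> x) * L)\<bar> \<le> 4 * e"
    unfolding main wsum_split[OF x U T] ins add_divide_distrib using E0 E1 E2 E3 by linarith
  moreover have "(\<Prod>y\<in>insert x V. loc (\<phi> y)) = loc (\<phi> x) * L"
    unfolding L_def using insert by (subst prod.insert) auto
  moreover have "4 ^ card (insert x V) * err \<epsilon> (min n1 (min n2 n3) - int (card T)) = 4 * e"
    using insert by (simp add: e_def)
  ultimately show ?case unfolding N_def P_def by simp
qed

lemma wsum_estimate:
  assumes "0 < \<epsilon>" "\<epsilon> < 1" and T: "T \<subseteq> Pts" and "bounded_wt T \<phi>"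
  shows "\<bar>wsum {} T n1 n2 n3 \<phi> / real q powr real_of_int (n1 + n2 + n3) - dens T * (\<Prod>x\<in>T. loc (\<phi> x))\<bar>
    \<le> 4 ^ card T * err \<epsilon> (min n1 (min n2 n3) - int (card T))"
  using wsum_estimate_aux[OF assms(1,2) T finite_subset[OF T finite_Pts] order_refl assms(4)] by simp

lemma card_sqtri_estimate:
  assumes "0 < \<epsilon>" "\<epsilon> < 1"
  shows "\<bar>real (card (sqtri n1 n2 n3)) / real q powr real_of_int (n1 + n2 + n3) - dens {}\<bar>
    \<le> err \<epsilon> (min n1 (min n2 n3))"
proof -
  have "real (card (sqtri n1 n2 n3)) = wsum {} {} n1 n2 n3 (\<lambda>_ _ _ _. 1)"
    by (simp add: wsum_def wt_def nonvan_def)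
  moreover have "bounded_wt {} (\<lambda>_ _ _ _. 1)" by (simp add: bounded_wt_def)
  ultimately show ?thesis using wsum_estimate[OF assms, of "{}" "\<lambda>_ _ _ _. 1" n1 n2 n3] by simp
qed

section \<open>A lower bound for the density of squarefree triples\<close>

lemma err_tendsto_0:
  assumes "0 < \<epsilon>" "\<epsilon> < 1" shows "(\<lambda>m. err \<epsilon> (int m)) \<longlonglongrightarrow> 0"
proof -
  define c where "c = (1 - \<epsilon>) / 2"
  have c: "c > 0" using assms by (simp add: c_def)
  have q: "real q > 1" using q_ge_3 by simp
  have "(\<lambda>m::nat. real q powr (- c * real m)) \<longlonglongrightarrow> 0" using c q by real_asymp
  then have "(\<lambda>m. 2 * tail_const \<epsilon> * real q powr (- c * real m)) \<longlonglongrightarrow> 2 * tail_const \<epsilon> * 0"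
    by (intro tendsto_mult tendsto_const)
  then show ?thesis by (simp add: err_def c_def)
qed

text \<open>Taking \<open>E\<close> maximal with \<open>E\<^sup>2\<close> dividing \<open>f g h\<close> writes every triple as a squarefree triple times a
  sixfold product, and the latter have bounded total weight.\<close>

lemma dens_empty_ge:
  assumes eps: "0 < \<epsilon>" "\<epsilon> < 1"
  shows "dens {} \<ge> 1 / tail_const \<epsilon>"
proof -
  define K where "K = tail_const \<epsilon>"
  have K1: "K \<ge> 1" unfolding K_def by (rule tail_const_ge_1[OF eps(1)])
  have q: "real q > 1" using q_ge_3 by simp
  \<comment> \<open>Stated for all integers \<open>m\<close>, because it is applied to m - 2 j,
    which may be negative.\<close>
  have pos: "0 \<le> dens {} + err \<epsilon> m" for m
  proof -
    have "0 \<le> real (card (sqtri m m m)) / real q powr real_of_int (m + m + m)" by simp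
    then show ?thesis using card_sqtri_estimate[OF eps, of m m m] unfolding min.idem by linarith
  qed
  have d0: "0 \<le> dens {}"
  proof -
    have "(\<lambda>m. dens {} + err \<epsilon> (int m)) \<longlonglongrightarrow> dens {} + 0"
      by (intro tendsto_add tendsto_const err_tendsto_0 eps)
    then have "0 \<le> dens {} + 0" by (rule LIMSEQ_le_const) (use pos in blast)
    then show ?thesis by simp
  qed
  have fsum: "(\<Sum>j\<le>n. real (j + 1) ^ 6 * 3 powr (- \<epsilon> * real j)) \<le> K" for n
    unfolding K_def tail_const_def by (rule sum_le_suminf[OF summable_tail_const[OF eps(1)]]) auto
  \<comment> \<open>\<open>card_tri_le_sum_sqtri\<close> for three equal degrees m, divided by the
    number of all triples; letting m grow removes the error.\<close>
  have main: "1 \<le> dens {} * K + err \<epsilon> (int m) * K" for m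
  proof -
    let ?N = "int m + int m + int m"
    let ?sh = "\<lambda>s. sqtri (int m - shift1 s) (int m - shift2 s) (int m - shift3 s)"
    define Q where "Q = real q powr real_of_int ?N"
    have Q: "Q > 0" unfolding Q_def using q by simp
    have "Q = real (card (tri (int m) (int m) (int m)))"
      unfolding Q_def card_tri using q by (simp add: powr_realpow[symmetric])
    also have "\<dots> \<le> real (\<Sum>j\<le>nat ?N. \<Sum>s\<in>tuples j. card (?sh s))"
      by (rule of_nat_mono) (rule card_tri_le_sum_sqtri)
    also have "\<dots> = (\<Sum>j\<le>nat ?N. \<Sum>s\<in>tuples j. real (card (?sh s)))" by simp
    also have "\<dots> \<le> (\<Sum>j\<le>nat ?N. \<Sum>s\<in>tuples j. real q powr real_of_int (?N - 2 * int j) * (dens {} + err \<epsilon> (int m - 2 * int j)))"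
    proof (intro sum_mono)
      fix j s assume s: "s \<in> tuples j"
      have sum: "int m - shift1 s + (int m - shift2 s) + (int m - shift3 s) = ?N - 2 * int j"
        using shift_sum[OF s] by linarith
      \<comment> \<open>The three shifts are nonnegative with sum 2 j, so none of them exceeds 2
        j.\<close>
      have "int m - 2 * int j \<le> min (int m - shift1 s) (min (int m - shift2 s) (int m - shift3 s))"
        using shift_sum[OF s] shift_nonneg[of s] by linarith
      then have "err \<epsilon> (min (int m - shift1 s) (min (int m - shift2 s) (int m - shift3 s))) \<le> err \<epsilon> (int m - 2 * int j)"
        by (intro err_antimono eps)
      then have "real (card (?sh s)) / real q powr real_of_int (?N - 2 * int j) \<le> dens {} + err \<epsilon> (int m - 2 * int j)"
        using card_sqtri_estimate[OF eps, of "int m - shift1 s" "int m - shift2 s" "int m - shift3 s"]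
        unfolding sum by linarith
      moreover have "real q powr real_of_int (?N - 2 * int j) > 0" using q by simp
      ultimately show "real (card (?sh s)) \<le> real q powr real_of_int (?N - 2 * int j) * (dens {} + err \<epsilon> (int m - 2 * int j))"
        by (metis mult.commute pos_divide_le_eq)
    qed
    also have "\<dots> \<le> (\<Sum>j\<le>nat ?N. Q * (real (j + 1) ^ 6 * 3 powr (- \<epsilon> * real j) * (dens {} + err \<epsilon> (int m))))"
    proof (intro sum_mono)
      fix j
      let ?D = "dens {} + err \<epsilon> (int m - 2 * int j)"
      have qq: "real q powr real_of_int (?N - 2 * int j) = Q * (real q powr (- real j) * real q powr (- real j))"
        unfolding Q_def by (simp add: powr_add[symmetric])
      have "(\<Sum>s\<in>tuples j. real q powr real_of_int (?N - 2 * int j) * ?D)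
          = real (card (tuples j)) * (real q powr real_of_int (?N - 2 * int j) * ?D)" by simp
      also have "\<dots> \<le> (real (j + 1) ^ 6 * real q ^ j) * (real q powr real_of_int (?N - 2 * int j) * ?D)"
        using pos by (intro mult_right_mono card_tuples_le mult_nonneg_nonneg) auto
      also have "\<dots> = (real (j + 1) ^ 6 * real q ^ j) * (Q * (real q powr (- real j) * real q powr (- real j)) * ?D)"
        unfolding qq ..
      also have "\<dots>
          = Q * (real (j + 1) ^ 6 * (real q powr (- real j) * ?D))"
        using q by (simp add: powr_minus powr_realpow)
      also have "\<dots> \<le> Q * (real (j + 1) ^ 6 * (3 powr (- \<epsilon> * real j) * (dens {} + err \<epsilon> (int m))))"
      proof (intro mult_left_mono)
        have a: "real q powr (- real j) = real q powr (- \<epsilon> * real j) * real q powr (- (1 - \<epsilon>) * real j)"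
          by (simp add: powr_add[symmetric] algebra_simps)
        \<comment> \<open>Lowering the degree by 2 j costs q^((1 - \<epsilon>) j), exactly what
          remains of q^(-j) after q^(-\<epsilon> j) has been set aside for convergence.\<close>
        have b: "err \<epsilon> (int m - 2 * int j) = err \<epsilon> (int m) * real q powr ((1 - \<epsilon>) * real j)"
        proof -
          have "- ((1 - \<epsilon>) / 2) * real_of_int (int m - 2 * int j)
              = - ((1 - \<epsilon>) / 2) * real_of_int (int m) + (1 - \<epsilon>) * real j" by (simp add: field_simps)
          then show ?thesis unfolding err_def by (simp only: powr_add mult.assoc)
        qed
        have c: "real q powr (- (1 - \<epsilon>) * real j) * real q powr ((1 - \<epsilon>) * real j) = 1"
          unfolding powr_add[symmetric] mult_minus_left using q by simp
        have d: "real q powr (- (1 - \<epsilon>) * real j) \<le> 1"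
        proof -
          have "real q powr (- (1 - \<epsilon>) * real j) \<le> real q powr 0"
            using eps q by (intro powr_mono) (auto simp: mult_le_0_iff)
          then show ?thesis using q by simp
        qed
        have "real q powr (- real j) * ?D = real q powr (- \<epsilon> * real j) *
            (real q powr (- (1 - \<epsilon>) * real j) * dens {} + err \<epsilon> (int m) *
              (real q powr (- (1 - \<epsilon>) * real j) * real q powr ((1 - \<epsilon>) * real j)))"
          unfolding a b distrib_left by (simp only: mult_ac)
        also have "\<dots> = real q powr (- \<epsilon> * real j) * (real q powr (- (1 - \<epsilon>) * real j) * dens {} + err \<epsilon> (int m))"
          unfolding c by simp
        also have "\<dots> \<le> 3 powr (- \<epsilon> * real j) * (dens {} + err \<epsilon> (int m))"
        proof (rule mult_mono)
          show "real q powr (- \<epsilon> * real j) \<le> 3 powr (- \<epsilon> * real j)"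
            using eps q_ge_3 by (intro powr_mono2') auto
          show "real q powr (- (1 - \<epsilon>) * real j) * dens {} + err \<epsilon> (int m) \<le> dens {} + err \<epsilon> (int m)"
            using d d0 by (simp add: mult_left_le_one_le)
          show "0 \<le> real q powr (- (1 - \<epsilon>) * real j) * dens {} + err \<epsilon> (int m)"
            using d0 err_nonneg[OF eps(1)] by (intro add_nonneg_nonneg mult_nonneg_nonneg) auto
        qed auto
        finally show "real q powr (- real j) * ?D \<le> 3 powr (- \<epsilon> * real j) * (dens {} + err \<epsilon> (int m))" .
      qed (use Q in auto)
      finally show "(\<Sum>s\<in>tuples j. real q powr real_of_int (?N - 2 * int j) * ?D)
          \<le> Q * (real (j + 1) ^ 6 * 3 powr (- \<epsilon> * real j) * (dens {} + err \<epsilon> (int m)))"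
        by (simp only: mult.assoc)
    qed
    also have "\<dots> = Q * ((\<Sum>j\<le>nat ?N. real (j + 1) ^ 6 * 3 powr (- \<epsilon> * real j)) * (dens {} + err \<epsilon> (int m)))"
      by (simp only: sum_distrib_left sum_distrib_right)
    also have "\<dots> \<le> Q * (K * (dens {} + err \<epsilon> (int m)))"
      using Q pos fsum by (intro mult_left_mono mult_right_mono) auto
    finally have "Q * 1 \<le> Q * (K * (dens {} + err \<epsilon> (int m)))" by simp
    then have "1 \<le> K * (dens {} + err \<epsilon> (int m))" using Q by (simp only: mult_le_cancel_left_pos)
    then show ?thesis by (simp add: algebra_simps)
  qed
  have "(\<lambda>m. dens {} * K + err \<epsilon> (int m) * K) \<longlonglongrightarrow> dens {} * K + 0 * K"
    by (intro tendsto_intros err_tendsto_0 eps)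
  then have "1 \<le> dens {} * K + 0 * K" by (rule LIMSEQ_le_const) (use main in blast)
  then show ?thesis using K1 unfolding K_def[symmetric] by (simp add: pos_divide_le_eq)
qed

text \<open>One third of the contribution of a point to the trace; the factor keeps all weights at most 1.\<close>

definition yval :: "real \<Rightarrow> real \<Rightarrow> real \<Rightarrow> real" where
  "yval a b c = (a * b + a * c + b * c) / 3"

text \<open>The \<open>e\<close>-th moment of \<open>X / 3\<close> for \<open>X\<close> distributed as \<open>point_pmf q\<close>.\<close>

definition mom :: "nat \<Rightarrow> real" where
  "mom e = (real q + (3 * real q + 6) * (- 1 / 3) ^ e + 6 * (1 / 3) ^ e) / (4 * (real q + 3))"

definition ywt :: "('x \<Rightarrow> nat) \<Rightarrow> real \<Rightarrow> real \<Rightarrow> 'x \<Rightarrow> real \<Rightarrow> real \<Rightarrow> real \<Rightarrow> real" where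
  "ywt e \<sigma> \<tau> x a b c = yval a (\<sigma> * b) (\<tau> * c) ^ e x"

text \<open>The signs \<open>\<sigma>, \<tau>\<close> are the characters of the leading coefficients of \<open>f\<^sub>1, f\<^sub>2\<close>. At infinity, a polynomial
  of lowered degree behaves as if it vanished there.\<close>

definition famsum :: "'x set \<Rightarrow> ('x \<Rightarrow> nat) \<Rightarrow> nat \<Rightarrow> int \<Rightarrow> int \<Rightarrow> int \<Rightarrow> real" where
  "famsum T e e' n1 n2 n3 = (\<Sum>(\<sigma>, \<tau>)\<in>{1, -1} \<times> {1, -1}.
     yval 1 \<sigma> \<tau> ^ e' * wsum {} T n1 n2 n3 (ywt e \<sigma> \<tau>)
     + yval 0 \<sigma> \<tau> ^ e' * wsum {} T (n1 - 1) n2 n3 (ywt e \<sigma> \<tau>)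
     + yval 1 0 \<tau> ^ e' * wsum {} T n1 (n2 - 1) n3 (ywt e \<sigma> \<tau>)
     + yval 1 \<sigma> 0 ^ e' * wsum {} T n1 n2 (n3 - 1) (ywt e \<sigma> \<tau>)) / 4"

section \<open>Moments at a point, sums over the family and their ratio\<close>

lemma abs_yval_le: "\<lbrakk>a \<in> {-1, 0, 1}; b \<in> {-1, 0, 1}; c \<in> {-1, 0, 1}\<rbrakk> \<Longrightarrow> \<bar>yval a b c\<bar> \<le> 1"
  by (auto simp: yval_def)

lemma abs_yval_power_le: "\<lbrakk>a \<in> {-1, 0, 1}; b \<in> {-1, 0, 1}; c \<in> {-1, 0, 1}\<rbrakk> \<Longrightarrow> \<bar>yval a b c ^ e\<bar> \<le> 1"
  using abs_yval_le[of a b c] by (simp add: power_abs power_le_one)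

lemma bounded_ywt:
  assumes "\<sigma> \<in> {1, -1}" "\<tau> \<in> {1, -1}" shows "bounded_wt T (ywt e \<sigma> \<tau>)"
proof -
  have *: "s * b \<in> {-1, 0, 1}" if "s \<in> {1, -1}" "b \<in> {-1, 0, 1}" for s b :: real using that by auto
  show ?thesis unfolding bounded_wt_def ywt_def
    by (intro ballI abs_yval_power_le *[OF assms(1)] *[OF assms(2)])
qed

text \<open>The value of \<open>loc\<close> at the constant weight 1: the density of triples whose
  product vanishes at most to first order at a given point.\<close>

definition locfac :: real where
  "locfac = ((real q - 1) / real q) ^ 3 * (1 + 3 / real q)"

text \<open>This is where the law of the variables comes from. No member vanishing and exactly one
  member vanishing have odds q : 3. In the first case a b + a c + b c is 3 for two of the eight sign
  patterns and -1 for the other six; in the second it is the product of two signs, 1 or -1 equally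
  often. Hence 3 has probability q / (4 (q + 3)), 1 has 6 / (4 (q + 3)), and -1 the rest. The twists
  by \<sigma> and \<tau> only permute the patterns.\<close>

lemma loc_ywt:
  assumes "\<sigma> \<in> {1, -1}" "\<tau> \<in> {1, -1}" shows "loc (ywt e \<sigma> \<tau> x) = locfac * mom (e x)"
proof -
  have "loc (ywt e \<sigma> \<tau> x) = loc (\<lambda>a b c. yval a b (\<tau> * c) ^ e x)"
    unfolding ywt_def using loc_scale(2)[OF assms(1), of "\<lambda>a b c. yval a b (\<tau> * c) ^ e x"] by simp
  also have "\<dots> = loc (\<lambda>a b c. yval a b c ^ e x)"
    using loc_scale(3)[OF assms(2), of "\<lambda>a b c. yval a b c ^ e x"] by simp
  also have "\<dots> = locfac * mom (e x)"
  proof -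
    define s t where "s = (- 1 / 3 :: real) ^ e x" and "t = (1 / 3 :: real) ^ e x"
    have vals: "yval 1 1 1 = 1" "yval 1 1 (-1) = - 1 / 3" "yval 1 (-1) 1 = - 1 / 3"
      "yval 1 (-1) (-1) = - 1 / 3" "yval (-1) 1 1 = - 1 / 3" "yval (-1) 1 (-1) = - 1 / 3"
      "yval (-1) (-1) 1 = - 1 / 3" "yval (-1) (-1) (-1) = 1"
      "yval 0 1 1 = 1 / 3" "yval 0 1 (-1) = - 1 / 3" "yval 0 (-1) 1 = - 1 / 3" "yval 0 (-1) (-1) = 1 / 3"
      "yval 1 0 1 = 1 / 3" "yval 1 0 (-1) = - 1 / 3" "yval (-1) 0 1 = - 1 / 3" "yval (-1) 0 (-1) = 1 / 3"
      "yval 1 1 0 = 1 / 3" "yval 1 (-1) 0 = - 1 / 3" "yval (-1) 1 0 = - 1 / 3" "yval (-1) (-1) 0 = 1 / 3"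
      by (simp_all add: yval_def)
    have c: "((real q - 1) / (2 * real q)) ^ 3 = ((real q - 1) / real q) ^ 3 / 8"
      by (simp add: power_divide power_mult_distrib)
    define d where "d = ((real q - 1) / real q) ^ 3"
    have "loc (\<lambda>a b c. yval a b c ^ e x) = d * ((2 + 6 * s + 3 / real q * (4 * t + 4 * s)) / 8)"
      unfolding loc_def avg_expand vals c power_one s_def[symmetric] t_def[symmetric] d_def[symmetric]
      using q_ge_3 by (simp add: field_simps)
    also have "(2 + 6 * s + 3 / real q * (4 * t + 4 * s)) / 8
        = (1 + 3 / real q) * ((real q + (3 * real q + 6) * s + 6 * t) / (4 * (real q + 3)))"
      using q_ge_3 by (simp add: divide_simps) (simp add: algebra_simps)
    finally show ?thesis unfolding locfac_def mom_def s_def t_def d_def by (simp only: mult.assoc)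
  qed
  finally show ?thesis .
qed

lemma abs_mom_le: "\<bar>mom e\<bar> \<le> 1"
proof -
  have "\<bar>(- 1 / 3 :: real) ^ e\<bar> \<le> 1" "\<bar>(1 / 3 :: real) ^ e\<bar> \<le> 1"
    by (simp_all add: power_abs power_le_one)
  then have "\<bar>real q + (3 * real q + 6) * (- 1 / 3) ^ e + 6 * (1 / 3) ^ e\<bar>
      \<le> real q + (3 * real q + 6) * 1 + 6 * 1"
    by (intro order_trans[OF abs_triangle_ineq] add_mono) (auto simp: abs_mult intro!: mult_left_le)
  then show ?thesis unfolding mom_def by (simp add: pos_divide_le_eq abs_divide)
qed

lemma mom_0: "mom 0 = 1"
  by (simp add: mom_def)

lemma weighted_wsum_estimate:
  fixes w :: real
  assumes "\<bar>w\<bar> \<le> 1" "\<bar>W - M\<bar> \<le> e"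
  shows "\<bar>w * W - w * M\<bar> \<le> e"
proof -
  have "\<bar>w * W - w * M\<bar> = \<bar>w\<bar> * \<bar>W - M\<bar>" by (simp add: right_diff_distrib[symmetric] abs_mult)
  also have "\<dots> \<le> 1 * e" using assms by (intro mult_mono) auto
  finally show ?thesis by simp
qed

text \<open>The four summands of \<open>famsum\<close> are to infinity what the four sums of
  \<open>wsum_split\<close> are to a point: relative weight 1 for the full degrees and 1 / q for
  each lowered one. Infinity thus obeys the same law, with local factor 1 + 3 / q in place of
  \<open>locfac\<close>. That f is monic costs nothing, as \<open>yval\<close> is unchanged when all
  three signs are reversed.\<close>

lemma famsum_estimate:
  assumes eps: "0 < \<epsilon>" "\<epsilon> < 1" and T: "T \<subseteq> Pts"
  shows "\<bar>famsum T e e' n1 n2 n3 / real q powr real_of_int (n1 + n2 + n3)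
      - dens T * locfac ^ card T * (1 + 3 / real q) * ((\<Prod>x\<in>T. mom (e x)) * mom e')\<bar>
    \<le> 4 * (4 ^ card T * err \<epsilon> (min n1 (min n2 n3) - int (card T)))"
proof -
  define N where "N = n1 + n2 + n3"
  define Q where "Q = real q powr real_of_int N"
  define D where "D = dens T * (locfac ^ card T * (\<Prod>x\<in>T. mom (e x)))"
  define \<delta> where "\<delta> = 4 ^ card T * err \<epsilon> (min n1 (min n2 n3) - int (card T))"
  define F where "F = (\<lambda>\<sigma> \<tau>. yval 1 \<sigma> \<tau> ^ e' * wsum {} T n1 n2 n3 (ywt e \<sigma> \<tau>)
     + yval 0 \<sigma> \<tau> ^ e' * wsum {} T (n1 - 1) n2 n3 (ywt e \<sigma> \<tau>)
     + yval 1 0 \<tau> ^ e' * wsum {} T n1 (n2 - 1) n3 (ywt e \<sigma> \<tau>)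
     + yval 1 \<sigma> 0 ^ e' * wsum {} T n1 n2 (n3 - 1) (ywt e \<sigma> \<tau>))"
  define M where "M = (\<lambda>\<sigma> \<tau>. yval 1 \<sigma> \<tau> ^ e' * D + yval 0 \<sigma> \<tau> ^ e' * (D / real q)
     + yval 1 0 \<tau> ^ e' * (D / real q) + yval 1 \<sigma> 0 ^ e' * (D / real q))"
  have step: "\<bar>F \<sigma> \<tau> / Q - M \<sigma> \<tau>\<bar> \<le> 4 * \<delta>" if st: "\<sigma> \<in> {1, -1}" "\<tau> \<in> {1, -1}" for \<sigma> \<tau>
  proof -
    have loc: "(\<Prod>x\<in>T. loc (ywt e \<sigma> \<tau> x)) = locfac ^ card T * (\<Prod>x\<in>T. mom (e x))"
      using st by (simp add: loc_ywt prod.distrib)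
    note est = wsum_estimate[OF eps T bounded_ywt[OF st], where e1 = e, unfolded loc, folded D_def]
    have pred: "4 ^ card T * err \<epsilon> (i' - int (card T)) / real q \<le> \<delta>" if "min n1 (min n2 n3) - 1 \<le> i'" for i'
    proof -
      have "err \<epsilon> (i' - int (card T)) / real q \<le> err \<epsilon> (min n1 (min n2 n3) - int (card T))"
        using that by (intro err_pred eps) auto
      then have "4 ^ card T * (err \<epsilon> (i' - int (card T)) / real q) \<le> \<delta>"
        unfolding \<delta>_def by (rule mult_left_mono) simp
      then show ?thesis by simp
    qed
    have s: "\<sigma> \<in> {-1, 0, 1}" "\<tau> \<in> {-1, 0, 1}" "(0::real) \<in> {-1, 0, 1}" "(1::real) \<in> {-1, 0, 1}"
      using st by auto
    have N: "n1 - 1 + n2 + n3 = N - 1" "n1 + (n2 - 1) + n3 = N - 1" "n1 + n2 + (n3 - 1) = N - 1"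
      by (auto simp: N_def)
    have "\<bar>wsum {} T n1 n2 n3 (ywt e \<sigma> \<tau>) / Q - D\<bar> \<le> \<delta>"
      using est[of n1 n2 n3] by (simp only: Q_def N_def \<delta>_def)
    note 0 = weighted_wsum_estimate[OF abs_yval_power_le[OF s(4,1,2)] this, of e']
    have "\<bar>wsum {} T (n1 - 1) n2 n3 (ywt e \<sigma> \<tau>) / Q - D / real q\<bar> \<le> \<delta>"
      unfolding Q_def by (rule divided_estimate[OF est[of "n1 - 1" n2 n3, unfolded N] pred]) linarith
    note 1 = weighted_wsum_estimate[OF abs_yval_power_le[OF s(3,1,2)] this, of e']
    have "\<bar>wsum {} T n1 (n2 - 1) n3 (ywt e \<sigma> \<tau>) / Q - D / real q\<bar> \<le> \<delta>"
      unfolding Q_def by (rule divided_estimate[OF est[of n1 "n2 - 1" n3, unfolded N] pred]) linarith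
    note 2 = weighted_wsum_estimate[OF abs_yval_power_le[OF s(4,3,2)] this, of e']
    have "\<bar>wsum {} T n1 n2 (n3 - 1) (ywt e \<sigma> \<tau>) / Q - D / real q\<bar> \<le> \<delta>"
      unfolding Q_def by (rule divided_estimate[OF est[of n1 n2 "n3 - 1", unfolded N] pred]) linarith
    note 3 = weighted_wsum_estimate[OF abs_yval_power_le[OF s(4,1,3)] this, of e']
    show ?thesis
      unfolding F_def M_def add_divide_distrib times_divide_eq_right[symmetric] using 0 1 2 3 by linarith
  qed
  have fam: "famsum T e e' n1 n2 n3 = (F 1 1 + F 1 (-1) + F (-1) 1 + F (-1) (-1)) / 4"
    unfolding famsum_def F_def sum.cartesian_product[symmetric] by simp
  have main: "(M 1 1 + M 1 (-1) + M (-1) 1 + M (-1) (-1)) / 4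
      = dens T * locfac ^ card T * (1 + 3 / real q) * ((\<Prod>x\<in>T. mom (e x)) * mom e')"
  proof -
    define s t where "s = (- 1 / 3 :: real) ^ e'" and "t = (1 / 3 :: real) ^ e'"
    have vals: "yval 1 1 1 = 1" "yval 1 1 (-1) = - 1 / 3" "yval 1 (-1) 1 = - 1 / 3"
      "yval 1 (-1) (-1) = - 1 / 3"
      "yval 0 1 1 = 1 / 3" "yval 0 1 (-1) = - 1 / 3" "yval 0 (-1) 1 = - 1 / 3" "yval 0 (-1) (-1) = 1 / 3"
      "yval 1 0 1 = 1 / 3" "yval 1 0 (-1) = - 1 / 3" "yval 1 1 0 = 1 / 3" "yval 1 (-1) 0 = - 1 / 3"
      by (simp_all add: yval_def)
    have "(M 1 1 + M 1 (-1) + M (-1) 1 + M (-1) (-1)) / 4 = D * ((1 + 3 * s + 6 * (t + s) / real q) / 4)"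
      unfolding M_def vals power_one s_def[symmetric] t_def[symmetric]
      using q_ge_3 by (simp add: field_simps)
    also have "(1 + 3 * s + 6 * (t + s) / real q) / 4 = (1 + 3 / real q) * mom e'"
      unfolding mom_def s_def[symmetric] t_def[symmetric]
      using q_ge_3 by (simp add: divide_simps) (simp add: algebra_simps)
    finally show ?thesis unfolding D_def by (simp only: mult_ac)
  qed
  have "\<bar>(F 1 1 / Q - M 1 1) + (F 1 (-1) / Q - M 1 (-1)) + (F (-1) 1 / Q - M (-1) 1)
      + (F (-1) (-1) / Q - M (-1) (-1))\<bar> \<le> 16 * \<delta>"
    using step[of 1 1] step[of 1 "-1"] step[of "-1" 1] step[of "-1" "-1"] by simp
  moreover have "(F 1 1 + F 1 (-1) + F (-1) 1 + F (-1) (-1)) / 4 / Q - (M 1 1 + M 1 (-1) + M (-1) 1 + M (-1) (-1)) / 4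
    = ((F 1 1 / Q - M 1 1) + (F 1 (-1) / Q - M 1 (-1)) + (F (-1) 1 / Q - M (-1) 1)
      + (F (-1) (-1) / Q - M (-1) (-1))) / 4"
    by (simp add: add_divide_distrib diff_divide_distrib)
  ultimately show ?thesis
    unfolding fam main[symmetric] N_def[symmetric] Q_def[symmetric] \<delta>_def[symmetric]
    by (simp only: abs_divide) simp
qed

text \<open>The denominator is estimated over the same \<open>T\<close> as the numerator, with all
  exponents zero, so both main terms carry the same factor, \<open>dens T\<close> included. The
  hypothesis \<open>small\<close> keeps the error below half of the lower bound
  \<open>1 / tail_const \<epsilon>\<close> for \<open>dens {}\<close>, which bounds the denominator
  away from 0.\<close>

lemma famsum_ratio_estimate:
  assumes eps: "0 < \<epsilon>" "\<epsilon> < 1" and T: "T \<subseteq> Pts"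
    and small: "4 * (tail_const \<epsilon>)\<^sup>2 * real q powr (- ((1 - \<epsilon>) / 2) * real_of_int (min n1 (min n2 n3))) \<le> 1"
  shows "famsum T (\<lambda>_. 0) 0 n1 n2 n3 > 0"
    "\<bar>famsum T e e' n1 n2 n3 / famsum T (\<lambda>_. 0) 0 n1 n2 n3 - (\<Prod>x\<in>T. mom (e x)) * mom e'\<bar>
    \<le> 32 * (tail_const \<epsilon>)\<^sup>2 * 4 ^ card T *
      real q powr (- ((1 - \<epsilon>) / 2) * real_of_int (min n1 (min n2 n3) - int (card T)))"
proof -
  define K where "K = tail_const \<epsilon>"
  define Q where "Q = real q powr real_of_int (n1 + n2 + n3)"
  define \<mu> where "\<mu> = (\<Prod>x\<in>T. mom (e x)) * mom e'"
  define d where "d = dens T * locfac ^ card T * (1 + 3 / real q)"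
  define \<delta> where "\<delta> = 4 * (4 ^ card T * err \<epsilon> (min n1 (min n2 n3) - int (card T)))"
  define A B where "A = famsum T e e' n1 n2 n3" and "B = famsum T (\<lambda>_. 0) 0 n1 n2 n3"
  have K: "K \<ge> 1" unfolding K_def by (rule tail_const_ge_1[OF eps(1)])
  have Q: "Q > 0" unfolding Q_def using q_ge_3 by simp
  have mu: "\<bar>\<mu>\<bar> \<le> 1"
  proof -
    have "\<bar>\<Prod>x\<in>T. mom (e x)\<bar> \<le> 1" unfolding abs_prod by (intro prod_le_1) (auto simp: abs_mom_le)
    then show ?thesis unfolding \<mu>_def abs_mult using abs_mom_le[of e'] by (intro mult_le_one) auto
  qed
  have \<delta>: "\<delta> \<ge> 0" unfolding \<delta>_def using err_nonneg[OF eps(1)] by simp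
  have estA: "\<bar>A / Q - d * \<mu>\<bar> \<le> \<delta>"
    using famsum_estimate[OF eps T, of e e' n1 n2 n3] by (simp only: A_def Q_def d_def \<mu>_def \<delta>_def)
  have estB: "\<bar>B / Q - d\<bar> \<le> \<delta>"
    using famsum_estimate[OF eps T, of "\<lambda>_. 0" 0 n1 n2 n3] by (simp add: B_def Q_def d_def \<delta>_def mom_0)
  have Bge: "B \<ge> Q / (2 * K)"
  proof -
    \<comment> \<open>Zeroth powers are 1, so \<open>B\<close> counts the triples of all four kinds;
      those of full degree alone give the lower bound.\<close>
    have w: "wsum {} T a b c (ywt (\<lambda>_. 0) \<sigma> \<tau>) = real (card (sqtri a b c))" for a b c \<sigma> \<tau>
      unfolding wsum_def wt_def ywt_def nonvan_def by simp
    have "B = real (card (sqtri n1 n2 n3)) + real (card (sqtri (n1 - 1) n2 n3))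
        + real (card (sqtri n1 (n2 - 1) n3)) + real (card (sqtri n1 n2 (n3 - 1)))"
      unfolding B_def famsum_def w sum.cartesian_product[symmetric] by simp
    then have "real (card (sqtri n1 n2 n3)) / Q \<le> B / Q" using Q by (intro divide_right_mono) auto
    moreover have "dens {} - err \<epsilon> (min n1 (min n2 n3)) \<le> real (card (sqtri n1 n2 n3)) / Q"
      using card_sqtri_estimate[OF eps, of n1 n2 n3] unfolding Q_def by linarith
    moreover have "err \<epsilon> (min n1 (min n2 n3)) \<le> 1 / (2 * K)"
    proof -
      have "err \<epsilon> (min n1 (min n2 n3)) * (2 * K) \<le> 1"
        using small unfolding err_def K_def[symmetric] by (simp add: power2_eq_square mult_ac)
      then show ?thesis using K by (simp add: pos_le_divide_eq)
    qed
    moreover have "1 / K \<le> dens {}" unfolding K_def by (rule dens_empty_ge[OF eps])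
    moreover have "1 / K - 1 / (2 * K) = 1 / (2 * K)" using K by (simp add: field_simps)
    ultimately have "1 / (2 * K) \<le> B / Q" by linarith
    then show ?thesis using Q K by (simp add: field_simps)
  qed
  have B: "B > 0" using Bge Q K by (smt (verit) divide_pos_pos)
  then show "famsum T (\<lambda>_. 0) 0 n1 n2 n3 > 0" by (simp only: B_def)
  \<comment> \<open>Comparing \<open>A\<close> with \<open>\<mu> * B\<close> directly makes the
    unknown factor \<open>d\<close> drop out.\<close>
  have "\<bar>A / Q - \<mu> * (B / Q)\<bar> = \<bar>(A / Q - d * \<mu>) - \<mu> * (B / Q - d)\<bar>"
    by (simp add: algebra_simps)
  also have "\<dots> \<le> \<bar>A / Q - d * \<mu>\<bar> + \<bar>\<mu>\<bar> * \<bar>B / Q - d\<bar>" by (metis abs_triangle_ineq4 abs_mult)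
  also have "\<dots> \<le> \<delta> + 1 * \<delta>" using estA estB mu by (intro add_mono mult_mono) auto
  finally have diff: "\<bar>A / Q - \<mu> * (B / Q)\<bar> \<le> 2 * \<delta>" by simp
  have "\<bar>A / B - \<mu>\<bar> = \<bar>A / Q - \<mu> * (B / Q)\<bar> * (Q / B)"
  proof -
    have "A / B - \<mu> = (A / Q - \<mu> * (B / Q)) * (Q / B)" using B Q by (simp add: field_simps)
    then show ?thesis using B Q by (simp add: abs_mult)
  qed
  also have "\<dots> \<le> (2 * \<delta>) * (2 * K)"
  proof (rule mult_mono[OF diff])
    show "Q / B \<le> 2 * K" using Bge B K by (simp add: field_simps)
  qed (use \<delta> B Q in auto)
  also have "\<dots> = 32 * K\<^sup>2 * 4 ^ card T *
      real q powr (- ((1 - \<epsilon>) / 2) * real_of_int (min n1 (min n2 n3) - int (card T)))"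
    unfolding \<delta>_def err_def K_def[symmetric] by (simp add: power2_eq_square)
  finally show "\<bar>famsum T e e' n1 n2 n3 / famsum T (\<lambda>_. 0) 0 n1 n2 n3 - (\<Prod>x\<in>T. mom (e x)) * mom e'\<bar>
    \<le> 32 * (tail_const \<epsilon>)\<^sup>2 * 4 ^ card T *
      real q powr (- ((1 - \<epsilon>) / 2) * real_of_int (min n1 (min n2 n3) - int (card T)))"
    by (simp only: A_def B_def \<mu>_def K_def)
qed

section \<open>Squarefree products and pairwise coprime triples\<close>

text \<open>The bridge to the family in the theorem, whose triples are given by pairwise
  coprimality. From right to left, each of the six cases of \<open>prime_square_divides_prod\<close>
  contradicts one of the six conditions.\<close>

lemma sqfree_prod3_iff:
  assumes c: "f \<in> carrier G" "g \<in> carrier G" "h \<in> carrier G"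
  shows "sqfree (f \<otimes> g \<otimes> h) \<longleftrightarrow> sqfree f \<and> sqfree g \<and> sqfree h
    \<and> (\<forall>u\<in>carrier G. u divides f \<longrightarrow> u divides g \<longrightarrow> u = \<one>)
    \<and> (\<forall>u\<in>carrier G. u divides f \<longrightarrow> u divides h \<longrightarrow> u = \<one>)
    \<and> (\<forall>u\<in>carrier G. u divides g \<longrightarrow> u divides h \<longrightarrow> u = \<one>)" (is "?L = ?R")
proof
  assume sq: ?L
  have cop: "u = \<one>" if u: "u \<in> carrier G" "u divides a" "u divides b"
    and ab: "a \<in> carrier G" "b \<in> carrier G" "d \<in> carrier G" "f \<otimes> g \<otimes> h = a \<otimes> b \<otimes> d" for u a b d
  proof -
    obtain a' where a': "a' \<in> carrier G" "a = u \<otimes> a'" using u(2) by (elim dividesE')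
    obtain b' where b': "b' \<in> carrier G" "b = u \<otimes> b'" using u(3) by (elim dividesE')
    have "f \<otimes> g \<otimes> h = u \<otimes> u \<otimes> (a' \<otimes> b' \<otimes> d)" unfolding ab(4) a'(2) b'(2) using a' b' u ab by (simp add: m_ac)
    then have "u \<otimes> u divides f \<otimes> g \<otimes> h" using a' b' ab by (auto intro: dividesI')
    then show ?thesis using sq u unfolding sqfree_def by blast
  qed
  have "f divides f \<otimes> g \<otimes> h" using c by (intro dividesI'[of "g \<otimes> h"]) (auto simp: m_assoc)
  moreover have "g divides f \<otimes> g \<otimes> h" using c by (intro dividesI'[of "f \<otimes> h"]) (auto simp: m_ac)
  moreover have "h divides f \<otimes> g \<otimes> h" using c by (intro dividesI'[of "f \<otimes> g"]) (auto simp: m_ac)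
  ultimately have "sqfree f \<and> sqfree g \<and> sqfree h"
    using sqfree_divides[OF sq] c by simp
  moreover have "f \<otimes> g \<otimes> h = f \<otimes> h \<otimes> g" "f \<otimes> g \<otimes> h = g \<otimes> h \<otimes> f" using c by (simp_all add: m_ac)
  ultimately show ?R using cop[OF _ _ _ c refl] cop[OF _ _ _ c(1,3,2)] cop[OF _ _ _ c(2,3,1)] by blast
next
  assume R: ?R
  have nd: "\<not> (p divides a \<and> p divides b)" if "prime_elt p" "\<forall>u\<in>carrier G. u divides a \<longrightarrow> u divides b \<longrightarrow> u = \<one>" for p a b
    using that unfolding prime_elt_def by blast
  show ?L
    unfolding sqfree_iff_prime_elt[OF m_closed[OF m_closed[OF c(1,2)] c(3)]]
  proof (intro allI impI notI)
    fix p assume p: "prime_elt p" "p \<otimes> p divides f \<otimes> g \<otimes> h"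
    have ns: "\<not> p \<otimes> p divides a" if "a \<in> carrier G" "sqfree a" for a
      using that p sqfree_iff_prime_elt by blast
    from p(1) c p(2) show False
    proof (cases rule: prime_square_divides_prod)
      case (1 f') then show False using ns[OF c(1)] R by (auto intro: dividesI')
    next
      case (2 g') then show False using ns[OF c(2)] R by (auto intro: dividesI')
    next
      case (3 h') then show False using ns[OF c(3)] R by (auto intro: dividesI')
    next
      case (4 f' g')
      then have "p divides f" "p divides g" by (auto intro: dividesI')
      then show False using nd[OF p(1), of f g] R by blast
    next
      case (5 f' h')
      then have "p divides f" "p divides h" by (auto intro: dividesI')
      then show False using nd[OF p(1), of f h] R by blast
    next
      case (6 g' h')
      then have "p divides g" "p divides h" by (auto intro: dividesI')
      then show False using nd[OF p(1), of g h] R by blast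
    qed
  qed
qed

end

section \<open>Polynomials over a finite field of odd order\<close>

text \<open>Applied to the pairs {x, x + 1} and to squaring on the nonzero elements.\<close>

lemma card_eq_twice_image:
  assumes "finite A" "\<And>y. y \<in> g ` A \<Longrightarrow> card {x \<in> A. g x = y} = 2"
  shows "card A = 2 * card (g ` A)"
proof -
  have "card A = (\<Sum>y\<in>g ` A. card {x \<in> A. g x = y})"
    using sum.image_gen[OF assms(1), of "\<lambda>_. 1::nat" g] by simp
  also have "\<dots> = 2 * card (g ` A)" using assms(2) by simp
  finally show ?thesis .
qed

locale finite_odd_field = field R for R :: "'a ring" (structure) +
  assumes finite_carrier: "finite (carrier R)" and odd_card: "odd (card (carrier R))"
begin

abbreviation P where "P \<equiv> poly_ring R"
abbreviation qq where "qq \<equiv> card (carrier R)"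
abbreviation qc where "qc \<equiv> quadratic_char R"

sublocale UP: domain P
  by (rule univ_poly_is_domain[OF carrier_is_subring])

section \<open>Squares and the quadratic character\<close>

text \<open>Otherwise adding 1 would be an involution without fixed points on a set of odd
  size.\<close>

lemma one_plus_one: "\<one> \<oplus> \<one> \<noteq> \<zero>"
proof
  assume 2: "\<one> \<oplus> \<one> = \<zero>"
  have inv: "x \<oplus> \<one> \<oplus> \<one> = x" if "x \<in> carrier R" for x
    using that 2 by (simp add: a_assoc)
  have ne: "x \<oplus> \<one> \<noteq> x" if "x \<in> carrier R" for x
    using that one_not_zero by (metis add.l_cancel_one' one_closed)
  let ?g = "\<lambda>x. {x, x \<oplus> \<one>}"
  have "card (carrier R) = 2 * card (?g ` carrier R)"
  proof (rule card_eq_twice_image[OF finite_carrier])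
    fix y assume "y \<in> ?g ` carrier R"
    then obtain x where x: "x \<in> carrier R" "y = {x, x \<oplus> \<one>}" by auto
    have "{z \<in> carrier R. ?g z = y} = {x, x \<oplus> \<one>}"
      using x inv by (auto simp: doubleton_eq_iff)
    then show "card {z \<in> carrier R. ?g z = y} = 2" using ne[OF x(1)] by simp
  qed
  then show False using odd_card by simp
qed

lemma card_ge_3: "qq \<ge> 3"
proof -
  have "card {\<zero>, \<one>} \<le> qq" by (rule card_mono[OF finite_carrier]) auto
  then have "qq \<ge> 2" using one_not_zero by simp
  then show ?thesis using odd_card by (cases "qq = 2") auto
qed

definition nonzero :: "'a set" where "nonzero = carrier R - {\<zero>}"
definition squares :: "'a set" where "squares = (\<lambda>b. b \<otimes> b) ` nonzero"

lemma finite_nonzero: "finite nonzero"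
  using finite_carrier by (simp add: nonzero_def)

lemma card_nonzero: "card nonzero = qq - 1"
  unfolding nonzero_def using finite_carrier by simp

lemma nonzero_mult: "\<lbrakk>a \<in> nonzero; b \<in> nonzero\<rbrakk> \<Longrightarrow> a \<otimes> b \<in> nonzero"
  unfolding nonzero_def using integral by auto

lemma squares_subset: "squares \<subseteq> nonzero"
  unfolding squares_def using nonzero_mult by blast

lemma card_squares: "qq - 1 = 2 * card squares"
proof -
  have "card nonzero = 2 * card squares"
    unfolding squares_def
  proof (rule card_eq_twice_image[OF finite_nonzero])
    fix y assume "y \<in> (\<lambda>b. b \<otimes> b) ` nonzero"
    then obtain b where b: "b \<in> nonzero" "y = b \<otimes> b" by auto
    have bc: "b \<in> carrier R" "b \<noteq> \<zero>" using b by (auto simp: nonzero_def)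
    have h1: "c = b \<or> c = \<ominus> b" if c: "c \<in> carrier R" "c \<otimes> c = b \<otimes> b" for c
    proof -
      have "(c \<ominus> b) \<otimes> (c \<oplus> b) = c \<otimes> c \<ominus> b \<otimes> b"
        using c bc by algebra
      also have "\<dots> = \<zero>" using c bc by (simp add: r_right_minus_eq)
      finally have "c \<ominus> b = \<zero> \<or> c \<oplus> b = \<zero>" using c bc integral by blast
      then show ?thesis using c bc by (metis minus_equality add.m_comm r_right_minus_eq)
    qed
    have h2: "(\<ominus> b) \<otimes> (\<ominus> b) = b \<otimes> b" using bc by algebra
    have h3: "\<ominus> b \<in> nonzero" using bc by (auto simp: nonzero_def)
    have "{x \<in> nonzero. x \<otimes> x = y} = {b, \<ominus> b}"
    proof (intro equalityI subsetI)
      fix x assume "x \<in> {x \<in> nonzero. x \<otimes> x = y}"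
      then have "x \<in> carrier R" "x \<otimes> x = b \<otimes> b" using b by (simp_all add: nonzero_def)
      then show "x \<in> {b, \<ominus> b}" using h1 by blast
    next
      fix x assume "x \<in> {b, \<ominus> b}"
      then show "x \<in> {x \<in> nonzero. x \<otimes> x = y}" using b h2 h3 by auto
    qed
    moreover have "b \<noteq> \<ominus> b"
    proof
      assume "b = \<ominus> b"
      then have "b \<oplus> b = \<zero>" using bc by (metis r_neg)
      then have "b \<otimes> (\<one> \<oplus> \<one>) = \<zero>" using bc by (simp add: r_distr)
      then show False using integral[of b "\<one> \<oplus> \<one>"] bc one_plus_one by auto
    qed
    ultimately show "card {x \<in> nonzero. x \<otimes> x = y} = 2" by simp
  qed
  then show ?thesis using card_nonzero by simp
qed

lemma qc_eq:
  assumes "a \<in> carrier R"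
  shows "qc a = (if a = \<zero> then 0 else if a \<in> squares then 1 else -1)"
proof (cases "a = \<zero>")
  case False
  have "(\<exists>b\<in>carrier R. a = b \<otimes> b) \<longleftrightarrow> a \<in> squares"
    using False assms by (auto simp: squares_def nonzero_def)
  then show ?thesis using False by (simp add: quadratic_char_def)
qed (simp add: quadratic_char_def)

lemma qc_values: "qc a \<in> {-1, 0, 1}"
  by (simp add: quadratic_char_def)

lemma qc_eq_0_iff: "qc a = 0 \<longleftrightarrow> a = \<zero>"
  by (simp add: quadratic_char_def)

lemma squares_mult_iff:
  assumes "s \<in> squares" "a \<in> nonzero" shows "s \<otimes> a \<in> squares \<longleftrightarrow> a \<in> squares"
proof -
  obtain b where b: "b \<in> nonzero" "s = b \<otimes> b" using assms by (auto simp: squares_def)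
  have bc: "b \<in> carrier R" "b \<noteq> \<zero>" "b \<in> Units R" using b field_Units by (auto simp: nonzero_def)
  have ib: "inv b \<in> nonzero" using bc by (auto simp: nonzero_def) (metis Units_r_inv r_null one_not_zero)
  have ac: "a \<in> carrier R" using assms by (auto simp: nonzero_def)
  have "\<exists>d\<in>nonzero. a = d \<otimes> d" if "c \<in> nonzero" "s \<otimes> a = c \<otimes> c" for c
  proof -
    have cc: "c \<in> carrier R" "inv b \<in> carrier R" using that ib by (auto simp: nonzero_def)
    have "(inv b \<otimes> c) \<otimes> (inv b \<otimes> c) = (inv b \<otimes> inv b) \<otimes> (c \<otimes> c)" using cc by (simp add: m_ac)
    also have "\<dots> = (inv b \<otimes> inv b) \<otimes> ((b \<otimes> b) \<otimes> a)" using that b by simp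
    also have "\<dots> = (inv b \<otimes> b) \<otimes> (inv b \<otimes> b) \<otimes> a" using cc bc ac by (simp add: m_ac)
    also have "\<dots> = a" using bc ac by (simp add: Units_l_inv)
    finally show ?thesis using nonzero_mult[OF ib that(1)] by metis
  qed
  moreover have "s \<otimes> (d \<otimes> d) = (b \<otimes> d) \<otimes> (b \<otimes> d)" if "d \<in> nonzero" for d
    using that bc b by (auto simp: nonzero_def m_ac)
  ultimately show ?thesis unfolding squares_def using nonzero_mult[OF b(1)] by auto
qed

text \<open>Multiplication by the nonsquare \<open>n\<close> maps the squares injectively into the
  nonsquares, and there are equally many of both. Every nonsquare is thus \<open>n\<close> times a
  square, so \<open>n \<otimes> a\<close> with \<open>a\<close> a nonsquare cannot be one. The
  cyclic structure of the group is avoided.\<close>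

lemma nonsquares_mult:
  assumes "n \<in> nonzero - squares" "a \<in> nonzero - squares" shows "n \<otimes> a \<in> squares"
proof -
  have nc: "n \<in> carrier R" "n \<noteq> \<zero>" using assms by (auto simp: nonzero_def)
  have inj: "inj_on (\<lambda>x. n \<otimes> x) nonzero"
    using nc m_lcancel by (auto simp: inj_on_def nonzero_def)
  have sub: "(\<lambda>x. n \<otimes> x) ` squares \<subseteq> nonzero - squares"
  proof
    fix y assume "y \<in> (\<lambda>x. n \<otimes> x) ` squares"
    then obtain s where s: "s \<in> squares" "y = n \<otimes> s" by auto
    have sc: "s \<in> nonzero" using s squares_subset by blast
    have "y = s \<otimes> n" using s sc nc m_comm by (auto simp: nonzero_def)
    then show "y \<in> nonzero - squares" using squares_mult_iff[OF s(1)] assms nonzero_mult sc by auto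
  qed
  have finS: "finite squares" using finite_subset[OF squares_subset finite_nonzero] .
  have "card (nonzero - squares) = card squares"
    using card_squares card_nonzero card_Diff_subset[OF finS squares_subset] by simp
  moreover have "card ((\<lambda>x. n \<otimes> x) ` squares) = card squares"
    by (rule card_image[OF inj_on_subset[OF inj squares_subset]])
  ultimately have "(\<lambda>x. n \<otimes> x) ` squares = nonzero - squares"
    using sub finite_nonzero by (intro card_subset_eq) auto
  moreover have "n \<otimes> a \<notin> (\<lambda>x. n \<otimes> x) ` squares"
  proof
    assume "n \<otimes> a \<in> (\<lambda>x. n \<otimes> x) ` squares"
    then obtain s where "s \<in> squares" "n \<otimes> a = n \<otimes> s" by auto
    then have "a = s" using inj assms squares_subset unfolding inj_on_def by blast
    then show False using assms \<open>s \<in> squares\<close> by simp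
  qed
  ultimately show ?thesis using nonzero_mult assms by blast
qed

lemma qc_mult:
  assumes "a \<in> carrier R" "b \<in> carrier R" shows "qc (a \<otimes> b) = qc a * qc b"
proof (cases "a = \<zero> \<or> b = \<zero>")
  case True
  then show ?thesis using assms by (auto simp: qc_eq)
next
  case False
  then have nz: "a \<in> nonzero" "b \<in> nonzero" using assms by (auto simp: nonzero_def)
  then have "a \<otimes> b \<noteq> \<zero>" using nonzero_mult by (auto simp: nonzero_def)
  moreover have "a \<otimes> b \<in> squares \<longleftrightarrow> (a \<in> squares \<longleftrightarrow> b \<in> squares)"
    using nz nonsquares_mult[of a b] squares_mult_iff[of a b] squares_mult_iff[of b a] m_comm assms by auto
  ultimately show ?thesis using assms False by (simp add: qc_eq)
qed

lemma card_qc: "s \<in> {1, -1} \<Longrightarrow> 2 * card {a \<in> carrier R. qc a = s} = qq - 1"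
proof -
  have finS: "finite squares" using finite_subset[OF squares_subset finite_nonzero] .
  have "{a \<in> carrier R. qc a = 1} = squares"
    using squares_subset by (auto simp: qc_eq nonzero_def split: if_splits)
  moreover have "{a \<in> carrier R. qc a = -1} = nonzero - squares"
    by (auto simp: qc_eq nonzero_def split: if_splits)
  moreover have "card (nonzero - squares) = card squares"
    using card_squares card_nonzero card_Diff_subset[OF finS squares_subset] by simp
  moreover assume "s \<in> {1, -1}"
  ultimately show ?thesis using card_squares by auto
qed

section \<open>Monic polynomials and their prime factors\<close>

text \<open>The zero polynomial has to be excluded by hand, because \<open>lead_coeff []\<close> is
  the head of an empty list and hence unspecified.\<close>

definition monics :: "'a list set" where
  "monics = {f \<in> carrier P. f \<noteq> [] \<and> lead_coeff f = \<one>}"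

definition monic_monoid_of :: "'a list monoid" where
  "monic_monoid_of = \<lparr>carrier = monics, mult = mult P, one = one P\<rparr>"

lemma carrier_P: "f \<in> carrier P \<longleftrightarrow> f = [] \<or> (set f \<subseteq> carrier R \<and> lead_coeff f \<noteq> \<zero>)"
  unfolding univ_poly_carrier[symmetric] polynomial_def ..

lemma set_carrier_P: "f \<in> carrier P \<Longrightarrow> set f \<subseteq> carrier R"
  by (auto simp: carrier_P)

lemma monics_closed: "f \<in> monics \<Longrightarrow> f \<in> carrier P" and monics_ne: "f \<in> monics \<Longrightarrow> f \<noteq> []"
  by (auto simp: monics_def)

lemma P_mult_ne:
  assumes "f \<in> carrier P" "g \<in> carrier P" "f \<noteq> []" "g \<noteq> []"
  shows "f \<otimes>\<^bsub>P\<^esub> g \<noteq> []" "degree (f \<otimes>\<^bsub>P\<^esub> g) = degree f + degree g"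
    "lead_coeff (f \<otimes>\<^bsub>P\<^esub> g) = lead_coeff f \<otimes> lead_coeff g"
proof -
  show "f \<otimes>\<^bsub>P\<^esub> g \<noteq> []" using UP.integral[OF _ assms(1,2)] assms by (auto simp: univ_poly_zero)
  show "degree (f \<otimes>\<^bsub>P\<^esub> g) = degree f + degree g"
    using poly_mult_degree_eq[OF carrier_is_subring, of f g] assms by (simp add: univ_poly_mult univ_poly_carrier)
  show "lead_coeff (f \<otimes>\<^bsub>P\<^esub> g) = lead_coeff f \<otimes> lead_coeff g"
    using poly_mult_lead_coeff[OF carrier_is_subring, of f g] assms by (simp add: univ_poly_mult univ_poly_carrier)
qed

lemma monics_mult: "\<lbrakk>f \<in> monics; g \<in> monics\<rbrakk> \<Longrightarrow> f \<otimes>\<^bsub>P\<^esub> g \<in> monics"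
  using P_mult_ne[of f g] by (auto simp: monics_def)

lemma degree_monics_mult: "\<lbrakk>f \<in> monics; g \<in> monics\<rbrakk> \<Longrightarrow> degree (f \<otimes>\<^bsub>P\<^esub> g) = degree f + degree g"
  using P_mult_ne[of f g] by (auto simp: monics_def)

lemma one_monics: "\<one>\<^bsub>P\<^esub> \<in> monics"
  using UP.one_closed by (auto simp: monics_def univ_poly_one)

lemma const_P: "c \<in> nonzero \<Longrightarrow> [c] \<in> carrier P"
  by (auto simp: carrier_P nonzero_def)

lemma lead_coeff_nonzero: "\<lbrakk>f \<in> carrier P; f \<noteq> []\<rbrakk> \<Longrightarrow> lead_coeff f \<in> nonzero"
  by (auto simp: carrier_P nonzero_def)

lemma const_mult:
  assumes "c \<in> nonzero" "f \<in> carrier P" "f \<noteq> []"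
  shows "[c] \<otimes>\<^bsub>P\<^esub> f \<in> carrier P" "[c] \<otimes>\<^bsub>P\<^esub> f \<noteq> []" "degree ([c] \<otimes>\<^bsub>P\<^esub> f) = degree f"
    "lead_coeff ([c] \<otimes>\<^bsub>P\<^esub> f) = c \<otimes> lead_coeff f"
  using P_mult_ne[OF const_P[OF assms(1)] assms(2) _ assms(3)] UP.m_closed[OF const_P[OF assms(1)] assms(2)]
  by simp_all

lemma const_mult_const:
  assumes "c \<in> nonzero" "d \<in> nonzero" shows "[c] \<otimes>\<^bsub>P\<^esub> [d] = [c \<otimes> d]"
proof -
  have "polynomial (carrier R) [d]" "c \<in> carrier R - {\<zero>}"
    using assms by (auto simp: polynomial_def nonzero_def)
  from poly_mult_const(1)[OF carrier_is_subring this] show ?thesis by (simp add: univ_poly_mult)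
qed

lemma nonzero_inv: "c \<in> nonzero \<Longrightarrow> inv c \<in> nonzero \<and> inv c \<otimes> c = \<one> \<and> c \<otimes> inv c = \<one>"
proof -
  assume c: "c \<in> nonzero"
  then have u: "c \<in> Units R" using field_Units by (simp add: nonzero_def)
  have "inv c \<otimes> c = \<one>" "c \<otimes> inv c = \<one>" "inv c \<in> carrier R" using u by auto
  moreover from this have "inv c \<noteq> \<zero>" using one_not_zero c by (auto simp: nonzero_def)
  ultimately show ?thesis by (simp add: nonzero_def)
qed

lemma one_nonzero: "\<one> \<in> nonzero" by (simp add: nonzero_def)

lemma monic_decomp:
  assumes "f \<in> carrier P" "f \<noteq> []"
  obtains g where "g \<in> monics" "f = [lead_coeff f] \<otimes>\<^bsub>P\<^esub> g" "degree g = degree f"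
proof -
  let ?c = "lead_coeff f"
  have c: "?c \<in> nonzero" using lead_coeff_nonzero[OF assms] .
  have i: "inv ?c \<in> nonzero" "inv ?c \<otimes> ?c = \<one>" "?c \<otimes> inv ?c = \<one>" using nonzero_inv[OF c] by auto
  have "[inv ?c] \<otimes>\<^bsub>P\<^esub> f \<in> monics" "degree ([inv ?c] \<otimes>\<^bsub>P\<^esub> f) = degree f"
    using const_mult[OF i(1) assms] i by (auto simp: monics_def)
  moreover have "[?c] \<otimes>\<^bsub>P\<^esub> ([inv ?c] \<otimes>\<^bsub>P\<^esub> f) = f"
  proof -
    have "[?c] \<otimes>\<^bsub>P\<^esub> ([inv ?c] \<otimes>\<^bsub>P\<^esub> f) = ([?c] \<otimes>\<^bsub>P\<^esub> [inv ?c]) \<otimes>\<^bsub>P\<^esub> f"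
      using const_P[OF c] const_P[OF i(1)] assms by (simp add: UP.m_assoc)
    also have "\<dots> = \<one>\<^bsub>P\<^esub> \<otimes>\<^bsub>P\<^esub> f" unfolding const_mult_const[OF c i(1)] i(3) univ_poly_one ..
    finally show ?thesis using assms by simp
  qed
  ultimately show thesis using that by metis
qed

lemma Units_P: "f \<in> Units P \<longleftrightarrow> f \<in> carrier P \<and> f \<noteq> [] \<and> degree f = 0"
  by (rule univ_poly_units'[OF carrier_is_subfield])

lemma monics_degree_0: "\<lbrakk>f \<in> monics; degree f = 0\<rbrakk> \<Longrightarrow> f = \<one>\<^bsub>P\<^esub>"
  by (cases f) (auto simp: monics_def univ_poly_one)

lemma monics_Units: "f \<in> monics \<Longrightarrow> f \<in> Units P \<longleftrightarrow> f = \<one>\<^bsub>P\<^esub>"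
  using monics_degree_0[of f] monics_closed[of f] monics_ne[of f] unfolding Units_P
  by (auto simp: univ_poly_one)

lemma monic_quotient:
  assumes "a \<in> monics" "b \<in> monics" "c \<in> carrier P" "b = a \<otimes>\<^bsub>P\<^esub> c"
  shows "c \<in> monics"
proof -
  have "c \<noteq> []" using assms UP.r_null[of a] by (auto simp: univ_poly_zero monics_def)
  moreover have "lead_coeff c = \<one>"
  proof -
    have "lead_coeff c \<in> carrier R" using lead_coeff_nonzero[OF assms(3) calculation] by (simp add: nonzero_def)
    then show ?thesis using P_mult_ne(3)[of a c] assms calculation by (simp add: monics_def)
  qed
  ultimately show ?thesis using assms by (simp add: monics_def)
qed

text \<open>The cofactor of a monic polynomial by a monic divisor is monic, so dividing inside the
  monoid and inside the ring agree.\<close>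

lemma divides_monic_monoid_iff:
  assumes "a \<in> monics" "b \<in> monics"
  shows "a divides\<^bsub>monic_monoid_of\<^esub> b \<longleftrightarrow> a divides\<^bsub>P\<^esub> b"
  unfolding factor_def monic_monoid_of_def
  by (simp only: monoid.simps partial_object.simps) (use monic_quotient[OF assms] monics_closed in blast)

lemma comm_monoid_cancel_monics: "comm_monoid_cancel monic_monoid_of"
proof (rule comm_monoid_cancelI)
  show "comm_monoid monic_monoid_of"
    by (rule comm_monoidI) (simp_all add: monic_monoid_of_def monics_mult one_monics monics_closed UP.m_assoc,
        use monics_closed UP.m_comm in blast)
  fix a b c assume *: "a \<otimes>\<^bsub>monic_monoid_of\<^esub> c = b \<otimes>\<^bsub>monic_monoid_of\<^esub> c"
    "a \<in> carrier monic_monoid_of" "b \<in> carrier monic_monoid_of" "c \<in> carrier monic_monoid_of"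
  then show "a = b" using UP.m_rcancel[of c a b] monics_closed monics_ne
    by (auto simp: monic_monoid_of_def univ_poly_zero)
qed

lemma card_monics_degree: "card {f \<in> monics. degree f = n} = qq ^ n"
proof -
  have "bij_betw (\<lambda>xs. \<one> # xs) {xs. set xs \<subseteq> carrier R \<and> length xs = n} {f \<in> monics. degree f = n}"
  proof (rule bij_betw_imageI)
    show "(\<lambda>xs. \<one> # xs) ` {xs. set xs \<subseteq> carrier R \<and> length xs = n} = {f \<in> monics. degree f = n}"
    proof (intro equalityI subsetI)
      fix f assume f: "f \<in> {f \<in> monics. degree f = n}"
      then obtain a xs where "f = a # xs" by (cases f) (auto simp: monics_def)
      then show "f \<in> (\<lambda>xs. \<one> # xs) ` {xs. set xs \<subseteq> carrier R \<and> length xs = n}"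
        using f by (auto simp: monics_def carrier_P)
    qed (auto simp: monics_def carrier_P)
  qed (auto simp: inj_on_def)
  from bij_betw_same_card[OF this] show ?thesis
    using card_lists_length_eq[OF finite_carrier, of n] by simp
qed

lemma finite_monics_degree: "finite {f \<in> monics. degree f = n}"
  using card_monics_degree[of n] card_ge_3 by (intro card_ge_0_finite) simp

text \<open>The hypothesis \<open>irr\<close> tests monic factorisations. An arbitrary factorisation
  p = u v becomes monic on removing the leading coefficients, whose product is 1 as p is monic. Then
  irreducible polynomials over a field are prime.\<close>

lemma monic_irreducible_imp_prime:
  assumes p: "p \<in> monics" "p \<noteq> \<one>\<^bsub>P\<^esub>"
    and irr: "\<And>a b. \<lbrakk>a \<in> monics; b \<in> monics; p = a \<otimes>\<^bsub>P\<^esub> b\<rbrakk> \<Longrightarrow> a = \<one>\<^bsub>P\<^esub> \<or> b = \<one>\<^bsub>P\<^esub>"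
    and ab: "a \<in> carrier P" "b \<in> carrier P" "p divides\<^bsub>P\<^esub> a \<otimes>\<^bsub>P\<^esub> b"
  shows "p divides\<^bsub>P\<^esub> a \<or> p divides\<^bsub>P\<^esub> b"
proof -
  have pc: "p \<in> carrier P" "p \<noteq> []" using p by (auto simp: monics_def)
  have "pirreducible (carrier R) p"
  proof (rule pirreducibleI[OF carrier_is_subring pc])
    show "p \<notin> Units P" using monics_Units p by blast
    fix u v assume uv: "u \<in> carrier P" "v \<in> carrier P" "p = u \<otimes>\<^bsub>P\<^esub> v"
    have ne: "u \<noteq> []" "v \<noteq> []" using uv pc UP.l_null UP.r_null by (auto simp: univ_poly_zero)
    obtain u' where u': "u' \<in> monics" "u = [lead_coeff u] \<otimes>\<^bsub>P\<^esub> u'" "degree u' = degree u"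
      using monic_decomp[OF uv(1) ne(1)] .
    obtain v' where v': "v' \<in> monics" "v = [lead_coeff v] \<otimes>\<^bsub>P\<^esub> v'" "degree v' = degree v"
      using monic_decomp[OF uv(2) ne(2)] .
    note lu = lead_coeff_nonzero[OF uv(1) ne(1)] and lv = lead_coeff_nonzero[OF uv(2) ne(2)]
    have lc: "lead_coeff u \<otimes> lead_coeff v = \<one>"
      using P_mult_ne(3)[OF uv(1,2) ne] uv p by (simp add: monics_def)
    have "p = ([lead_coeff u] \<otimes>\<^bsub>P\<^esub> u') \<otimes>\<^bsub>P\<^esub> ([lead_coeff v] \<otimes>\<^bsub>P\<^esub> v')" using uv(3) u'(2) v'(2) by simp
    also have "\<dots> = ([lead_coeff u] \<otimes>\<^bsub>P\<^esub> [lead_coeff v]) \<otimes>\<^bsub>P\<^esub> (u' \<otimes>\<^bsub>P\<^esub> v')"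
      using const_P[OF lu] const_P[OF lv] monics_closed[OF u'(1)] monics_closed[OF v'(1)] by (simp add: UP.m_ac)
    also have "\<dots> = u' \<otimes>\<^bsub>P\<^esub> v'"
      unfolding const_mult_const[OF lu lv] lc
      using UP.l_one[OF monics_closed[OF monics_mult[OF u'(1) v'(1)]]] by (simp only: univ_poly_one)
    finally have "u' = \<one>\<^bsub>P\<^esub> \<or> v' = \<one>\<^bsub>P\<^esub>" using irr u' v' by blast
    then have "degree u = 0 \<or> degree v = 0" using u' v' by (auto simp: univ_poly_one)
    then show "u \<in> Units P \<or> v \<in> Units P" using uv ne by (auto simp: Units_P)
  qed
  then have "pprime (carrier R) p" using pprime_iff_pirreducible[OF carrier_is_subfield pc(1)] by simp
  from pprimeE(3)[OF carrier_is_subfield pc(1) this ab(1,2)] ab(3) show ?thesis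
    by (simp add: pdivides_def)
qed

section \<open>Evaluation and linear factors\<close>

lemma eval_mult:
  "\<lbrakk>f \<in> carrier P; g \<in> carrier P; x \<in> carrier R\<rbrakk> \<Longrightarrow> eval (f \<otimes>\<^bsub>P\<^esub> g) x = eval f x \<otimes> eval g x"
  using ring_hom_mult[OF eval_is_hom[OF carrier_is_subring, of x], of f g] by simp

lemma eval_add:
  "\<lbrakk>f \<in> carrier P; g \<in> carrier P; x \<in> carrier R\<rbrakk> \<Longrightarrow> eval (f \<oplus>\<^bsub>P\<^esub> g) x = eval f x \<oplus> eval g x"
  using ring_hom_add[OF eval_is_hom[OF carrier_is_subring, of x], of f g] by simp

lemma eval_closed: "\<lbrakk>f \<in> carrier P; x \<in> carrier R\<rbrakk> \<Longrightarrow> eval f x \<in> carrier R"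
  using eval_in_carrier[OF set_carrier_P] by simp

definition linear :: "'a \<Rightarrow> 'a list" where "linear x = [\<one>, \<ominus> x]"

lemma linear_monics: "x \<in> carrier R \<Longrightarrow> linear x \<in> monics"
  by (auto simp: linear_def monics_def carrier_P)

lemma eval_linear: "\<lbrakk>x \<in> carrier R; y \<in> carrier R\<rbrakk> \<Longrightarrow> eval (linear x) y = y \<ominus> x"
  by (simp add: linear_def a_minus_def)

lemma linear_divides_iff:
  assumes "x \<in> carrier R" "f \<in> monics"
  shows "linear x divides\<^bsub>P\<^esub> f \<longleftrightarrow> eval f x = \<zero>"
proof
  show "linear x divides\<^bsub>P\<^esub> f \<Longrightarrow> eval f x = \<zero>"
    using pdivides_imp_is_root[OF monics_ne[OF assms(2)] assms(1)]
    unfolding pdivides_def linear_def is_root_def by blast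
  show "eval f x = \<zero> \<Longrightarrow> linear x divides\<^bsub>P\<^esub> f"
    using is_root_imp_pdivides[OF monics_closed[OF assms(2)], of x] assms(1) monics_ne[OF assms(2)]
    unfolding pdivides_def linear_def is_root_def by blast
qed

section \<open>Division with remainder, interpolation and equidistribution\<close>

abbreviation Mon where "Mon n \<equiv> {f \<in> monics. degree f = n}"

text \<open>The canonical residues modulo \<open>Q\<close>. Zero is listed separately because
  \<open>degree []\<close> is 0, so that for constant \<open>Q\<close> the degree condition alone
  would leave no residue.\<close>

definition low :: "'a list \<Rightarrow> 'a list set" where
  "low Q = {a \<in> carrier P. a = [] \<or> degree a < degree Q}"

lemma add_lower_degree:
  assumes h: "h \<in> carrier P" "h \<noteq> []" and a: "a \<in> carrier P" "a = [] \<or> degree a < degree h"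
  shows "h \<oplus>\<^bsub>P\<^esub> a \<noteq> []" "degree (h \<oplus>\<^bsub>P\<^esub> a) = degree h" "lead_coeff (h \<oplus>\<^bsub>P\<^esub> a) = lead_coeff h"
proof -
  have "h \<oplus>\<^bsub>P\<^esub> a \<noteq> [] \<and> degree (h \<oplus>\<^bsub>P\<^esub> a) = degree h \<and> lead_coeff (h \<oplus>\<^bsub>P\<^esub> a) = lead_coeff h"
  proof (cases "a = []")
    case True
    then have "h \<oplus>\<^bsub>P\<^esub> a = h" using UP.r_zero[OF h(1)] by (simp add: univ_poly_zero)
    then show ?thesis using h by simp
  next
    case False
    have sets: "set h \<subseteq> carrier R" "set a \<subseteq> carrier R" using h a set_carrier_P by auto
    have lt: "length a < length h" using a False by auto
    have add: "h \<oplus>\<^bsub>P\<^esub> a = poly_add h a" by (simp add: univ_poly_add)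
    have len: "length (poly_add h a) = length h"
      using poly_add_length_eq[OF carrier_is_subring, of h a] h a lt by (simp add: univ_poly_carrier)
    then have ne: "poly_add h a \<noteq> []" using h by auto
    have "lead_coeff (poly_add h a) = coeff (poly_add h a) (degree h)"
      using lead_coeff_simp[OF ne] len by simp
    also have "\<dots> = coeff h (degree h) \<oplus> coeff a (degree h)" using poly_add_coeff[OF sets] by simp
    also have "coeff a (degree h) = \<zero>" using a False by (intro coeff_degree) auto
    also have "coeff h (degree h) = lead_coeff h" by (rule lead_coeff_simp[OF h(2)])
    finally have "lead_coeff (poly_add h a) = lead_coeff h"
      using lead_coeff_nonzero[OF h] by (simp add: nonzero_def)
    then show ?thesis using ne len add by simp
  qed
  then show "h \<oplus>\<^bsub>P\<^esub> a \<noteq> []" "degree (h \<oplus>\<^bsub>P\<^esub> a) = degree h" "lead_coeff (h \<oplus>\<^bsub>P\<^esub> a) = lead_coeff h"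
    by blast+
qed

text \<open>Division with remainder. Once n is at least the degree of \<open>Q\<close>, residue and
  monic quotient can be prescribed freely and independently; this is why equidistribution is exact
  here and not merely asymptotic.\<close>

lemma division_bij:
  assumes Q: "Q \<in> monics" and n: "degree Q \<le> n"
  shows "bij_betw (\<lambda>(a, g). Q \<otimes>\<^bsub>P\<^esub> g \<oplus>\<^bsub>P\<^esub> a) (low Q \<times> Mon (n - degree Q)) (Mon n)"
proof (rule bij_betw_imageI)
  have Qc: "Q \<in> carrier P" "Q \<noteq> []" using Q monics_closed monics_ne by auto
  show "inj_on (\<lambda>(a, g). Q \<otimes>\<^bsub>P\<^esub> g \<oplus>\<^bsub>P\<^esub> a) (low Q \<times> Mon (n - degree Q))"
  proof (rule inj_onI, clarify)
    fix a g b h assume ag: "a \<in> low Q" "g \<in> monics" "b \<in> low Q" "h \<in> monics"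
      and eq: "Q \<otimes>\<^bsub>P\<^esub> g \<oplus>\<^bsub>P\<^esub> a = Q \<otimes>\<^bsub>P\<^esub> h \<oplus>\<^bsub>P\<^esub> b"
    have c: "a \<in> carrier P" "g \<in> carrier P" "b \<in> carrier P" "h \<in> carrier P"
      using ag monics_closed by (auto simp: low_def)
    let ?f = "Q \<otimes>\<^bsub>P\<^esub> g \<oplus>\<^bsub>P\<^esub> a"
    have "long_divides ?f Q (g, a)" "long_divides ?f Q (h, b)"
      using c ag eq by (auto simp: long_divides_def low_def)
    then show "a = b \<and> g = h"
      using exists_unique_long_division[OF carrier_is_subfield, of ?f Q] Qc c by auto
  qed
  show "(\<lambda>(a, g). Q \<otimes>\<^bsub>P\<^esub> g \<oplus>\<^bsub>P\<^esub> a) ` (low Q \<times> Mon (n - degree Q)) = Mon n"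
  proof (intro equalityI subsetI)
    fix f assume "f \<in> (\<lambda>(a, g). Q \<otimes>\<^bsub>P\<^esub> g \<oplus>\<^bsub>P\<^esub> a) ` (low Q \<times> Mon (n - degree Q))"
    then obtain a g where ag: "a \<in> low Q" "g \<in> monics" "degree g = n - degree Q" "f = Q \<otimes>\<^bsub>P\<^esub> g \<oplus>\<^bsub>P\<^esub> a" by auto
    have m: "Q \<otimes>\<^bsub>P\<^esub> g \<in> monics" "degree (Q \<otimes>\<^bsub>P\<^esub> g) = n"
      using monics_mult[OF Q ag(2)] degree_monics_mult[OF Q ag(2)] ag n by auto
    have a: "a \<in> carrier P" "a = [] \<or> degree a < degree (Q \<otimes>\<^bsub>P\<^esub> g)"
      using ag n m by (auto simp: low_def)
    show "f \<in> Mon n"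
      using add_lower_degree[OF monics_closed[OF m(1)] monics_ne[OF m(1)] a] m a monics_closed[OF m(1)]
      unfolding ag(4) monics_def by auto
  next
    fix f assume f: "f \<in> Mon n"
    then have fc: "f \<in> carrier P" "f \<noteq> []" "lead_coeff f = \<one>" "degree f = n" by (auto simp: monics_def)
    obtain b r where br: "b \<in> carrier P" "r \<in> carrier P" "long_divides f Q (b, r)"
      using exists_long_division[OF carrier_is_subfield fc(1) Qc] .
    have eq: "f = Q \<otimes>\<^bsub>P\<^esub> b \<oplus>\<^bsub>P\<^esub> r" and r: "r = [] \<or> degree r < degree Q"
      using br by (auto simp: long_divides_def)
    have b: "b \<noteq> []"
    proof
      assume "b = []"
      then have "f = r" using eq br Qc UP.r_null[OF Qc(1)] by (simp add: univ_poly_zero)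
      then show False using r fc n by auto
    qed
    note m = P_mult_ne[OF Qc(1) br(1) Qc(2) b]
    have r': "r = [] \<or> degree r < degree (Q \<otimes>\<^bsub>P\<^esub> b)" using r m by auto
    note ad = add_lower_degree[OF UP.m_closed[OF Qc(1) br(1)] m(1) br(2) r', folded eq]
    have "lead_coeff b \<in> carrier R" using lead_coeff_nonzero[OF br(1) b] by (simp add: nonzero_def)
    moreover have "\<one> = \<one> \<otimes> lead_coeff b"
    proof -
      have "lead_coeff Q = \<one>" using Q by (simp add: monics_def)
      then show ?thesis using ad(3) m(3) fc(3) by metis
    qed
    ultimately have "lead_coeff b = \<one>" using l_one by metis
    moreover have "degree b = n - degree Q" using ad(2) m(2) fc by simp
    ultimately have "(r, b) \<in> low Q \<times> Mon (n - degree Q)"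
      using b br r by (auto simp: monics_def low_def)
    then show "f \<in> (\<lambda>(a, g). Q \<otimes>\<^bsub>P\<^esub> g \<oplus>\<^bsub>P\<^esub> a) ` (low Q \<times> Mon (n - degree Q))"
      using eq by (intro image_eqI[of _ _ "(r, b)"]) auto
  qed
qed

lemma finite_low: "finite (low Q)"
proof (rule finite_subset)
  show "low Q \<subseteq> {xs. set xs \<subseteq> carrier R \<and> length xs \<le> degree Q}"
    using set_carrier_P by (auto simp: low_def)
  show "finite {xs. set xs \<subseteq> carrier R \<and> length xs \<le> degree Q}"
    using finite_carrier by (rule finite_lists_length_le)
qed

lemma sum_division:
  fixes F :: "'a list \<Rightarrow> 'c::comm_monoid_add"
  assumes "Q \<in> monics" "degree Q \<le> n"
  shows "(\<Sum>f\<in>Mon n. F f) = (\<Sum>a\<in>low Q. \<Sum>g\<in>Mon (n - degree Q). F (Q \<otimes>\<^bsub>P\<^esub> g \<oplus>\<^bsub>P\<^esub> a))"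
proof -
  have "(\<Sum>f\<in>Mon n. F f)
      = (\<Sum>t\<in>low Q \<times> Mon (n - degree Q). F ((\<lambda>(a, g). Q \<otimes>\<^bsub>P\<^esub> g \<oplus>\<^bsub>P\<^esub> a) t))"
    by (rule sum.reindex_bij_betw[OF division_bij[OF assms], symmetric])
  also have "\<dots> = (\<Sum>(a, g)\<in>low Q \<times> Mon (n - degree Q). F (Q \<otimes>\<^bsub>P\<^esub> g \<oplus>\<^bsub>P\<^esub> a))"
    by (intro sum.cong refl) (simp add: case_prod_unfold)
  also have "\<dots> = (\<Sum>a\<in>low Q. \<Sum>g\<in>Mon (n - degree Q). F (Q \<otimes>\<^bsub>P\<^esub> g \<oplus>\<^bsub>P\<^esub> a))"
    by (rule sum.cartesian_product[symmetric])
  finally show ?thesis .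
qed

lemma affine_bij:
  assumes "c \<in> nonzero" "d \<in> carrier R"
  shows "bij_betw (\<lambda>v. c \<otimes> v \<oplus> d) (carrier R) (carrier R)"
proof -
  have c: "c \<in> carrier R" "c \<noteq> \<zero>" using assms by (auto simp: nonzero_def)
  have "inj_on (\<lambda>v. c \<otimes> v \<oplus> d) (carrier R)"
    using c assms m_lcancel by (auto simp: inj_on_def)
  moreover have "(\<lambda>v. c \<otimes> v \<oplus> d) ` carrier R \<subseteq> carrier R" using c assms by auto
  ultimately show ?thesis unfolding bij_betw_def using endo_inj_surj[OF finite_carrier] by blast
qed

lemma low_linear: "low (linear x) = insert [] ((\<lambda>c. [c]) ` nonzero)"
proof (intro equalityI subsetI)
  fix a assume "a \<in> low (linear x)"
  then show "a \<in> insert [] ((\<lambda>c. [c]) ` nonzero)"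
    by (cases a) (auto simp: low_def linear_def carrier_P nonzero_def)
qed (auto simp: low_def linear_def carrier_P nonzero_def)

text \<open>Induction over the points: dividing by t - x, the remainder is forced to be the constant
  \<open>v x\<close>, and at the remaining points y the quotient must take the value (v y - v x) /
  (y - x), which is \<open>v'\<close>.\<close>

lemma card_interpolation:
  assumes "finite U" "U \<subseteq> carrier R" "\<And>x. x \<in> U \<Longrightarrow> v x \<in> carrier R" "card U \<le> n"
  shows "card {f \<in> Mon n. \<forall>x\<in>U. eval f x = v x} = qq ^ (n - card U)"
  using assms
proof (induction U arbitrary: n v rule: finite_induct)
  case empty
  then show ?case using card_monics_degree by simp
next
  case (insert x U)
  have x: "x \<in> carrier R" "v x \<in> carrier R" and U: "U \<subseteq> carrier R" using insert by auto
  have L: "linear x \<in> monics" "degree (linear x) = 1" using linear_monics[OF x(1)] by (auto simp: linear_def)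
  have n: "degree (linear x) \<le> n" "card U \<le> n - 1" using insert L by auto
  \<comment> \<open>The constant \<open>v x\<close> as a coefficient list, which is
    \<open>[]\<close> when the constant is zero.\<close>
  define a0 where "a0 = (if v x = \<zero> then [] else [v x])"
  define v' where "v' y = inv (y \<ominus> x) \<otimes> (v y \<ominus> v x)" for y
  have a0: "a0 \<in> low (linear x)" using x by (auto simp: a0_def low_linear nonzero_def)
  have eval_a: "a = a0 \<longleftrightarrow> eval a x = v x" if "a \<in> low (linear x)" for a
    using that x unfolding low_linear a0_def by (auto simp: nonzero_def)
  have ev_const: "eval a0 y = v x" if "y \<in> carrier R" for y using that x by (simp add: a0_def)
  have diff: "y \<ominus> x \<in> nonzero" if "y \<in> U" for y
    using that insert x U by (auto simp: nonzero_def r_right_minus_eq)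
  have key: "(\<forall>y\<in>insert x U. eval (linear x \<otimes>\<^bsub>P\<^esub> g \<oplus>\<^bsub>P\<^esub> a) y = v y) \<longleftrightarrow> a = a0 \<and> (\<forall>y\<in>U. eval g y = v' y)"
    if g: "g \<in> monics" and a: "a \<in> low (linear x)" for g a
  proof -
    have c: "g \<in> carrier P" "a \<in> carrier P" "linear x \<in> carrier P" using g a L monics_closed by (auto simp: low_def)
    have ev: "eval (linear x \<otimes>\<^bsub>P\<^esub> g \<oplus>\<^bsub>P\<^esub> a) y = (y \<ominus> x) \<otimes> eval g y \<oplus> eval a y" if "y \<in> carrier R" for y
      using c that x by (simp add: eval_add eval_mult eval_linear)
    have "eval (linear x \<otimes>\<^bsub>P\<^esub> g \<oplus>\<^bsub>P\<^esub> a) x = eval a x"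
      unfolding ev[OF x(1)] using x c eval_closed[OF c(1) x(1)] eval_closed[OF c(2) x(1)] by (simp add: r_right_minus_eq[THEN iffD2])
    then have 1: "eval (linear x \<otimes>\<^bsub>P\<^esub> g \<oplus>\<^bsub>P\<^esub> a) x = v x \<longleftrightarrow> a = a0" using eval_a[OF a] by simp
    have 2: "eval (linear x \<otimes>\<^bsub>P\<^esub> g \<oplus>\<^bsub>P\<^esub> a) y = v y \<longleftrightarrow> eval g y = v' y" if y: "y \<in> U" and "a = a0" for y
    proof -
      have yc: "y \<in> carrier R" "v y \<in> carrier R" using y U insert by auto
      let ?d = "y \<ominus> x"
      have d: "?d \<in> nonzero" "?d \<in> carrier R" "inv ?d \<in> carrier R" "inv ?d \<otimes> ?d = \<one>" "?d \<otimes> inv ?d = \<one>"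
        using diff[OF y] nonzero_inv[OF diff[OF y]] by (auto simp: nonzero_def)
      have e: "eval g y \<in> carrier R" using eval_closed[OF c(1) yc(1)] .
      have "eval (linear x \<otimes>\<^bsub>P\<^esub> g \<oplus>\<^bsub>P\<^esub> a) y = v y \<longleftrightarrow> ?d \<otimes> eval g y \<oplus> v x = v y"
        using ev[OF yc(1)] ev_const[OF yc(1)] that by simp
      also have "\<dots> \<longleftrightarrow> ?d \<otimes> eval g y = v y \<ominus> v x"
      proof
        assume "?d \<otimes> eval g y \<oplus> v x = v y"
        then have "v y \<ominus> v x = ?d \<otimes> eval g y \<oplus> v x \<ominus> v x" by simp
        also have "\<dots> = ?d \<otimes> eval g y" using d e x(2) by algebra
        finally show "?d \<otimes> eval g y = v y \<ominus> v x" by simp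
      next
        assume "?d \<otimes> eval g y = v y \<ominus> v x"
        then have "?d \<otimes> eval g y \<oplus> v x = v y \<ominus> v x \<oplus> v x" by simp
        also have "\<dots> = v y" using yc x(2) by algebra
        finally show "?d \<otimes> eval g y \<oplus> v x = v y" .
      qed
      also have "\<dots> \<longleftrightarrow> eval g y = v' y"
      proof
        assume "?d \<otimes> eval g y = v y \<ominus> v x"
        then have "v' y = inv ?d \<otimes> (?d \<otimes> eval g y)" by (simp add: v'_def)
        also have "\<dots> = eval g y" using d e by (simp add: m_assoc[symmetric])
        finally show "eval g y = v' y" by simp
      next
        assume "eval g y = v' y"
        then have "?d \<otimes> eval g y = (?d \<otimes> inv ?d) \<otimes> (v y \<ominus> v x)"
          unfolding v'_def using m_assoc[OF d(2,3) minus_closed[OF yc(2) x(2)]] by (simp only:)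
        then show "?d \<otimes> eval g y = v y \<ominus> v x" using d yc x by simp
      qed
      finally show ?thesis .
    qed
    show ?thesis using 1 2 by auto
  qed
  let ?cond = "\<lambda>f. \<forall>y\<in>insert x U. eval f y = v y"
  have "card {f \<in> Mon n. ?cond f} = (\<Sum>f\<in>Mon n. of_bool (?cond f))"
    using finite_monics_degree[of n] by (simp add: Int_def)
  also have "\<dots> = (\<Sum>a\<in>low (linear x). \<Sum>g\<in>Mon (n - 1). of_bool (?cond (linear x \<otimes>\<^bsub>P\<^esub> g \<oplus>\<^bsub>P\<^esub> a)))"
    by (rule sum_division[OF L(1) n(1), unfolded L(2)])
  also have "\<dots> = (\<Sum>a\<in>low (linear x). if a = a0 then \<Sum>g\<in>Mon (n - 1). of_bool (\<forall>y\<in>U. eval g y = v' y) else 0)"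
  proof (intro sum.cong refl)
    fix a assume a: "a \<in> low (linear x)"
    have "(\<Sum>g\<in>Mon (n - 1). of_bool (?cond (linear x \<otimes>\<^bsub>P\<^esub> g \<oplus>\<^bsub>P\<^esub> a)))
        = (\<Sum>g\<in>Mon (n - 1). of_bool (a = a0 \<and> (\<forall>y\<in>U. eval g y = v' y)) :: nat)"
      by (intro sum.cong refl arg_cong[where f = of_bool] key) (use a in auto)
    then show "(\<Sum>g\<in>Mon (n - 1). of_bool (?cond (linear x \<otimes>\<^bsub>P\<^esub> g \<oplus>\<^bsub>P\<^esub> a)))
        = (if a = a0 then \<Sum>g\<in>Mon (n - 1). of_bool (\<forall>y\<in>U. eval g y = v' y) else 0 :: nat)" by simp
  qed
  also have "\<dots> = (\<Sum>g\<in>Mon (n - 1). of_bool (\<forall>y\<in>U. eval g y = v' y))"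
    using a0 finite_low by simp
  also have "\<dots> = card {g \<in> Mon (n - 1). \<forall>y\<in>U. eval g y = v' y}"
    using finite_monics_degree[of "n - 1"] by (simp add: Int_def)
  also have "\<dots> = qq ^ (n - 1 - card U)"
  proof (rule insert.IH[OF U _ n(2)])
    fix y assume y: "y \<in> U"
    then have "inv (y \<ominus> x) \<in> carrier R" using nonzero_inv[OF diff[OF y]] by (simp add: nonzero_def)
    then show "v' y \<in> carrier R" using y insert x by (simp add: v'_def)
  qed
  finally show ?case using insert by simp
qed

lemma card_eval_in:
  assumes U: "U \<subseteq> carrier R" and B: "\<And>x. x \<in> U \<Longrightarrow> B x \<subseteq> carrier R" and n: "card U \<le> n"
  shows "card {f \<in> Mon n. \<forall>x\<in>U. eval f x \<in> B x} = qq ^ (n - card U) * (\<Prod>x\<in>U. card (B x))"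
proof -
  have finU: "finite U" using U finite_carrier finite_subset by blast
  have finB: "finite (B x)" if "x \<in> U" for x using B[OF that] finite_carrier finite_subset by blast
  let ?A = "{f \<in> Mon n. \<forall>x\<in>U. eval f x \<in> B x}"
  let ?r = "\<lambda>f. restrict (eval f) U"
  have finA: "finite ?A" by (rule finite_subset[OF _ finite_monics_degree[of n]]) auto
  have "card ?A = (\<Sum>v\<in>PiE U B. card {f \<in> ?A. ?r f = v})"
    using sum.group[where g = ?r and h = "\<lambda>_. 1::nat", OF finA finite_PiE[OF finU finB]]
    by (auto simp: image_subset_iff)
  also have "\<dots> = (\<Sum>v\<in>PiE U B. qq ^ (n - card U))"
  proof (intro sum.cong refl)
    fix v assume v: "v \<in> PiE U B"
    have "{f \<in> ?A. ?r f = v} = {f \<in> Mon n. \<forall>x\<in>U. eval f x = v x}"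
    proof (intro equalityI subsetI)
      fix f assume "f \<in> {f \<in> ?A. ?r f = v}"
      then show "f \<in> {f \<in> Mon n. \<forall>x\<in>U. eval f x = v x}" by auto
    next
      fix f assume f: "f \<in> {f \<in> Mon n. \<forall>x\<in>U. eval f x = v x}"
      then have "?r f = v" using v by (auto simp: PiE_def extensional_def fun_eq_iff)
      moreover have "\<forall>x\<in>U. eval f x \<in> B x" using f v by auto
      ultimately show "f \<in> {f \<in> ?A. ?r f = v}" using f by simp
    qed
    moreover have "v x \<in> carrier R" if "x \<in> U" for x using v B that by (meson PiE_mem subsetD)
    ultimately show "card {f \<in> ?A. ?r f = v} = qq ^ (n - card U)"
      using card_interpolation[OF finU U _ n, of v] by simp
  qed
  also have "\<dots> = card (PiE U B) * qq ^ (n - card U)" by simp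
  also have "card (PiE U B) = (\<Prod>x\<in>U. card (B x))" by (rule card_PiE[OF finU])
  finally show ?thesis by (simp add: mult.commute)
qed

text \<open>Writing f = Q g + a, the function \<open>F\<close> sees only the residue
  \<open>a\<close>. Since \<open>Q\<close> does not vanish at x, the value of f at x is an affine
  bijective function of the value of g, so for every \<open>a\<close> the sign condition at x admits
  (q - 1) / 2 values of g there. By interpolation the conditions at different points are
  independent.\<close>

lemma sum_equidistributed:
  fixes F :: "'a list \<Rightarrow> real"
  assumes Q: "Q \<in> monics" and U: "U \<subseteq> carrier R" and nz: "\<And>x. x \<in> U \<Longrightarrow> eval Q x \<noteq> \<zero>"
    and s: "\<And>x. x \<in> U \<Longrightarrow> s x \<in> {1, -1}" and n: "degree Q + card U \<le> n"
    and F: "\<And>g a. \<lbrakk>g \<in> carrier P; a \<in> carrier P\<rbrakk> \<Longrightarrow> F (Q \<otimes>\<^bsub>P\<^esub> g \<oplus>\<^bsub>P\<^esub> a) = F a"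
  shows "(\<Sum>f\<in>Mon n. of_bool (\<forall>x\<in>U. qc (eval f x) = s x) * F f)
    = real qq ^ n / real qq ^ degree Q * ((real qq - 1) / (2 * real qq)) ^ card U * (\<Sum>a\<in>low Q. F a)"
proof -
  let ?d = "degree Q"
  have Qc: "Q \<in> carrier P" using Q monics_closed by blast
  have q0: "real qq \<noteq> 0" using card_ge_3 by simp
  have inner: "(\<Sum>g\<in>Mon (n - ?d). of_bool (\<forall>x\<in>U. qc (eval (Q \<otimes>\<^bsub>P\<^esub> g \<oplus>\<^bsub>P\<^esub> a) x) = s x))
      = real qq ^ n / real qq ^ ?d * ((real qq - 1) / (2 * real qq)) ^ card U" if a: "a \<in> low Q" for a
  proof -
    have ac: "a \<in> carrier P" using a by (simp add: low_def)
    define B where "B x = {v \<in> carrier R. qc (eval Q x \<otimes> v \<oplus> eval a x) = s x}" for x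
    have cardB: "real (card (B x)) = (real qq - 1) / 2" if x: "x \<in> U" for x
    proof -
      have xc: "x \<in> carrier R" using x U by blast
      have "eval Q x \<in> nonzero" using nz[OF x] eval_closed[OF Qc xc] by (simp add: nonzero_def)
      note bij = affine_bij[OF this eval_closed[OF ac xc]]
      have "bij_betw (\<lambda>v. eval Q x \<otimes> v \<oplus> eval a x) (B x) {w \<in> carrier R. qc w = s x}"
        by (rule bij_betw_subset[OF bij]) (use bij in \<open>auto simp: B_def bij_betw_def\<close>)
      then have "card (B x) = card {w \<in> carrier R. qc w = s x}" by (rule bij_betw_same_card)
      then have "2 * card (B x) = qq - 1" using card_qc[OF s[OF x]] by simp
      then have "2 * real (card (B x)) = real (qq - 1)" by (metis of_nat_mult of_nat_numeral)
      then show ?thesis using card_ge_3 by (simp add: of_nat_diff)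
    qed
    have "(\<Sum>g\<in>Mon (n - ?d). of_bool (\<forall>x\<in>U. qc (eval (Q \<otimes>\<^bsub>P\<^esub> g \<oplus>\<^bsub>P\<^esub> a) x) = s x))
        = (\<Sum>g\<in>Mon (n - ?d). of_bool (\<forall>x\<in>U. eval g x \<in> B x) :: real)"
    proof (intro sum.cong refl arg_cong[where f = of_bool] ball_cong)
      fix g x assume "g \<in> Mon (n - ?d)" "x \<in> U"
      then have "g \<in> carrier P" "x \<in> carrier R" using monics_closed U by auto
      then show "(qc (eval (Q \<otimes>\<^bsub>P\<^esub> g \<oplus>\<^bsub>P\<^esub> a) x) = s x) = (eval g x \<in> B x)"
        using Qc ac by (simp add: B_def eval_add eval_mult eval_closed)
    qed
    also have "\<dots> = real (card {g \<in> Mon (n - ?d). \<forall>x\<in>U. eval g x \<in> B x})"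
      using finite_monics_degree[of "n - ?d"] by (simp add: Int_def)
    also have "\<dots> = real (qq ^ (n - ?d - card U) * (\<Prod>x\<in>U. card (B x)))"
      by (subst card_eval_in) (use U n in \<open>auto simp: B_def\<close>)
    also have "\<dots> = real qq ^ (n - ?d - card U) * ((real qq - 1) / 2) ^ card U"
      by (simp add: cardB)
    also have "real qq ^ (n - ?d - card U) = real qq ^ n / real qq ^ ?d / real qq ^ card U"
      using n q0 by (simp add: power_diff power_add)
    also have "real qq ^ n / real qq ^ ?d / real qq ^ card U * ((real qq - 1) / 2) ^ card U
        = real qq ^ n / real qq ^ ?d * ((real qq - 1) / (2 * real qq)) ^ card U"
      by (simp add: power_divide power_mult_distrib)
    finally show ?thesis .
  qed
  have dn: "?d \<le> n" using n by simp
  have "(\<Sum>f\<in>Mon n. of_bool (\<forall>x\<in>U. qc (eval f x) = s x) * F f)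
    = (\<Sum>a\<in>low Q. \<Sum>g\<in>Mon (n - ?d). of_bool (\<forall>x\<in>U. qc (eval (Q \<otimes>\<^bsub>P\<^esub> g \<oplus>\<^bsub>P\<^esub> a) x) = s x) * F (Q \<otimes>\<^bsub>P\<^esub> g \<oplus>\<^bsub>P\<^esub> a))"
    by (rule sum_division[OF Q dn])
  also have "\<dots> = (\<Sum>a\<in>low Q. (\<Sum>g\<in>Mon (n - ?d). of_bool (\<forall>x\<in>U. qc (eval (Q \<otimes>\<^bsub>P\<^esub> g \<oplus>\<^bsub>P\<^esub> a) x) = s x)) * F a)"
    unfolding sum_distrib_right
    by (intro sum.cong refl arg_cong2[where f = "(*)"] F) (auto simp: low_def monics_closed)
  also have "\<dots> = (\<Sum>a\<in>low Q. real qq ^ n / real qq ^ ?d * ((real qq - 1) / (2 * real qq)) ^ card U * F a)"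
    by (intro sum.cong refl) (simp only: inner)
  also have "\<dots> = real qq ^ n / real qq ^ ?d * ((real qq - 1) / (2 * real qq)) ^ card U * (\<Sum>a\<in>low Q. F a)"
    by (rule sum_distrib_left[symmetric])
  finally show ?thesis .
qed

definition pdeg :: "'a list \<Rightarrow> nat" where "pdeg f = degree f"

definition chi :: "'a list \<Rightarrow> 'a \<Rightarrow> real" where "chi f x = real_of_int (qc (eval f x))"

text \<open>There are q^(6 deg E) triples of residues modulo E^2; this is the proportion of those
  with product 0.\<close>

definition rho :: "'a list \<Rightarrow> real" where
  "rho E = (\<Sum>a\<in>low (E \<otimes>\<^bsub>P\<^esub> E). \<Sum>b\<in>low (E \<otimes>\<^bsub>P\<^esub> E). \<Sum>c\<in>low (E \<otimes>\<^bsub>P\<^esub> E).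
     of_bool (E \<otimes>\<^bsub>P\<^esub> E divides\<^bsub>P\<^esub> a \<otimes>\<^bsub>P\<^esub> b \<otimes>\<^bsub>P\<^esub> c)) / real qq ^ (6 * degree E)"

lemma carrier_monic_monoid_of: "carrier monic_monoid_of = monics"
  and mult_monic_monoid_of: "mult monic_monoid_of = mult P"
  and one_monic_monoid_of: "one monic_monoid_of = one P"
  by (simp_all add: monic_monoid_of_def)

lemma divides_mult_add_iff:
  assumes "Q \<in> carrier P" "u \<in> carrier P" "z \<in> carrier P"
  shows "Q divides\<^bsub>P\<^esub> (Q \<otimes>\<^bsub>P\<^esub> u \<oplus>\<^bsub>P\<^esub> z) \<longleftrightarrow> Q divides\<^bsub>P\<^esub> z"
proof
  assume "Q divides\<^bsub>P\<^esub> (Q \<otimes>\<^bsub>P\<^esub> u \<oplus>\<^bsub>P\<^esub> z)"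
  then obtain c where c: "c \<in> carrier P" "Q \<otimes>\<^bsub>P\<^esub> u \<oplus>\<^bsub>P\<^esub> z = Q \<otimes>\<^bsub>P\<^esub> c" by (auto simp: factor_def)
  have "z = (Q \<otimes>\<^bsub>P\<^esub> u \<oplus>\<^bsub>P\<^esub> z) \<ominus>\<^bsub>P\<^esub> Q \<otimes>\<^bsub>P\<^esub> u" using assms by algebra
  also have "\<dots> = Q \<otimes>\<^bsub>P\<^esub> (c \<ominus>\<^bsub>P\<^esub> u)" unfolding c(2) using assms c(1) by algebra
  finally have "z = Q \<otimes>\<^bsub>P\<^esub> (c \<ominus>\<^bsub>P\<^esub> u)" .
  moreover have "c \<ominus>\<^bsub>P\<^esub> u \<in> carrier P" using assms c by simp
  ultimately show "Q divides\<^bsub>P\<^esub> z" unfolding factor_def by blast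
next
  assume "Q divides\<^bsub>P\<^esub> z"
  then obtain c where c: "c \<in> carrier P" "z = Q \<otimes>\<^bsub>P\<^esub> c" by (auto simp: factor_def)
  have "Q \<otimes>\<^bsub>P\<^esub> u \<oplus>\<^bsub>P\<^esub> z = Q \<otimes>\<^bsub>P\<^esub> (u \<oplus>\<^bsub>P\<^esub> c)" unfolding c(2) using assms c(1) by algebra
  moreover have "u \<oplus>\<^bsub>P\<^esub> c \<in> carrier P" using assms c by simp
  ultimately show "Q divides\<^bsub>P\<^esub> (Q \<otimes>\<^bsub>P\<^esub> u \<oplus>\<^bsub>P\<^esub> z)" unfolding factor_def by blast
qed

lemma divides_prod_shift:
  assumes "Q \<in> carrier P" "u \<in> carrier P" "a \<in> carrier P" "g \<in> carrier P" "h \<in> carrier P"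
  shows "Q divides\<^bsub>P\<^esub> (Q \<otimes>\<^bsub>P\<^esub> u \<oplus>\<^bsub>P\<^esub> a) \<otimes>\<^bsub>P\<^esub> g \<otimes>\<^bsub>P\<^esub> h \<longleftrightarrow> Q divides\<^bsub>P\<^esub> a \<otimes>\<^bsub>P\<^esub> g \<otimes>\<^bsub>P\<^esub> h"
    "Q divides\<^bsub>P\<^esub> g \<otimes>\<^bsub>P\<^esub> (Q \<otimes>\<^bsub>P\<^esub> u \<oplus>\<^bsub>P\<^esub> a) \<otimes>\<^bsub>P\<^esub> h \<longleftrightarrow> Q divides\<^bsub>P\<^esub> g \<otimes>\<^bsub>P\<^esub> a \<otimes>\<^bsub>P\<^esub> h"
    "Q divides\<^bsub>P\<^esub> g \<otimes>\<^bsub>P\<^esub> h \<otimes>\<^bsub>P\<^esub> (Q \<otimes>\<^bsub>P\<^esub> u \<oplus>\<^bsub>P\<^esub> a) \<longleftrightarrow> Q divides\<^bsub>P\<^esub> g \<otimes>\<^bsub>P\<^esub> h \<otimes>\<^bsub>P\<^esub> a"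
proof -
  have 1: "(Q \<otimes>\<^bsub>P\<^esub> u \<oplus>\<^bsub>P\<^esub> a) \<otimes>\<^bsub>P\<^esub> g \<otimes>\<^bsub>P\<^esub> h = Q \<otimes>\<^bsub>P\<^esub> (u \<otimes>\<^bsub>P\<^esub> g \<otimes>\<^bsub>P\<^esub> h) \<oplus>\<^bsub>P\<^esub> a \<otimes>\<^bsub>P\<^esub> g \<otimes>\<^bsub>P\<^esub> h"
    using assms by algebra
  have 2: "g \<otimes>\<^bsub>P\<^esub> (Q \<otimes>\<^bsub>P\<^esub> u \<oplus>\<^bsub>P\<^esub> a) \<otimes>\<^bsub>P\<^esub> h = Q \<otimes>\<^bsub>P\<^esub> (u \<otimes>\<^bsub>P\<^esub> g \<otimes>\<^bsub>P\<^esub> h) \<oplus>\<^bsub>P\<^esub> g \<otimes>\<^bsub>P\<^esub> a \<otimes>\<^bsub>P\<^esub> h"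
    using assms by algebra
  have 3: "g \<otimes>\<^bsub>P\<^esub> h \<otimes>\<^bsub>P\<^esub> (Q \<otimes>\<^bsub>P\<^esub> u \<oplus>\<^bsub>P\<^esub> a) = Q \<otimes>\<^bsub>P\<^esub> (u \<otimes>\<^bsub>P\<^esub> g \<otimes>\<^bsub>P\<^esub> h) \<oplus>\<^bsub>P\<^esub> g \<otimes>\<^bsub>P\<^esub> h \<otimes>\<^bsub>P\<^esub> a"
    using assms by algebra
  note cl = UP.m_closed assms
  show "Q divides\<^bsub>P\<^esub> (Q \<otimes>\<^bsub>P\<^esub> u \<oplus>\<^bsub>P\<^esub> a) \<otimes>\<^bsub>P\<^esub> g \<otimes>\<^bsub>P\<^esub> h \<longleftrightarrow> Q divides\<^bsub>P\<^esub> a \<otimes>\<^bsub>P\<^esub> g \<otimes>\<^bsub>P\<^esub> h"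
    unfolding 1 by (rule divides_mult_add_iff) (intro cl)+
  show "Q divides\<^bsub>P\<^esub> g \<otimes>\<^bsub>P\<^esub> (Q \<otimes>\<^bsub>P\<^esub> u \<oplus>\<^bsub>P\<^esub> a) \<otimes>\<^bsub>P\<^esub> h \<longleftrightarrow> Q divides\<^bsub>P\<^esub> g \<otimes>\<^bsub>P\<^esub> a \<otimes>\<^bsub>P\<^esub> h"
    unfolding 2 by (rule divides_mult_add_iff) (intro cl)+
  show "Q divides\<^bsub>P\<^esub> g \<otimes>\<^bsub>P\<^esub> h \<otimes>\<^bsub>P\<^esub> (Q \<otimes>\<^bsub>P\<^esub> u \<oplus>\<^bsub>P\<^esub> a) \<longleftrightarrow> Q divides\<^bsub>P\<^esub> g \<otimes>\<^bsub>P\<^esub> h \<otimes>\<^bsub>P\<^esub> a"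
    unfolding 3 by (rule divides_mult_add_iff) (intro cl)+
qed

text \<open>\<open>sum_equidistributed\<close> with Q = E^2 is applied to h, then g, then f. Each
  time the divisibility indicator \<open>D\<close> depends on the variable being summed through its
  residue only, and the variables already treated have been replaced by residues.\<close>

lemma equidistribution_triples:
  assumes E: "E \<in> monics" and U: "U \<subseteq> carrier R" and nz: "\<And>x. x \<in> U \<Longrightarrow> chi E x \<noteq> 0"
    and s: "\<And>x. x \<in> U \<Longrightarrow> s x \<in> {1, -1} \<times> {1, -1} \<times> {1, -1}"
    and n: "n1 \<ge> 2 * pdeg E + card U" "n2 \<ge> 2 * pdeg E + card U" "n3 \<ge> 2 * pdeg E + card U"
  shows "real (card {(f, g, h). f \<in> monics \<and> g \<in> monics \<and> h \<in> monics
        \<and> pdeg f = n1 \<and> pdeg g = n2 \<and> pdeg h = n3 \<and> E \<otimes>\<^bsub>P\<^esub> E divides\<^bsub>P\<^esub> f \<otimes>\<^bsub>P\<^esub> g \<otimes>\<^bsub>P\<^esub> h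
        \<and> (\<forall>x\<in>U. (chi f x, chi g x, chi h x) = s x)})
      = rho E * real qq ^ (n1 + n2 + n3) * ((real qq - 1) / (2 * real qq)) ^ (3 * card U)"
proof -
  define Q where "Q = E \<otimes>\<^bsub>P\<^esub> E"
  have Q: "Q \<in> monics" "degree Q = 2 * degree E" "Q \<in> carrier P"
    unfolding Q_def using monics_mult[OF E E] degree_monics_mult[OF E E] monics_closed by auto
  have Ec: "E \<in> carrier P" using E monics_closed by blast
  have nzQ: "eval Q x \<noteq> \<zero>" if "x \<in> U" for x
  proof -
    have x: "x \<in> carrier R" using that U by blast
    have "eval E x \<noteq> \<zero>" using nz[OF that] by (simp add: chi_def qc_eq_0_iff)
    then show ?thesis unfolding Q_def eval_mult[OF Ec Ec x] using integral eval_closed[OF Ec x] by blast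
  qed
  define sg :: "real \<Rightarrow> int" where "sg r = (if r = 1 then 1 else -1)" for r
  define s1 s2 s3 where "s1 x = sg (fst (s x))" and "s2 x = sg (fst (snd (s x)))" and "s3 x = sg (snd (snd (s x)))" for x
  have sgn: "s1 x \<in> {1, -1}" "s2 x \<in> {1, -1}" "s3 x \<in> {1, -1}" for x
    by (auto simp: s1_def s2_def s3_def sg_def)
  have sgn_iff: "(chi f x, chi g x, chi h x) = s x
      \<longleftrightarrow> qc (eval f x) = s1 x \<and> qc (eval g x) = s2 x \<and> qc (eval h x) = s3 x" if "x \<in> U" for f g h x
  proof -
    obtain a b c where abc: "s x = (a, b, c)" by (cases "s x")
    have "a \<in> {1, -1}" "b \<in> {1, -1}" "c \<in> {1, -1}" using s[OF that] abc by auto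
    then have "a = real_of_int (s1 x)" "b = real_of_int (s2 x)" "c = real_of_int (s3 x)"
      by (auto simp: s1_def s2_def s3_def sg_def abc)
    then show ?thesis using abc by (simp add: chi_def)
  qed
  define S1 S2 S3 where "S1 f \<longleftrightarrow> (\<forall>x\<in>U. qc (eval f x) = s1 x)" and "S2 f \<longleftrightarrow> (\<forall>x\<in>U. qc (eval f x) = s2 x)"
    and "S3 f \<longleftrightarrow> (\<forall>x\<in>U. qc (eval f x) = s3 x)" for f
  define D where "D f g h = (of_bool (Q divides\<^bsub>P\<^esub> f \<otimes>\<^bsub>P\<^esub> g \<otimes>\<^bsub>P\<^esub> h) :: real)" for f g h
  define k where "k n = real qq ^ n / real qq ^ degree Q * ((real qq - 1) / (2 * real qq)) ^ card U" for n
  have mc: "f \<in> carrier P" if "f \<in> Mon m" for f m using that monics_closed by auto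
  have lc: "f \<in> carrier P" if "f \<in> low Q" for f using that by (simp add: low_def)
  let ?A = "Mon n1 \<times> Mon n2 \<times> Mon n3"
  let ?C = "\<lambda>(f, g, h). Q divides\<^bsub>P\<^esub> f \<otimes>\<^bsub>P\<^esub> g \<otimes>\<^bsub>P\<^esub> h \<and> S1 f \<and> S2 g \<and> S3 h"
  have seteq: "{(f, g, h). f \<in> monics \<and> g \<in> monics \<and> h \<in> monics
        \<and> pdeg f = n1 \<and> pdeg g = n2 \<and> pdeg h = n3 \<and> E \<otimes>\<^bsub>P\<^esub> E divides\<^bsub>P\<^esub> f \<otimes>\<^bsub>P\<^esub> g \<otimes>\<^bsub>P\<^esub> h
        \<and> (\<forall>x\<in>U. (chi f x, chi g x, chi h x) = s x)} = {t \<in> ?A. ?C t}"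
    using sgn_iff by (auto simp: Q_def[symmetric] pdeg_def S1_def S2_def S3_def)
  have "real (card {t \<in> ?A. ?C t}) = (\<Sum>t\<in>?A. of_bool (?C t))"
    using finite_monics_degree by (simp add: Int_def)
  also have "\<dots> = (\<Sum>f\<in>Mon n1. \<Sum>g\<in>Mon n2. \<Sum>h\<in>Mon n3. of_bool (?C (f, g, h)))"
    by (simp only: sum.cartesian_product) (simp add: case_prod_unfold)
  also have "\<dots> = (\<Sum>f\<in>Mon n1. of_bool (S1 f) * (\<Sum>g\<in>Mon n2. of_bool (S2 g) * (\<Sum>h\<in>Mon n3. of_bool (S3 h) * D f g h)))"
    unfolding sum_distrib_left by (intro sum.cong refl) (auto simp: D_def)
  also have "\<dots> = (\<Sum>f\<in>Mon n1. of_bool (S1 f) * (\<Sum>g\<in>Mon n2. of_bool (S2 g) * (k n3 * (\<Sum>c\<in>low Q. D f g c))))"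
  proof (intro sum.cong refl arg_cong2[where f = "(*)"])
    fix f g assume fg: "f \<in> Mon n1" "g \<in> Mon n2"
    show "(\<Sum>h\<in>Mon n3. of_bool (S3 h) * D f g h) = k n3 * (\<Sum>c\<in>low Q. D f g c)"
      unfolding S3_def k_def
      by (rule sum_equidistributed[OF Q(1) U nzQ sgn(3)])
        (use n Q mc[OF fg(1)] mc[OF fg(2)] divides_prod_shift(3)[OF Q(3)] in \<open>auto simp: D_def pdeg_def\<close>)
  qed
  also have "\<dots> = (\<Sum>f\<in>Mon n1. of_bool (S1 f) * (k n2 * (\<Sum>b\<in>low Q. k n3 * (\<Sum>c\<in>low Q. D f b c))))"
  proof (intro sum.cong refl arg_cong2[where f = "(*)"])
    fix f assume f: "f \<in> Mon n1"
    show "(\<Sum>g\<in>Mon n2. of_bool (S2 g) * (k n3 * (\<Sum>c\<in>low Q. D f g c))) = k n2 * (\<Sum>b\<in>low Q. k n3 * (\<Sum>c\<in>low Q. D f b c))"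
      unfolding S2_def k_def[of n2]
    proof (rule sum_equidistributed[OF Q(1) U nzQ sgn(2)])
      fix u a assume ua: "u \<in> carrier P" "a \<in> carrier P"
      have "D f (Q \<otimes>\<^bsub>P\<^esub> u \<oplus>\<^bsub>P\<^esub> a) c = D f a c" if "c \<in> low Q" for c
        unfolding D_def using divides_prod_shift(2)[OF Q(3) ua mc[OF f] lc[OF that]] by simp
      then show "k n3 * (\<Sum>c\<in>low Q. D f (Q \<otimes>\<^bsub>P\<^esub> u \<oplus>\<^bsub>P\<^esub> a) c) = k n3 * (\<Sum>c\<in>low Q. D f a c)" by simp
    qed (use n Q in \<open>auto simp: pdeg_def\<close>)
  qed
  also have "\<dots> = k n1 * (\<Sum>a\<in>low Q. k n2 * (\<Sum>b\<in>low Q. k n3 * (\<Sum>c\<in>low Q. D a b c)))"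
    unfolding S1_def k_def[of n1]
  proof (rule sum_equidistributed[OF Q(1) U nzQ sgn(1)])
    fix u a assume ua: "u \<in> carrier P" "a \<in> carrier P"
    have "D (Q \<otimes>\<^bsub>P\<^esub> u \<oplus>\<^bsub>P\<^esub> a) b c = D a b c" if "b \<in> low Q" "c \<in> low Q" for b c
      unfolding D_def using divides_prod_shift(1)[OF Q(3) ua lc[OF that(1)] lc[OF that(2)]] by simp
    then show "k n2 * (\<Sum>b\<in>low Q. k n3 * (\<Sum>c\<in>low Q. D (Q \<otimes>\<^bsub>P\<^esub> u \<oplus>\<^bsub>P\<^esub> a) b c))
        = k n2 * (\<Sum>b\<in>low Q. k n3 * (\<Sum>c\<in>low Q. D a b c))" by simp
  qed (use n Q in \<open>auto simp: pdeg_def\<close>)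
  also have "\<dots> = k n1 * k n2 * k n3 * (\<Sum>a\<in>low Q. \<Sum>b\<in>low Q. \<Sum>c\<in>low Q. D a b c)"
    by (simp add: sum_distrib_left[symmetric])
  also have "(\<Sum>a\<in>low Q. \<Sum>b\<in>low Q. \<Sum>c\<in>low Q. D a b c) = rho E * real qq ^ (6 * degree E)"
    unfolding rho_def D_def Q_def[symmetric] using card_ge_3 by simp
  also have "k n1 * k n2 * k n3 * (rho E * real qq ^ (6 * degree E))
      = rho E * real qq ^ (n1 + n2 + n3) * ((real qq - 1) / (2 * real qq)) ^ (3 * card U)"
  proof -
    have "real qq ^ (6 * degree E) = real qq ^ degree Q * real qq ^ degree Q * real qq ^ degree Q"
      unfolding Q(2) power_add[symmetric] by simp
    moreover have "((real qq - 1) / (2 * real qq)) ^ (3 * card U) = ((real qq - 1) / (2 * real qq)) ^ card U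
        * ((real qq - 1) / (2 * real qq)) ^ card U * ((real qq - 1) / (2 * real qq)) ^ card U"
      by (simp only: mult.commute[of 3] power_mult power3_eq_cube)
    ultimately show ?thesis unfolding k_def power_add using card_ge_3 by simp
  qed
  finally show ?thesis unfolding seteq .
qed

sublocale M: monic_monoid monic_monoid_of qq pdeg "carrier R" linear chi rho
proof (intro monic_monoid.intro comm_monoid_cancel_monics monic_monoid_axioms.intro, unfold carrier_monic_monoid_of mult_monic_monoid_of one_monic_monoid_of)
  show "3 \<le> qq" by (rule card_ge_3)
  show "pdeg (a \<otimes>\<^bsub>P\<^esub> b) = pdeg a + pdeg b" if "a \<in> monics" "b \<in> monics" for a b
    using degree_monics_mult[OF that] by (simp only: pdeg_def)
  show "a = \<one>\<^bsub>P\<^esub>" if "a \<in> monics" "pdeg a = 0" for a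
    using monics_degree_0[of a] that by (simp only: pdeg_def)
  show "card {a \<in> monics. pdeg a = n} = qq ^ n" for n
    using card_monics_degree by (simp add: pdeg_def)
  show "p divides\<^bsub>monic_monoid_of\<^esub> a \<or> p divides\<^bsub>monic_monoid_of\<^esub> b"
    if p: "p \<in> monics" "p \<noteq> \<one>\<^bsub>P\<^esub>"
      "\<And>a b. a \<in> monics \<Longrightarrow> b \<in> monics \<Longrightarrow> p = a \<otimes>\<^bsub>P\<^esub> b \<Longrightarrow> a = \<one>\<^bsub>P\<^esub> \<or> b = \<one>\<^bsub>P\<^esub>"
      and ab: "a \<in> monics" "b \<in> monics" "p divides\<^bsub>monic_monoid_of\<^esub> (a \<otimes>\<^bsub>P\<^esub> b)" for p a b
  proof -
    have "p divides\<^bsub>P\<^esub> a \<otimes>\<^bsub>P\<^esub> b"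
      using ab(3) divides_monic_monoid_iff[OF p(1) monics_mult[OF ab(1,2)]] by blast
    from monic_irreducible_imp_prime[OF p monics_closed[OF ab(1)] monics_closed[OF ab(2)] this]
    show ?thesis using divides_monic_monoid_iff[OF p(1) ab(1)] divides_monic_monoid_iff[OF p(1) ab(2)] by blast
  qed
  show "finite (carrier R)" by (rule finite_carrier)
  show "linear x \<in> monics" if "x \<in> carrier R" for x using that by (rule linear_monics)
  show "pdeg (linear x) = 1" if "x \<in> carrier R" for x by (simp add: pdeg_def linear_def)
  show "chi (a \<otimes>\<^bsub>P\<^esub> b) x = chi a x * chi b x" if "a \<in> monics" "b \<in> monics" "x \<in> carrier R" for a b x
    using that monics_closed by (simp add: chi_def eval_mult qc_mult eval_closed)
  show "chi a x \<in> {-1, 0, 1}" if "a \<in> monics" "x \<in> carrier R" for a x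
    using qc_values[of "eval a x"] by (auto simp: chi_def)
  show "(chi a x = 0) = (linear x divides\<^bsub>monic_monoid_of\<^esub> a)" if "a \<in> monics" "x \<in> carrier R" for a x
    using that by (simp add: chi_def qc_eq_0_iff divides_monic_monoid_iff linear_monics linear_divides_iff)
  show "chi (linear x) y \<noteq> 0" if "x \<in> carrier R" "y \<in> carrier R" "x \<noteq> y" for x y
    using that by (simp add: chi_def qc_eq_0_iff eval_linear r_right_minus_eq)
  show "real (card {(f, g, h). f \<in> monics \<and> g \<in> monics \<and> h \<in> monics
        \<and> pdeg f = n1 \<and> pdeg g = n2 \<and> pdeg h = n3 \<and> E \<otimes>\<^bsub>P\<^esub> E divides\<^bsub>monic_monoid_of\<^esub> f \<otimes>\<^bsub>P\<^esub> g \<otimes>\<^bsub>P\<^esub> h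
        \<and> (\<forall>x\<in>U. (chi f x, chi g x, chi h x) = s x)})
      = rho E * real qq ^ (n1 + n2 + n3) * ((real qq - 1) / (2 * real qq)) ^ (3 * card U)"
    if E: "E \<in> monics" and U: "U \<subseteq> carrier R" "\<And>x. x \<in> U \<Longrightarrow> chi E x \<noteq> 0"
      "\<And>x. x \<in> U \<Longrightarrow> s x \<in> {1, -1} \<times> {1, -1} \<times> {1, -1}"
      and n: "2 * pdeg E + card U \<le> n1" "2 * pdeg E + card U \<le> n2" "2 * pdeg E + card U \<le> n3"
    for E U s n1 n2 n3
  proof -
    have "(f \<in> monics \<and> g \<in> monics \<and> h \<in> monics \<and> pdeg f = n1 \<and> pdeg g = n2 \<and> pdeg h = n3
        \<and> E \<otimes>\<^bsub>P\<^esub> E divides\<^bsub>monic_monoid_of\<^esub> f \<otimes>\<^bsub>P\<^esub> g \<otimes>\<^bsub>P\<^esub> h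
        \<and> (\<forall>x\<in>U. (chi f x, chi g x, chi h x) = s x)) \<longleftrightarrow>
      (f \<in> monics \<and> g \<in> monics \<and> h \<in> monics \<and> pdeg f = n1 \<and> pdeg g = n2 \<and> pdeg h = n3
        \<and> E \<otimes>\<^bsub>P\<^esub> E divides\<^bsub>P\<^esub> f \<otimes>\<^bsub>P\<^esub> g \<otimes>\<^bsub>P\<^esub> h
        \<and> (\<forall>x\<in>U. (chi f x, chi g x, chi h x) = s x))" for f g h
      using divides_monic_monoid_iff[OF monics_mult[OF E E], of "f \<otimes>\<^bsub>P\<^esub> g \<otimes>\<^bsub>P\<^esub> h"] monics_mult by metis
    then show ?thesis using equidistribution_triples[OF E U n] by (simp only:)
  qed
qed

end

section \<open>The family of curves\<close>

lemma prod_group_power: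
  fixes Y :: "'b \<Rightarrow> 'c::comm_monoid_mult"
  assumes "finite I" "finite B" "p ` I \<subseteq> B"
  shows "(\<Prod>i\<in>I. Y (p i)) = (\<Prod>z\<in>B. Y z ^ card {i \<in> I. p i = z})"
proof -
  have "(\<Prod>i\<in>I. Y (p i)) = (\<Prod>z\<in>B. \<Prod>i\<in>{i \<in> I. p i = z}. Y (p i))"
    using prod.group[OF assms, of "\<lambda>i. Y (p i)"] by simp
  also have "\<dots> = (\<Prod>z\<in>B. Y z ^ card {i \<in> I. p i = z})"
    by (intro prod.cong refl) simp
  finally show ?thesis .
qed

context finite_odd_field
begin

section \<open>Removing the leading coefficients\<close>

lemma P_m_lcancel_const:
  assumes "c \<in> nonzero" "u \<in> carrier P" shows "[inv c] \<otimes>\<^bsub>P\<^esub> ([c] \<otimes>\<^bsub>P\<^esub> u) = u" "[c] \<otimes>\<^bsub>P\<^esub> ([inv c] \<otimes>\<^bsub>P\<^esub> u) = u"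
proof -
  have i: "inv c \<in> nonzero" "inv c \<otimes> c = \<one>" "c \<otimes> inv c = \<one>" using nonzero_inv[OF assms(1)] by auto
  have "[inv c] \<otimes>\<^bsub>P\<^esub> ([c] \<otimes>\<^bsub>P\<^esub> u) = ([inv c] \<otimes>\<^bsub>P\<^esub> [c]) \<otimes>\<^bsub>P\<^esub> u"
    "[c] \<otimes>\<^bsub>P\<^esub> ([inv c] \<otimes>\<^bsub>P\<^esub> u) = ([c] \<otimes>\<^bsub>P\<^esub> [inv c]) \<otimes>\<^bsub>P\<^esub> u"
    using const_P[OF assms(1)] const_P[OF i(1)] assms(2) by (simp_all add: UP.m_assoc)
  then show "[inv c] \<otimes>\<^bsub>P\<^esub> ([c] \<otimes>\<^bsub>P\<^esub> u) = u" "[c] \<otimes>\<^bsub>P\<^esub> ([inv c] \<otimes>\<^bsub>P\<^esub> u) = u"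
    using UP.l_one[OF assms(2)] unfolding const_mult_const[OF i(1) assms(1)] const_mult_const[OF assms(1) i(1)] i
    by (simp_all only: univ_poly_one)
qed

lemma const_mult_divides_iff:
  assumes c: "c \<in> nonzero" and u: "u \<in> carrier P" "z \<in> carrier P"
  shows "[c] \<otimes>\<^bsub>P\<^esub> u divides\<^bsub>P\<^esub> z \<longleftrightarrow> u divides\<^bsub>P\<^esub> z" "u divides\<^bsub>P\<^esub> [c] \<otimes>\<^bsub>P\<^esub> z \<longleftrightarrow> u divides\<^bsub>P\<^esub> z"
proof -
  have i: "inv c \<in> nonzero" using nonzero_inv[OF c] by auto
  note k = const_P[OF c] const_P[OF i]
  have 1: "a divides\<^bsub>P\<^esub> b" if dv: "[d] \<otimes>\<^bsub>P\<^esub> a divides\<^bsub>P\<^esub> b" "[d] \<in> carrier P" "a \<in> carrier P" for a b d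
  proof -
    obtain w where "w \<in> carrier P" "b = [d] \<otimes>\<^bsub>P\<^esub> a \<otimes>\<^bsub>P\<^esub> w" using dv(1) unfolding factor_def by blast
    then have "b = a \<otimes>\<^bsub>P\<^esub> ([d] \<otimes>\<^bsub>P\<^esub> w)" "[d] \<otimes>\<^bsub>P\<^esub> w \<in> carrier P" using dv(2,3) by (simp_all add: UP.m_ac)
    then show ?thesis unfolding factor_def by blast
  qed
  have 2: "a divides\<^bsub>P\<^esub> [d] \<otimes>\<^bsub>P\<^esub> b" if dv: "a divides\<^bsub>P\<^esub> b" "[d] \<in> carrier P" "a \<in> carrier P" for a b d
  proof -
    obtain w where "w \<in> carrier P" "b = a \<otimes>\<^bsub>P\<^esub> w" using dv(1) unfolding factor_def by blast
    then have "[d] \<otimes>\<^bsub>P\<^esub> b = a \<otimes>\<^bsub>P\<^esub> ([d] \<otimes>\<^bsub>P\<^esub> w)" "[d] \<otimes>\<^bsub>P\<^esub> w \<in> carrier P" using dv(2,3) by (simp_all add: UP.m_ac)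
    then show ?thesis unfolding factor_def by blast
  qed
  have "[c] \<otimes>\<^bsub>P\<^esub> u divides\<^bsub>P\<^esub> z" if "u divides\<^bsub>P\<^esub> z"
    using 1[of "inv c" "[c] \<otimes>\<^bsub>P\<^esub> u" z] that P_m_lcancel_const[OF c u(1)] k u by simp
  then show "[c] \<otimes>\<^bsub>P\<^esub> u divides\<^bsub>P\<^esub> z \<longleftrightarrow> u divides\<^bsub>P\<^esub> z" using 1[of c u z] k u by blast
  have "u divides\<^bsub>P\<^esub> z" if "u divides\<^bsub>P\<^esub> [c] \<otimes>\<^bsub>P\<^esub> z"
    using 2[of u "[c] \<otimes>\<^bsub>P\<^esub> z" "inv c"] that P_m_lcancel_const[OF c u(2)] k u by simp
  then show "u divides\<^bsub>P\<^esub> [c] \<otimes>\<^bsub>P\<^esub> z \<longleftrightarrow> u divides\<^bsub>P\<^esub> z" using 2[of u z c] k u by blast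
qed

lemma zero_not_divides: "\<lbrakk>z \<in> carrier P; z \<noteq> []\<rbrakk> \<Longrightarrow> \<not> [] divides\<^bsub>P\<^esub> z"
  using zero_pdivides[of z] by (simp add: pdivides_def)

lemma sqfree_iff: "g \<in> monics \<Longrightarrow> M.sqfree g \<longleftrightarrow> (\<forall>u\<in>monics. u \<otimes>\<^bsub>P\<^esub> u divides\<^bsub>P\<^esub> g \<longrightarrow> u = \<one>\<^bsub>P\<^esub>)"
  unfolding M.sqfree_def carrier_monic_monoid_of mult_monic_monoid_of one_monic_monoid_of
  using divides_monic_monoid_iff[OF monics_mult] by blast

text \<open>Leading coefficients are units, so square divisors may be taken monic; the zero
  polynomial divides nothing nonzero and causes no exception. The same reasoning gives
  \<open>coprime_in_iff\<close>.\<close>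

lemma squarefree_in_iff:
  assumes c: "c \<in> nonzero" and g: "g \<in> monics"
  shows "squarefree_in P ([c] \<otimes>\<^bsub>P\<^esub> g) \<longleftrightarrow> M.sqfree g"
proof -
  have gc: "g \<in> carrier P" "g \<noteq> []" using g monics_closed monics_ne by auto
  have pow2: "u [^]\<^bsub>P\<^esub> (2::nat) = u \<otimes>\<^bsub>P\<^esub> u" if "u \<in> carrier P" for u
    using that by (simp add: numeral_2_eq_2)
  show ?thesis unfolding sqfree_iff[OF g]
  proof
    assume sq: "squarefree_in P ([c] \<otimes>\<^bsub>P\<^esub> g)"
    show "\<forall>u\<in>monics. u \<otimes>\<^bsub>P\<^esub> u divides\<^bsub>P\<^esub> g \<longrightarrow> u = \<one>\<^bsub>P\<^esub>"
    proof (intro ballI impI)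
      fix u assume u: "u \<in> monics" "u \<otimes>\<^bsub>P\<^esub> u divides\<^bsub>P\<^esub> g"
      have uc: "u \<in> carrier P" using u monics_closed by blast
      have "u [^]\<^bsub>P\<^esub> (2::nat) divides\<^bsub>P\<^esub> [c] \<otimes>\<^bsub>P\<^esub> g"
        unfolding pow2[OF uc] const_mult_divides_iff(2)[OF c UP.m_closed[OF uc uc] gc(1)] by (rule u(2))
      then have "u \<in> Units P" using sq uc unfolding squarefree_in_def by blast
      then show "u = \<one>\<^bsub>P\<^esub>" using monics_Units[OF u(1)] by blast
    qed
  next
    assume sq: "\<forall>u\<in>monics. u \<otimes>\<^bsub>P\<^esub> u divides\<^bsub>P\<^esub> g \<longrightarrow> u = \<one>\<^bsub>P\<^esub>"
    show "squarefree_in P ([c] \<otimes>\<^bsub>P\<^esub> g)" unfolding squarefree_in_def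
    proof (intro ballI impI)
      fix u assume u: "u \<in> carrier P" "u [^]\<^bsub>P\<^esub> (2::nat) divides\<^bsub>P\<^esub> [c] \<otimes>\<^bsub>P\<^esub> g"
      then have dv: "u \<otimes>\<^bsub>P\<^esub> u divides\<^bsub>P\<^esub> g"
        using pow2[OF u(1)] const_mult_divides_iff(2)[OF c UP.m_closed[OF u(1) u(1)] gc(1)] by simp
      have ne: "u \<noteq> []"
        using dv zero_not_divides[OF gc] UP.l_null[OF UP.zero_closed] by (auto simp: univ_poly_zero)
      obtain v where v: "v \<in> monics" "u = [lead_coeff u] \<otimes>\<^bsub>P\<^esub> v" "degree v = degree u"
        using monic_decomp[OF u(1) ne] .
      have vc: "v \<in> carrier P" using v monics_closed by blast
      note lu = lead_coeff_nonzero[OF u(1) ne]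
      have "u \<otimes>\<^bsub>P\<^esub> u = [lead_coeff u] \<otimes>\<^bsub>P\<^esub> ([lead_coeff u] \<otimes>\<^bsub>P\<^esub> (v \<otimes>\<^bsub>P\<^esub> v))"
        by (subst (1 2) v(2)) (use const_P[OF lu] vc in \<open>simp add: UP.m_ac\<close>)
      then have "v \<otimes>\<^bsub>P\<^esub> v divides\<^bsub>P\<^esub> g"
        using dv const_mult_divides_iff(1)[OF lu] const_P[OF lu] vc gc by simp
      then have "v = \<one>\<^bsub>P\<^esub>" using sq v by blast
      then have "degree u = 0" using v(3) by (simp add: univ_poly_one)
      then show "u \<in> Units P" using Units_P u ne by blast
    qed
  qed
qed

lemma coprime_in_iff:
  assumes c: "c \<in> nonzero" "d \<in> nonzero" and g: "g \<in> monics" "h \<in> monics"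
  shows "coprime_in P ([c] \<otimes>\<^bsub>P\<^esub> g) ([d] \<otimes>\<^bsub>P\<^esub> h) \<longleftrightarrow>
    (\<forall>u\<in>monics. u divides\<^bsub>P\<^esub> g \<longrightarrow> u divides\<^bsub>P\<^esub> h \<longrightarrow> u = \<one>\<^bsub>P\<^esub>)"
proof -
  have gc: "g \<in> carrier P" "g \<noteq> []" "h \<in> carrier P" using g monics_closed monics_ne by auto
  note dv = const_mult_divides_iff(2)[OF c(1) _ gc(1)] const_mult_divides_iff(2)[OF c(2) _ gc(3)]
  show ?thesis
  proof
    assume co: "coprime_in P ([c] \<otimes>\<^bsub>P\<^esub> g) ([d] \<otimes>\<^bsub>P\<^esub> h)"
    show "\<forall>u\<in>monics. u divides\<^bsub>P\<^esub> g \<longrightarrow> u divides\<^bsub>P\<^esub> h \<longrightarrow> u = \<one>\<^bsub>P\<^esub>"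
    proof (intro ballI impI)
      fix u assume u: "u \<in> monics" "u divides\<^bsub>P\<^esub> g" "u divides\<^bsub>P\<^esub> h"
      have uc: "u \<in> carrier P" using u monics_closed by blast
      then have "u \<in> Units P" using co u dv[OF uc] unfolding coprime_in_def by blast
      then show "u = \<one>\<^bsub>P\<^esub>" using monics_Units[OF u(1)] by blast
    qed
  next
    assume co: "\<forall>u\<in>monics. u divides\<^bsub>P\<^esub> g \<longrightarrow> u divides\<^bsub>P\<^esub> h \<longrightarrow> u = \<one>\<^bsub>P\<^esub>"
    show "coprime_in P ([c] \<otimes>\<^bsub>P\<^esub> g) ([d] \<otimes>\<^bsub>P\<^esub> h)" unfolding coprime_in_def
    proof (intro ballI impI)
      fix u assume u: "u \<in> carrier P" "u divides\<^bsub>P\<^esub> [c] \<otimes>\<^bsub>P\<^esub> g" "u divides\<^bsub>P\<^esub> [d] \<otimes>\<^bsub>P\<^esub> h"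
      have d: "u divides\<^bsub>P\<^esub> g" "u divides\<^bsub>P\<^esub> h" using u dv[OF u(1)] by blast+
      have ne: "u \<noteq> []" using d zero_not_divides[OF gc(1,2)] by auto
      obtain v where v: "v \<in> monics" "u = [lead_coeff u] \<otimes>\<^bsub>P\<^esub> v" "degree v = degree u"
        using monic_decomp[OF u(1) ne] .
      have vc: "v \<in> carrier P" using v monics_closed by blast
      note lu = lead_coeff_nonzero[OF u(1) ne]
      have "v divides\<^bsub>P\<^esub> g" "v divides\<^bsub>P\<^esub> h"
        using d const_mult_divides_iff(1)[OF lu vc gc(1)] const_mult_divides_iff(1)[OF lu vc gc(3)] v(2) by simp_all
      then have "v = \<one>\<^bsub>P\<^esub>" using co v by blast
      then have "degree u = 0" using v(3) by (simp add: univ_poly_one)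
      then show "u \<in> Units P" using Units_P u ne by blast
    qed
  qed
qed

definition twist :: "'a \<times> 'a \<Rightarrow> 'a list \<times> 'a list \<times> 'a list \<Rightarrow> 'a list \<times> 'a list \<times> 'a list" where
  "twist = (\<lambda>(\<alpha>, \<beta>) (f, g, h). (f, [\<alpha>] \<otimes>\<^bsub>P\<^esub> g, [\<beta>] \<otimes>\<^bsub>P\<^esub> h))"

lemma const_one_mult: "f \<in> carrier P \<Longrightarrow> [\<one>] \<otimes>\<^bsub>P\<^esub> f = f"
  using UP.l_one[of f] by (simp only: univ_poly_one)

lemma twist_mem_iff:
  assumes c: "\<alpha> \<in> nonzero" "\<beta> \<in> nonzero" and m: "f \<in> monics" "g \<in> monics" "h \<in> monics"
  shows "twist (\<alpha>, \<beta>) (f, g, h) \<in> coprime_triples R n n1 n2 \<longleftrightarrow> (f, g, h) \<in> M.sqtri n n1 n2"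
proof -
  have mc: "f \<in> carrier P" "g \<in> carrier P" "h \<in> carrier P" "f \<noteq> []" "g \<noteq> []" "h \<noteq> []"
    using m monics_closed monics_ne by auto
  note cm1 = const_mult[OF c(1) mc(2,5)] and cm2 = const_mult[OF c(2) mc(3,6)]
  have sqf: "squarefree_in P f \<longleftrightarrow> M.sqfree f"
    using squarefree_in_iff[OF one_nonzero m(1)] const_one_mult[OF mc(1)] by simp
  have co: "coprime_in P f ([\<alpha>] \<otimes>\<^bsub>P\<^esub> g) \<longleftrightarrow> (\<forall>u\<in>monics. u divides\<^bsub>P\<^esub> f \<longrightarrow> u divides\<^bsub>P\<^esub> g \<longrightarrow> u = \<one>\<^bsub>P\<^esub>)"
    "coprime_in P f ([\<beta>] \<otimes>\<^bsub>P\<^esub> h) \<longleftrightarrow> (\<forall>u\<in>monics. u divides\<^bsub>P\<^esub> f \<longrightarrow> u divides\<^bsub>P\<^esub> h \<longrightarrow> u = \<one>\<^bsub>P\<^esub>)"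
    using coprime_in_iff[OF one_nonzero c(1) m(1,2)] coprime_in_iff[OF one_nonzero c(2) m(1,3)]
      const_one_mult[OF mc(1)] by simp_all
  have lead: "lead_coeff f = \<one>" using m by (simp add: monics_def)
  have dv: "u divides\<^bsub>monic_monoid_of\<^esub> z \<longleftrightarrow> u divides\<^bsub>P\<^esub> z" if "u \<in> monics" "z \<in> monics" for u z
    using divides_monic_monoid_iff that by blast
  have sq: "M.sqfree (f \<otimes>\<^bsub>P\<^esub> g \<otimes>\<^bsub>P\<^esub> h) \<longleftrightarrow> M.sqfree f \<and> M.sqfree g \<and> M.sqfree h
    \<and> (\<forall>u\<in>monics. u divides\<^bsub>P\<^esub> f \<longrightarrow> u divides\<^bsub>P\<^esub> g \<longrightarrow> u = \<one>\<^bsub>P\<^esub>)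
    \<and> (\<forall>u\<in>monics. u divides\<^bsub>P\<^esub> f \<longrightarrow> u divides\<^bsub>P\<^esub> h \<longrightarrow> u = \<one>\<^bsub>P\<^esub>)
    \<and> (\<forall>u\<in>monics. u divides\<^bsub>P\<^esub> g \<longrightarrow> u divides\<^bsub>P\<^esub> h \<longrightarrow> u = \<one>\<^bsub>P\<^esub>)"
    using M.sqfree_prod3_iff[unfolded carrier_monic_monoid_of mult_monic_monoid_of one_monic_monoid_of, OF m]
      dv[OF _ m(1)] dv[OF _ m(2)] dv[OF _ m(3)] by simp
  have "twist (\<alpha>, \<beta>) (f, g, h) \<in> coprime_triples R n n1 n2 \<longleftrightarrow>
    int (degree f) = n \<and> int (degree g) = n1 \<and> int (degree h) = n2
    \<and> M.sqfree f \<and> M.sqfree g \<and> M.sqfree h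
    \<and> (\<forall>u\<in>monics. u divides\<^bsub>P\<^esub> f \<longrightarrow> u divides\<^bsub>P\<^esub> g \<longrightarrow> u = \<one>\<^bsub>P\<^esub>)
    \<and> (\<forall>u\<in>monics. u divides\<^bsub>P\<^esub> f \<longrightarrow> u divides\<^bsub>P\<^esub> h \<longrightarrow> u = \<one>\<^bsub>P\<^esub>)
    \<and> (\<forall>u\<in>monics. u divides\<^bsub>P\<^esub> g \<longrightarrow> u divides\<^bsub>P\<^esub> h \<longrightarrow> u = \<one>\<^bsub>P\<^esub>)"
    unfolding coprime_triples_def monic_sqfree_polys_def sqfree_polys_def twist_def prod.case mem_Collect_eq
      co coprime_in_iff[OF c m(2,3)] squarefree_in_iff[OF c(1) m(2)] squarefree_in_iff[OF c(2) m(3)] sqf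
      cm1(3) cm2(3) lead univ_poly_zero
    using mc cm1(1,2) cm2(1,2) by blast
  also have "\<dots> \<longleftrightarrow> (f, g, h) \<in> M.sqtri n n1 n2"
    unfolding M.sqtri_def M.tri_def M.prod3_def prod.case mult_monic_monoid_of carrier_monic_monoid_of mem_Collect_eq
      mem_Sigma_iff sq pdeg_def
    using m by blast
  finally show ?thesis .
qed

lemma bij_betw_twist:
  "bij_betw (\<lambda>(c, t). twist c t) ((nonzero \<times> nonzero) \<times> M.sqtri n n1 n2) (coprime_triples R n n1 n2)"
proof (rule bij_betw_imageI)
  have mon: "f \<in> monics" "g \<in> monics" "h \<in> monics" if "(f, g, h) \<in> M.sqtri n n1 n2" for f g h
    using that by (auto simp: M.sqtri_def M.tri_def carrier_monic_monoid_of)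
  show "inj_on (\<lambda>(c, t). twist c t) ((nonzero \<times> nonzero) \<times> M.sqtri n n1 n2)"
  proof (rule inj_onI)
    fix x y assume x: "x \<in> (nonzero \<times> nonzero) \<times> M.sqtri n n1 n2"
      and y: "y \<in> (nonzero \<times> nonzero) \<times> M.sqtri n n1 n2"
      and xy: "(\<lambda>(c, t). twist c t) x = (\<lambda>(c, t). twist c t) y"
    obtain a b f g h a' b' f' g' h' where X: "x = ((a, b), (f, g, h))" and Y: "y = ((a', b'), (f', g', h'))"
      by (metis prod.exhaust)
    have ab: "a \<in> nonzero" "b \<in> nonzero" "a' \<in> nonzero" "b' \<in> nonzero"
      and t: "(f, g, h) \<in> M.sqtri n n1 n2" "(f', g', h') \<in> M.sqtri n n1 n2"
      and eq: "twist (a, b) (f, g, h) = twist (a', b') (f', g', h')"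
      using x y xy unfolding X Y by simp_all
    note m = mon[OF t(1)] mon[OF t(2)]
    have key: "c = c' \<and> u = u'" if "c \<in> nonzero" "c' \<in> nonzero" "u \<in> monics" "u' \<in> monics"
      "[c] \<otimes>\<^bsub>P\<^esub> u = [c'] \<otimes>\<^bsub>P\<^esub> u'" for c c' u u'
    proof -
      have u: "u \<in> carrier P" "u \<noteq> []" "lead_coeff u = \<one>" "u' \<in> carrier P" "u' \<noteq> []" "lead_coeff u' = \<one>"
        using that by (auto simp: monics_def)
      have cc: "c = c'" using const_mult(4)[OF that(1) u(1,2)] const_mult(4)[OF that(2) u(4,5)] that u
        by (simp add: nonzero_def)
      moreover have "u = u'"
      proof -
        have "u = [inv c] \<otimes>\<^bsub>P\<^esub> ([c] \<otimes>\<^bsub>P\<^esub> u)" by (rule P_m_lcancel_const(1)[OF that(1) u(1), symmetric])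
        also have "\<dots> = [inv c] \<otimes>\<^bsub>P\<^esub> ([c] \<otimes>\<^bsub>P\<^esub> u')" using that(5) unfolding cc by (rule arg_cong)
        also have "\<dots> = u'" by (rule P_m_lcancel_const(1)[OF that(1) u(4)])
        finally show ?thesis .
      qed
      ultimately show ?thesis by blast
    qed
    show "x = y"
      unfolding X Y using eq key[OF ab(1,3) m(2,5)] key[OF ab(2,4) m(3,6)] by (simp add: twist_def)
  qed
  show "(\<lambda>(c, t). twist c t) ` ((nonzero \<times> nonzero) \<times> M.sqtri n n1 n2) = coprime_triples R n n1 n2"
  proof (intro equalityI subsetI)
    fix T assume "T \<in> (\<lambda>(c, t). twist c t) ` ((nonzero \<times> nonzero) \<times> M.sqtri n n1 n2)"
    then obtain a b f g h where "a \<in> nonzero" "b \<in> nonzero" "(f, g, h) \<in> M.sqtri n n1 n2" "T = twist (a, b) (f, g, h)"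
      by auto
    then show "T \<in> coprime_triples R n n1 n2" using twist_mem_iff[of a b f g h n n1 n2] mon by blast
  next
    fix T assume T: "T \<in> coprime_triples R n n1 n2"
    obtain f f1 f2 where fT: "T = (f, f1, f2)" by (cases T)
    have c: "f \<in> monics" "f1 \<in> carrier P" "f1 \<noteq> []" "f2 \<in> carrier P" "f2 \<noteq> []"
      using T unfolding fT by (auto simp: coprime_triples_def monic_sqfree_polys_def sqfree_polys_def monics_def univ_poly_zero)
    obtain g where g: "g \<in> monics" "f1 = [lead_coeff f1] \<otimes>\<^bsub>P\<^esub> g" using monic_decomp[OF c(2,3)] by blast
    obtain h where h: "h \<in> monics" "f2 = [lead_coeff f2] \<otimes>\<^bsub>P\<^esub> h" using monic_decomp[OF c(4,5)] by blast
    note l1 = lead_coeff_nonzero[OF c(2,3)] and l2 = lead_coeff_nonzero[OF c(4,5)]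
    have eq: "T = twist (lead_coeff f1, lead_coeff f2) (f, g, h)"
      unfolding fT twist_def prod.case g(2)[symmetric] h(2)[symmetric] ..
    then have "(f, g, h) \<in> M.sqtri n n1 n2" using twist_mem_iff[OF l1 l2 c(1) g(1) h(1)] T by simp
    then show "T \<in> (\<lambda>(c, t). twist c t) ` ((nonzero \<times> nonzero) \<times> M.sqtri n n1 n2)"
      using eq l1 l2 by (intro image_eqI[of _ _ "((lead_coeff f1, lead_coeff f2), (f, g, h))"]) auto
  qed
qed

lemma sum_coprime_triples:
  fixes F :: "_ \<Rightarrow> real"
  shows "(\<Sum>T\<in>coprime_triples R n n1 n2. F T)
    = (\<Sum>\<alpha>\<in>nonzero. \<Sum>\<beta>\<in>nonzero. \<Sum>t\<in>M.sqtri n n1 n2. F (twist (\<alpha>, \<beta>) t))"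
proof -
  have "(\<Sum>T\<in>coprime_triples R n n1 n2. F T)
      = (\<Sum>x\<in>(nonzero \<times> nonzero) \<times> M.sqtri n n1 n2. F ((\<lambda>(c, t). twist c t) x))"
    by (rule sum.reindex_bij_betw[OF bij_betw_twist, symmetric])
  also have "\<dots> = (\<Sum>c\<in>nonzero \<times> nonzero. \<Sum>t\<in>M.sqtri n n1 n2. F (twist c t))"
    unfolding sum.cartesian_product by (intro sum.cong refl) (simp add: case_prod_unfold)
  also have "\<dots> = (\<Sum>(\<alpha>, \<beta>)\<in>nonzero \<times> nonzero. \<Sum>t\<in>M.sqtri n n1 n2. F (twist (\<alpha>, \<beta>) t))"
    by (intro sum.cong refl) (simp add: case_prod_unfold)
  also have "\<dots> = (\<Sum>\<alpha>\<in>nonzero. \<Sum>\<beta>\<in>nonzero. \<Sum>t\<in>M.sqtri n n1 n2. F (twist (\<alpha>, \<beta>) t))"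
    by (rule sum.cartesian_product[symmetric])
  finally show ?thesis .
qed

text \<open>Squares and nonsquares are equally many among the nonzero elements, so summing over a
  leading coefficient amounts to averaging over a sign.\<close>

lemma sum_qc:
  fixes H :: "real \<Rightarrow> real"
  shows "(\<Sum>\<alpha>\<in>nonzero. H (real_of_int (qc \<alpha>))) = (real qq - 1) / 2 * (H 1 + H (-1))"
proof -
  let ?A = "\<lambda>s. {a \<in> carrier R. qc a = s}"
  have nz: "nonzero = ?A 1 \<union> ?A (-1)" by (auto simp: nonzero_def qc_eq split: if_splits)
  have card: "real (card (?A s)) = (real qq - 1) / 2" if "s \<in> {1, -1}" for s
  proof -
    have "real (2 * card (?A s)) = real (qq - 1)" using card_qc[OF that] by simp
    then show ?thesis using card_ge_3 by (simp add: of_nat_diff)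
  qed
  have c1: "real (card (?A 1)) = (real qq - 1) / 2" and c2: "real (card (?A (-1))) = (real qq - 1) / 2"
    by (rule card; simp)+
  have "(\<Sum>\<alpha>\<in>nonzero. H (real_of_int (qc \<alpha>))) = (\<Sum>\<alpha>\<in>?A 1. H (real_of_int (qc \<alpha>))) + (\<Sum>\<alpha>\<in>?A (-1). H (real_of_int (qc \<alpha>)))"
    unfolding nz by (rule sum.union_disjoint) (use finite_carrier in auto)
  also have "(\<Sum>\<alpha>\<in>?A 1. H (real_of_int (qc \<alpha>))) = real (card (?A 1)) * H 1" by simp
  also have "(\<Sum>\<alpha>\<in>?A (-1). H (real_of_int (qc \<alpha>))) = real (card (?A (-1))) * H (-1)" by simp
  finally show ?thesis unfolding c1 c2 by (simp only: distrib_left)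
qed

section \<open>Contributions of the points of the projective line\<close>

text \<open>The summand of \<open>S_hat\<close> in the scaling of \<open>yval\<close>. It refers to
  the products of the polynomials, so at infinity it depends on the parities of the degrees; its
  translation into \<open>yval\<close> is a lemma of its own at each kind of point.\<close>

definition ypt :: "'a list \<times> 'a list \<times> 'a list \<Rightarrow> 'a option \<Rightarrow> real" where
  "ypt = (\<lambda>(f, f1, f2) x. real_of_int (quadratic_char_at R (f \<otimes>\<^bsub>P\<^esub> f1) x
     + quadratic_char_at R (f \<otimes>\<^bsub>P\<^esub> f2) x + quadratic_char_at R (f1 \<otimes>\<^bsub>P\<^esub> f2) x) / 3)"

abbreviation sgnr where "sgnr \<alpha> \<equiv> real_of_int (qc \<alpha>)"

lemma S_hat_eq_sum_ypt: "real_of_int (S_hat R f f1 f2) = 3 * (\<Sum>x\<in>proj_line R. ypt (f, f1, f2) x)"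
  unfolding S_hat_def ypt_def by (simp add: sum_divide_distrib[symmetric])

lemma eval_const: "\<lbrakk>c \<in> nonzero; x \<in> carrier R\<rbrakk> \<Longrightarrow> eval [c] x = c"
  by (simp add: nonzero_def)

lemma ypt_twist_Some:
  assumes c: "\<alpha> \<in> nonzero" "\<beta> \<in> nonzero" and m: "f \<in> monics" "g \<in> monics" "h \<in> monics" and x: "x \<in> carrier R"
  shows "ypt (twist (\<alpha>, \<beta>) (f, g, h)) (Some x) = M.yval (chi f x) (sgnr \<alpha> * chi g x) (sgnr \<beta> * chi h x)"
proof -
  have mc: "f \<in> carrier P" "g \<in> carrier P" "h \<in> carrier P" using m monics_closed by auto
  have cc: "[\<alpha>] \<in> carrier P" "[\<beta>] \<in> carrier P" "\<alpha> \<in> carrier R" "\<beta> \<in> carrier R"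
    using c const_P by (auto simp: nonzero_def)
  have ev: "qc (eval (u \<otimes>\<^bsub>P\<^esub> v) x) = qc (eval u x) * qc (eval v x)" if "u \<in> carrier P" "v \<in> carrier P" for u v
    using that x by (simp add: eval_mult qc_mult eval_closed)
  show ?thesis
    unfolding ypt_def twist_def prod.case quadratic_char_at_def option.case M.yval_def chi_def
    using mc cc by (simp add: ev eval_const[OF c(1) x] eval_const[OF c(2) x] algebra_simps)
qed

lemma ypt_twist_None:
  assumes c: "\<alpha> \<in> nonzero" "\<beta> \<in> nonzero" and m: "f \<in> monics" "g \<in> monics" "h \<in> monics"
  shows "ypt (twist (\<alpha>, \<beta>) (f, g, h)) None =
    ((if odd (degree f + degree g) then 0 else sgnr \<alpha>) + (if odd (degree f + degree h) then 0 else sgnr \<beta>)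
     + (if odd (degree g + degree h) then 0 else sgnr \<alpha> * sgnr \<beta>)) / 3"
proof -
  have mc: "f \<in> carrier P" "g \<in> carrier P" "h \<in> carrier P" "f \<noteq> []" "g \<noteq> []" "h \<noteq> []"
    "lead_coeff f = \<one>" "lead_coeff g = \<one>" "lead_coeff h = \<one>"
    using m by (auto simp: monics_def)
  have cc: "\<alpha> \<in> carrier R" "\<beta> \<in> carrier R" using c by (auto simp: nonzero_def)
  note g = const_mult[OF c(1) mc(2,5)] and h = const_mult[OF c(2) mc(3,6)]
  note fg = P_mult_ne[OF mc(1) g(1) mc(4) g(2)] and fh = P_mult_ne[OF mc(1) h(1) mc(4) h(2)]
    and gh = P_mult_ne[OF g(1) h(1) g(2) h(2)]
  define b1 b2 b3 where "b1 = odd (degree f + degree g)" and "b2 = odd (degree f + degree h)"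
    and "b3 = odd (degree g + degree h)"
  show ?thesis
    unfolding ypt_def twist_def prod.case quadratic_char_at_def option.case fg(2,3) fh(2,3) gh(2,3) g(3,4) h(3,4)
      mc(7-9) b1_def[symmetric] b2_def[symmetric] b3_def[symmetric]
    using cc by (simp add: qc_mult)
qed

section \<open>Tuples of points\<close>

text \<open>A product over a tuple \<open>p\<close> of points is determined by the affine points it
  meets and the multiplicities \<open>mult_at\<close>. Infinity is kept apart, since it enters
  through the degrees and leading coefficients.\<close>

definition pts :: "nat \<Rightarrow> (nat \<Rightarrow> 'a option) \<Rightarrow> 'a set" where
  "pts k p = {x \<in> carrier R. \<exists>i<k. p i = Some x}"

definition mult_at :: "nat \<Rightarrow> (nat \<Rightarrow> 'a option) \<Rightarrow> 'a option \<Rightarrow> nat" where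
  "mult_at k p z = card {i \<in> {..<k}. p i = z}"

lemma pts_subset: "pts k p \<subseteq> carrier R"
  by (auto simp: pts_def)

lemma finite_pts: "finite (pts k p)"
  using finite_subset[OF pts_subset finite_carrier] .

lemma card_pts_le: "card (pts k p) \<le> k"
proof -
  have "Some ` pts k p \<subseteq> p ` {..<k}" by (force simp: pts_def)
  then have "card (Some ` pts k p) \<le> card {..<k}" by (intro surj_card_le) auto
  then show ?thesis by (simp add: card_image)
qed

lemma prod_points:
  fixes Y :: "'a option \<Rightarrow> real"
  assumes "\<And>i. i < k \<Longrightarrow> p i \<in> proj_line R"
  shows "(\<Prod>i<k. Y (p i)) = Y None ^ mult_at k p None * (\<Prod>x\<in>pts k p. Y (Some x) ^ mult_at k p (Some x))"
proof -
  have "(\<Prod>i<k. Y (p i)) = (\<Prod>z\<in>insert None (Some ` pts k p). Y z ^ card {i \<in> {..<k}. p i = z})"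
    by (rule prod_group_power) (use assms finite_pts in \<open>fastforce simp: pts_def proj_line_def\<close>)+
  also have "\<dots> = Y None ^ mult_at k p None * (\<Prod>z\<in>Some ` pts k p. Y z ^ mult_at k p z)"
    using finite_pts by (simp add: mult_at_def)
  also have "(\<Prod>z\<in>Some ` pts k p. Y z ^ mult_at k p z) = (\<Prod>x\<in>pts k p. Y (Some x) ^ mult_at k p (Some x))"
    by (simp add: prod.reindex)
  finally show ?thesis .
qed

text \<open>The four parts of the family differ in their value at infinity, which is passed as the
  function \<open>w\<close> of the two signs; one proof covers them all.\<close>

lemma sum_coprime_triples_ypt:
  assumes p: "\<And>i. i < k \<Longrightarrow> p i \<in> proj_line R"
    and w: "\<And>\<alpha> \<beta> t. \<lbrakk>\<alpha> \<in> nonzero; \<beta> \<in> nonzero; t \<in> M.sqtri a b c\<rbrakk> \<Longrightarrow> ypt (twist (\<alpha>, \<beta>) t) None = w (sgnr \<alpha>) (sgnr \<beta>)"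
  shows "(\<Sum>T\<in>coprime_triples R a b c. \<Prod>i<k. ypt T (p i))
    = (\<Sum>\<alpha>\<in>nonzero. \<Sum>\<beta>\<in>nonzero. w (sgnr \<alpha>) (sgnr \<beta>) ^ mult_at k p None *
        M.wsum {} (pts k p) a b c (M.ywt (\<lambda>x. mult_at k p (Some x)) (sgnr \<alpha>) (sgnr \<beta>)))"
  unfolding sum_coprime_triples
proof (intro sum.cong refl)
  fix \<alpha> \<beta> assume ab: "\<alpha> \<in> nonzero" "\<beta> \<in> nonzero"
  have "(\<Sum>t\<in>M.sqtri a b c. \<Prod>i<k. ypt (twist (\<alpha>, \<beta>) t) (p i))
      = (\<Sum>t\<in>M.sqtri a b c. w (sgnr \<alpha>) (sgnr \<beta>) ^ mult_at k p None *
          M.wt (pts k p) (M.ywt (\<lambda>x. mult_at k p (Some x)) (sgnr \<alpha>) (sgnr \<beta>)) t)"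
  proof (intro sum.cong refl)
    fix t assume t: "t \<in> M.sqtri a b c"
    obtain f g h where fgh: "t = (f, g, h)" by (cases t)
    have m: "f \<in> monics" "g \<in> monics" "h \<in> monics"
      using t fgh by (auto simp: M.sqtri_def M.tri_def carrier_monic_monoid_of)
    have "(\<Prod>x\<in>pts k p. ypt (twist (\<alpha>, \<beta>) t) (Some x) ^ mult_at k p (Some x))
        = M.wt (pts k p) (M.ywt (\<lambda>x. mult_at k p (Some x)) (sgnr \<alpha>) (sgnr \<beta>)) t"
      unfolding fgh M.wt_def M.ywt_def prod.case
    proof (intro prod.cong refl)
      fix x assume "x \<in> pts k p"
      then have x: "x \<in> carrier R" using pts_subset by blast
      show "ypt (twist (\<alpha>, \<beta>) (f, g, h)) (Some x) ^ mult_at k p (Some x)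
          = M.yval (chi f x) (sgnr \<alpha> * chi g x) (sgnr \<beta> * chi h x) ^ mult_at k p (Some x)"
        by (simp only: ypt_twist_Some[OF ab m x])
    qed
    moreover have "(\<Prod>i<k. ypt (twist (\<alpha>, \<beta>) t) (p i)) = ypt (twist (\<alpha>, \<beta>) t) None ^ mult_at k p None *
        (\<Prod>x\<in>pts k p. ypt (twist (\<alpha>, \<beta>) t) (Some x) ^ mult_at k p (Some x))"
      by (rule prod_points[OF p])
    ultimately show "(\<Prod>i<k. ypt (twist (\<alpha>, \<beta>) t) (p i)) = w (sgnr \<alpha>) (sgnr \<beta>) ^ mult_at k p None *
          M.wt (pts k p) (M.ywt (\<lambda>x. mult_at k p (Some x)) (sgnr \<alpha>) (sgnr \<beta>)) t"
      by (simp only: w[OF ab t])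
  qed
  then show "(\<Sum>t\<in>M.sqtri a b c. \<Prod>i<k. ypt (twist (\<alpha>, \<beta>) t) (p i)) = w (sgnr \<alpha>) (sgnr \<beta>) ^ mult_at k p None *
        M.wsum {} (pts k p) a b c (M.ywt (\<lambda>x. mult_at k p (Some x)) (sgnr \<alpha>) (sgnr \<beta>))"
    unfolding M.wsum_def M.nonvan_def by (simp add: sum_distrib_left)
qed

text \<open>Here the parity conditions act. If the three degrees have the same parity, all pairwise
  products have even degree. Lowering one degree makes odd exactly the two products that involve
  this member, as if it had a zero at infinity.\<close>

lemma ypt_None_sqtri:
  assumes par: "even (n + n1)" "even (n + n2)" and ab: "\<alpha> \<in> nonzero" "\<beta> \<in> nonzero"
  shows "t \<in> M.sqtri n n1 n2 \<Longrightarrow> ypt (twist (\<alpha>, \<beta>) t) None = M.yval 1 (sgnr \<alpha>) (sgnr \<beta>)"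
    "t \<in> M.sqtri (n - 1) n1 n2 \<Longrightarrow> ypt (twist (\<alpha>, \<beta>) t) None = M.yval 0 (sgnr \<alpha>) (sgnr \<beta>)"
    "t \<in> M.sqtri n (n1 - 1) n2 \<Longrightarrow> ypt (twist (\<alpha>, \<beta>) t) None = M.yval 1 0 (sgnr \<beta>)"
    "t \<in> M.sqtri n n1 (n2 - 1) \<Longrightarrow> ypt (twist (\<alpha>, \<beta>) t) None = M.yval 1 (sgnr \<alpha>) 0"
proof -
  have D: "\<exists>f g h. t = (f, g, h) \<and> f \<in> monics \<and> g \<in> monics \<and> h \<in> monics
      \<and> int (degree f) = a \<and> int (degree g) = b \<and> int (degree h) = c" if "t \<in> M.sqtri a b c" for a b c
    using that by (cases t) (auto simp: M.sqtri_def M.tri_def carrier_monic_monoid_of pdeg_def)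
  have par': "even (n1 + n2)" using par by presburger
  have oddI: "odd (i + j) \<longleftrightarrow> odd (int i + int j)" for i j :: nat by (metis even_of_nat of_nat_add)
  show "ypt (twist (\<alpha>, \<beta>) t) None = M.yval 1 (sgnr \<alpha>) (sgnr \<beta>)" if "t \<in> M.sqtri n n1 n2"
  proof -
    from D[OF that] obtain f g h where t: "t = (f, g, h)" and m: "f \<in> monics" "g \<in> monics" "h \<in> monics"
      and d: "int (degree f) = n" "int (degree g) = n1" "int (degree h) = n2" by blast
    show ?thesis unfolding t ypt_twist_None[OF ab m] oddI d M.yval_def using par par' by simp
  qed
  show "ypt (twist (\<alpha>, \<beta>) t) None = M.yval 0 (sgnr \<alpha>) (sgnr \<beta>)" if "t \<in> M.sqtri (n - 1) n1 n2"
  proof -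
    from D[OF that] obtain f g h where t: "t = (f, g, h)" and m: "f \<in> monics" "g \<in> monics" "h \<in> monics"
      and d: "int (degree f) = n - 1" "int (degree g) = n1" "int (degree h) = n2" by blast
    have "odd (n - 1 + n1)" "odd (n - 1 + n2)" using par by presburger+
    then show ?thesis unfolding t ypt_twist_None[OF ab m] oddI d M.yval_def using par' by simp
  qed
  show "ypt (twist (\<alpha>, \<beta>) t) None = M.yval 1 0 (sgnr \<beta>)" if "t \<in> M.sqtri n (n1 - 1) n2"
  proof -
    from D[OF that] obtain f g h where t: "t = (f, g, h)" and m: "f \<in> monics" "g \<in> monics" "h \<in> monics"
      and d: "int (degree f) = n" "int (degree g) = n1 - 1" "int (degree h) = n2" by blast
    have "odd (n + (n1 - 1))" "odd (n1 - 1 + n2)" using par by presburger+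
    then show ?thesis unfolding t ypt_twist_None[OF ab m] oddI d M.yval_def using par by simp
  qed
  show "ypt (twist (\<alpha>, \<beta>) t) None = M.yval 1 (sgnr \<alpha>) 0" if "t \<in> M.sqtri n n1 (n2 - 1)"
  proof -
    from D[OF that] obtain f g h where t: "t = (f, g, h)" and m: "f \<in> monics" "g \<in> monics" "h \<in> monics"
      and d: "int (degree f) = n" "int (degree g) = n1" "int (degree h) = n2 - 1" by blast
    have "odd (n + (n2 - 1))" "odd (n1 + (n2 - 1))" using par by presburger+
    then show ?thesis unfolding t ypt_twist_None[OF ab m] oddI d M.yval_def using par by simp
  qed
qed

section \<open>Averages over the family\<close>

lemma finite_coprime_triples: "finite (coprime_triples R a b c)"
  by (rule finite_subset[OF _ finite_biquadratic_family[OF finite_carrier, of a b c]])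
    (auto simp: biquadratic_family_def)

lemma coprime_triples_disjoint:
  assumes "(a, b, c) \<noteq> (a', b', c')"
  shows "coprime_triples R a b c \<inter> coprime_triples R a' b' c' = {}"
  using assms by (auto simp: coprime_triples_def monic_sqfree_polys_def sqfree_polys_def)

lemma sum_biquadratic_family:
  fixes F :: "_ \<Rightarrow> real"
  shows "(\<Sum>T\<in>biquadratic_family R n n1 n2. F T) = (\<Sum>T\<in>coprime_triples R n n1 n2. F T)
    + (\<Sum>T\<in>coprime_triples R (n - 1) n1 n2. F T) + (\<Sum>T\<in>coprime_triples R n (n1 - 1) n2. F T)
    + (\<Sum>T\<in>coprime_triples R n n1 (n2 - 1). F T)"
proof -
  let ?A = "coprime_triples R n n1 n2" and ?B = "coprime_triples R (n - 1) n1 n2"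
    and ?C = "coprime_triples R n (n1 - 1) n2" and ?D = "coprime_triples R n n1 (n2 - 1)"
  have d: "?A \<inter> ?B = {}" "?A \<inter> ?C = {}" "?A \<inter> ?D = {}" "?B \<inter> ?C = {}" "?B \<inter> ?D = {}" "?C \<inter> ?D = {}"
    by (rule coprime_triples_disjoint, simp)+
  have "sum F (?A \<union> ?B \<union> ?C \<union> ?D) = sum F (?A \<union> ?B \<union> ?C) + sum F ?D"
    by (rule sum.union_disjoint) (use d finite_coprime_triples in blast)+
  also have "sum F (?A \<union> ?B \<union> ?C) = sum F (?A \<union> ?B) + sum F ?C"
    by (rule sum.union_disjoint) (use d finite_coprime_triples in blast)+
  also have "sum F (?A \<union> ?B) = sum F ?A + sum F ?B"
    by (rule sum.union_disjoint) (use d finite_coprime_triples in blast)+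
  finally show ?thesis unfolding biquadratic_family_def .
qed

text \<open>The leading coefficients of f1 and f2 enter through their characters only. The factor (q
  - 1)^2, the number of such pairs, cancels in the average.\<close>

lemma sum_family_ypt:
  assumes par: "even (n + n1)" "even (n + n2)" and p: "\<And>i. i < k \<Longrightarrow> p i \<in> proj_line R"
  shows "(\<Sum>T\<in>biquadratic_family R n n1 n2. \<Prod>i<k. ypt T (p i))
    = (real qq - 1)\<^sup>2 * M.famsum (pts k p) (\<lambda>x. mult_at k p (Some x)) (mult_at k p None) n n1 n2"
proof -
  let ?e = "mult_at k p None"
  let ?W = "\<lambda>a b c \<sigma> \<tau>. M.wsum {} (pts k p) a b c (M.ywt (\<lambda>x. mult_at k p (Some x)) \<sigma> \<tau>)"
  define F where "F \<sigma> \<tau> = M.yval 1 \<sigma> \<tau> ^ ?e * ?W n n1 n2 \<sigma> \<tau> + M.yval 0 \<sigma> \<tau> ^ ?e * ?W (n - 1) n1 n2 \<sigma> \<tau>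
    + M.yval 1 0 \<tau> ^ ?e * ?W n (n1 - 1) n2 \<sigma> \<tau> + M.yval 1 \<sigma> 0 ^ ?e * ?W n n1 (n2 - 1) \<sigma> \<tau>" for \<sigma> \<tau>
  note part = ypt_None_sqtri[OF par]
  have "(\<Sum>T\<in>biquadratic_family R n n1 n2. \<Prod>i<k. ypt T (p i))
      = (\<Sum>\<alpha>\<in>nonzero. \<Sum>\<beta>\<in>nonzero. F (sgnr \<alpha>) (sgnr \<beta>))"
    unfolding sum_biquadratic_family F_def sum.distrib
    by (intro arg_cong2[where f = "(+)"]) (rule sum_coprime_triples_ypt[OF p part(1)] sum_coprime_triples_ypt[OF p part(2)]
      sum_coprime_triples_ypt[OF p part(3)] sum_coprime_triples_ypt[OF p part(4)]; assumption)+
  also have "\<dots> = (\<Sum>\<alpha>\<in>nonzero. (real qq - 1) / 2 * (F (sgnr \<alpha>) 1 + F (sgnr \<alpha>) (-1)))"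
    by (simp only: sum_qc)
  also have "\<dots> = (real qq - 1) / 2 * ((real qq - 1) / 2 * (F 1 1 + F 1 (-1)) + (real qq - 1) / 2 * (F (-1) 1 + F (-1) (-1)))"
    by (rule sum_qc)
  also have "\<dots> = (real qq - 1)\<^sup>2 * ((F 1 1 + F 1 (-1) + F (-1) 1 + F (-1) (-1)) / 4)"
    by (simp add: power2_eq_square field_simps)
  also have "(F 1 1 + F 1 (-1) + F (-1) 1 + F (-1) (-1)) / 4
      = M.famsum (pts k p) (\<lambda>x. mult_at k p (Some x)) ?e n n1 n2"
    unfolding M.famsum_def F_def sum.cartesian_product[symmetric] by simp
  finally show ?thesis .
qed

lemma famsum_zero_eq: "M.famsum T (\<lambda>_. 0) 0 n n1 n2 = M.famsum {} (\<lambda>_. 0) 0 n n1 n2"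
  unfolding M.famsum_def M.wsum_def M.wt_def M.ywt_def by simp

text \<open>The case of empty tuples in \<open>sum_family_ypt\<close>. The set \<open>T\<close> is
  left free so that it can be matched with the one in the numerator.\<close>

lemma card_family:
  assumes par: "even (n + n1)" "even (n + n2)"
  shows "real (card (biquadratic_family R n n1 n2)) = (real qq - 1)\<^sup>2 * M.famsum T (\<lambda>_. 0) 0 n n1 n2"
proof -
  have "pts 0 undefined = {}" "mult_at 0 undefined z = 0" for z by (auto simp: pts_def mult_at_def)
  then show ?thesis
    using sum_family_ypt[OF par, of 0 undefined] famsum_zero_eq[of T n n1 n2] by simp
qed

lemma family_average_estimate:
  assumes eps: "0 < \<epsilon>" "\<epsilon> < 1" and par: "even (n + n1)" "even (n + n2)" and p: "\<And>i. i < k \<Longrightarrow> p i \<in> proj_line R"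
    and small: "4 * (tail_const \<epsilon>)\<^sup>2 * real qq powr (- ((1 - \<epsilon>) / 2) * real_of_int (min n (min n1 n2))) \<le> 1"
  shows "\<bar>(\<Sum>T\<in>biquadratic_family R n n1 n2. \<Prod>i<k. ypt T (p i)) / real (card (biquadratic_family R n n1 n2))
      - (\<Prod>z\<in>proj_line R. M.mom (mult_at k p z))\<bar>
    \<le> 32 * (tail_const \<epsilon>)\<^sup>2 * 4 ^ k * real qq powr (- ((1 - \<epsilon>) / 2) * (real_of_int (min n (min n1 n2)) - real k))"
proof -
  let ?T = "pts k p"
  let ?m = "min n (min n1 n2)"
  have nz: "(real qq - 1)\<^sup>2 \<noteq> 0" using card_ge_3 by simp
  have "(\<Prod>z\<in>proj_line R. M.mom (mult_at k p z)) = M.mom (mult_at k p None) * (\<Prod>x\<in>carrier R. M.mom (mult_at k p (Some x)))"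
    unfolding proj_line_def using finite_carrier by (simp add: prod.reindex)
  \<comment> \<open>Points that the tuple does not meet contribute \<open>mom 0\<close>, which is
    1.\<close>
  also have "(\<Prod>x\<in>carrier R. M.mom (mult_at k p (Some x))) = (\<Prod>x\<in>?T. M.mom (mult_at k p (Some x)))"
  proof (rule prod.mono_neutral_right[OF finite_carrier pts_subset], rule ballI)
    fix x assume "x \<in> carrier R - ?T"
    then have "mult_at k p (Some x) = 0" by (auto simp: pts_def mult_at_def)
    then show "M.mom (mult_at k p (Some x)) = 1" by (simp add: M.mom_0)
  qed
  finally have mu: "(\<Prod>z\<in>proj_line R. M.mom (mult_at k p z))
      = (\<Prod>x\<in>?T. M.mom (mult_at k p (Some x))) * M.mom (mult_at k p None)" by simp
  have avg: "(\<Sum>T\<in>biquadratic_family R n n1 n2. \<Prod>i<k. ypt T (p i)) / real (card (biquadratic_family R n n1 n2))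
      = M.famsum ?T (\<lambda>x. mult_at k p (Some x)) (mult_at k p None) n n1 n2 / M.famsum ?T (\<lambda>_. 0) 0 n n1 n2"
  proof -
    have s: "(\<Sum>T\<in>biquadratic_family R n n1 n2. \<Prod>i<k. ypt T (p i))
        = (real qq - 1)\<^sup>2 * M.famsum ?T (\<lambda>x. mult_at k p (Some x)) (mult_at k p None) n n1 n2"
      by (rule sum_family_ypt[OF par p])
    show ?thesis unfolding s card_family[OF par, of ?T] using nz by simp
  qed
  have "\<bar>(\<Sum>T\<in>biquadratic_family R n n1 n2. \<Prod>i<k. ypt T (p i)) / real (card (biquadratic_family R n n1 n2))
      - (\<Prod>z\<in>proj_line R. M.mom (mult_at k p z))\<bar>
    \<le> 32 * (tail_const \<epsilon>)\<^sup>2 * 4 ^ card ?T * real qq powr (- ((1 - \<epsilon>) / 2) * real_of_int (?m - int (card ?T)))"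
    unfolding avg mu by (rule M.famsum_ratio_estimate(2)[OF eps pts_subset small])
  \<comment> \<open>A tuple of length k meets at most k affine points; this makes the bound
    independent of \<open>p\<close>.\<close>
  also have "\<dots> \<le> 32 * (tail_const \<epsilon>)\<^sup>2 * 4 ^ k * real qq powr (- ((1 - \<epsilon>) / 2) * (real_of_int ?m - real k))"
  proof (intro mult_mono)
    show "(4::real) ^ card ?T \<le> 4 ^ k" using card_pts_le[of k p] by (intro power_increasing) auto
    have "(1 - \<epsilon>) / 2 * (real_of_int ?m - real k) \<le> (1 - \<epsilon>) / 2 * real_of_int (?m - int (card ?T))"
      using eps card_pts_le[of k p] by (intro mult_left_mono) auto
    then show "real qq powr (- ((1 - \<epsilon>) / 2) * real_of_int (?m - int (card ?T))) \<le> real qq powr (- ((1 - \<epsilon>) / 2) * (real_of_int ?m - real k))"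
      using card_ge_3 by (intro powr_mono) auto
  qed auto
  finally show ?thesis .
qed

end

section \<open>Moments\<close>

text \<open>The library version of the next lemma requires nonnegative factors.\<close>

lemma expectation_prod_Pi_pmf_finite_support:
  fixes f :: "'i \<Rightarrow> 'b \<Rightarrow> real"
  assumes A: "finite A" and S: "finite S" "\<And>x. x \<in> A \<Longrightarrow> set_pmf (p x) \<subseteq> S"
  shows "measure_pmf.expectation (Pi_pmf A d p) (\<lambda>y. \<Prod>x\<in>A. f x (y x))
    = (\<Prod>x\<in>A. measure_pmf.expectation (p x) (f x))"
proof -
  let ?D = "PiE_dflt A d (\<lambda>_. S)"
  let ?r = "\<lambda>g x. if x \<in> A then g x else d"
  have sub: "set_pmf (Pi_pmf A d p) \<subseteq> ?D"
    using S by (auto simp: set_Pi_pmf[OF A] PiE_dflt_def)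
  have img: "?D = ?r ` PiE A (\<lambda>_. S)"
  proof (intro equalityI subsetI)
    fix g assume g: "g \<in> ?D"
    then have "g = ?r (restrict g A)" by (auto simp: PiE_dflt_def fun_eq_iff)
    moreover have "restrict g A \<in> PiE A (\<lambda>_. S)" using g by (auto simp: PiE_dflt_def)
    ultimately show "g \<in> ?r ` PiE A (\<lambda>_. S)" by blast
  qed (auto simp: PiE_dflt_def)
  have inj: "inj_on ?r (PiE A (\<lambda>_. S))"
  proof (rule inj_onI)
    fix g h assume g: "g \<in> PiE A (\<lambda>_. S)" and h: "h \<in> PiE A (\<lambda>_. S)" and "?r g = ?r h"
    then have "g x = h x" if "x \<in> A" for x using that by (auto dest: fun_cong[of _ _ x])
    then show "g = h" using g h by (intro PiE_ext) auto
  qed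
  have "measure_pmf.expectation (Pi_pmf A d p) (\<lambda>y. \<Prod>x\<in>A. f x (y x))
      = (\<Sum>g\<in>?D. (\<Prod>x\<in>A. f x (g x)) * pmf (Pi_pmf A d p) g)"
    by (rule integral_measure_pmf_real) (use sub A S in auto)
  also have "\<dots> = (\<Sum>g\<in>PiE A (\<lambda>_. S). (\<Prod>x\<in>A. f x (?r g x)) * pmf (Pi_pmf A d p) (?r g))"
    unfolding img by (subst sum.reindex[OF inj]) simp
  also have "\<dots> = (\<Sum>g\<in>PiE A (\<lambda>_. S). \<Prod>x\<in>A. f x (g x) * pmf (p x) (g x))"
    by (intro sum.cong refl) (simp add: pmf_Pi[OF A] prod.distrib)
  also have "\<dots> = (\<Prod>x\<in>A. \<Sum>v\<in>S. f x v * pmf (p x) v)"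
    by (rule prod_sum_PiE[symmetric]) (use A S in auto)
  also have "\<dots> = (\<Prod>x\<in>A. measure_pmf.expectation (p x) (f x))"
    by (intro prod.cong refl integral_measure_pmf_real[symmetric]) (use S in auto)
  finally show ?thesis .
qed

lemma set_point_pmf: "set_pmf (point_pmf q) \<subseteq> {-1, 1, 3}"
proof -
  let ?xs = "[(- 1 :: real, 3 * (real q + 2) / (4 * (real q + 3))), (1, 6 / (4 * (real q + 3))),
    (3, real q / (4 * (real q + 3)))]"
  have "pmf_of_list_wf ?xs"
  proof (rule pmf_of_list_wfI)
    show "0 \<le> x" if "x \<in> set (map snd ?xs)" for x using that by auto
    have eq: "3 * (real q + 2) + (6 + real q) = 4 * (real q + 3)" by simp
    have ne: "4 * (real q + 3) \<noteq> 0" by (simp add: add_eq_0_iff)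
    have "sum_list (map snd ?xs) = (3 * (real q + 2) + (6 + real q)) / (4 * (real q + 3))"
      by (simp only: list.map snd_conv sum_list.Cons sum_list.Nil add_0_right add_divide_distrib)
    then show "sum_list (map snd ?xs) = 1" unfolding eq using ne by simp
  qed
  from set_pmf_of_list[OF this] show ?thesis by (simp add: point_pmf_def)
qed

lemma expectation_point_pmf_power:
  "measure_pmf.expectation (point_pmf q) (\<lambda>x. (x / 3) ^ e)
    = (real q + (3 * real q + 6) * (- 1 / 3) ^ e + 6 * (1 / 3) ^ e) / (4 * (real q + 3))"
proof -
  define s t where "s = (- 1 / 3 :: real) ^ e" and "t = (1 / 3 :: real) ^ e"
  have "measure_pmf.expectation (point_pmf q) (\<lambda>x. (x / 3) ^ e)
      = (\<Sum>x\<in>{-1, 1, 3}. (x / 3) ^ e * pmf (point_pmf q) x)"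
    by (rule integral_measure_pmf_real) (use set_point_pmf in auto)
  also have "\<dots> = s * pmf (point_pmf q) (-1) + t * pmf (point_pmf q) 1 + 1 * pmf (point_pmf q) 3"
    unfolding s_def t_def by simp
  also have "\<dots> = (real q + (3 * real q + 6) * s + 6 * t) / (4 * (real q + 3))"
    unfolding pmf_point_pmf by (simp add: add_divide_distrib algebra_simps)
  finally show ?thesis unfolding s_def t_def .
qed

lemma sum_power_PiE:
  fixes y :: "'b \<Rightarrow> 'c::comm_semiring_1"
  assumes "finite A"
  shows "(\<Sum>x\<in>A. y x) ^ k = (\<Sum>p\<in>PiE {..<k} (\<lambda>_. A). \<Prod>i<k. y (p i))"
  using prod_sum_PiE[of "{..<k}" "\<lambda>_. A" "\<lambda>_. y"] assms by simp

text \<open>The power is expanded over k-tuples exactly as will be done for the trace, so that the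
  two sides can be compared tuple by tuple. By independence every term is a product of moments of a
  single variable; the factor \<open>3 ^ k\<close> compensates for the scaling by 1/3.\<close>

lemma expectation_moment_expand:
  fixes c :: real
  shows "measure_pmf.expectation (Pi_pmf {1..q + 1} 0 (\<lambda>_. point_pmf q)) (\<lambda>x. (c * (\<Sum>i = 1..q + 1. x i)) ^ k)
    = (3 * c) ^ k * (\<Sum>p\<in>PiE {..<k} (\<lambda>_. {1..q + 1}). \<Prod>y\<in>{1..q + 1}.
        measure_pmf.expectation (point_pmf q) (\<lambda>x. (x / 3) ^ card {i \<in> {..<k}. p i = y}))"
proof -
  let ?A = "{1..q + 1}" and ?M = "Pi_pmf {1..q + 1} 0 (\<lambda>_. point_pmf q)"
  have fin: "finite (set_pmf ?M)"
  proof (rule finite_subset)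
    show "set_pmf ?M \<subseteq> PiE_dflt ?A 0 (\<lambda>_. {-1, 1, 3})"
      using set_point_pmf[of q] by (auto simp: set_Pi_pmf PiE_dflt_def)
  qed (rule finite_PiE_dflt; simp)
  have "(c * (\<Sum>i\<in>?A. x i)) ^ k = (3 * c) ^ k * (\<Sum>p\<in>PiE {..<k} (\<lambda>_. ?A). \<Prod>y\<in>?A. (x y / 3) ^ card {i \<in> {..<k}. p i = y})" for x :: "nat \<Rightarrow> real"
  proof -
    have "c * (\<Sum>i\<in>?A. x i) = (3 * c) * (\<Sum>i\<in>?A. x i / 3)" by (simp add: sum_divide_distrib[symmetric])
    then have "(c * (\<Sum>i\<in>?A. x i)) ^ k = (3 * c) ^ k * (\<Sum>i\<in>?A. x i / 3) ^ k"
      by (simp only: power_mult_distrib)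
    also have "(\<Sum>i\<in>?A. x i / 3) ^ k = (\<Sum>p\<in>PiE {..<k} (\<lambda>_. ?A). \<Prod>i<k. x (p i) / 3)"
      by (rule sum_power_PiE) simp
    also have "\<dots> = (\<Sum>p\<in>PiE {..<k} (\<lambda>_. ?A). \<Prod>y\<in>?A. (x y / 3) ^ card {i \<in> {..<k}. p i = y})"
      by (intro sum.cong refl prod_group_power) auto
    finally show ?thesis .
  qed
  then have "measure_pmf.expectation ?M (\<lambda>x. (c * (\<Sum>i\<in>?A. x i)) ^ k)
      = measure_pmf.expectation ?M (\<lambda>x. (3 * c) ^ k * (\<Sum>p\<in>PiE {..<k} (\<lambda>_. ?A). \<Prod>y\<in>?A. (x y / 3) ^ card {i \<in> {..<k}. p i = y}))"
    by (simp only:)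
  also have "\<dots> = (3 * c) ^ k * measure_pmf.expectation ?M (\<lambda>x. \<Sum>p\<in>PiE {..<k} (\<lambda>_. ?A). \<Prod>y\<in>?A. (x y / 3) ^ card {i \<in> {..<k}. p i = y})"
    by (rule integral_mult_right_zero)
  also have "measure_pmf.expectation ?M (\<lambda>x. \<Sum>p\<in>PiE {..<k} (\<lambda>_. ?A). \<Prod>y\<in>?A. (x y / 3) ^ card {i \<in> {..<k}. p i = y})
      = (\<Sum>p\<in>PiE {..<k} (\<lambda>_. ?A). measure_pmf.expectation ?M (\<lambda>x. \<Prod>y\<in>?A. (x y / 3) ^ card {i \<in> {..<k}. p i = y}))"
    by (rule Bochner_Integration.integral_sum) (rule integrable_measure_pmf_finite[OF fin])
  also have "\<dots> = (\<Sum>p\<in>PiE {..<k} (\<lambda>_. ?A). \<Prod>y\<in>?A.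
        measure_pmf.expectation (point_pmf q) (\<lambda>x. (x / 3) ^ card {i \<in> {..<k}. p i = y}))"
    by (intro sum.cong refl expectation_prod_Pi_pmf_finite_support[where S = "{-1, 1, 3}"]) (use set_point_pmf in auto)
  finally show ?thesis .
qed

context finite_odd_field
begin

section \<open>Comparison of the two moments\<close>

lemma abs_ypt_le: "\<bar>ypt T x\<bar> \<le> 1"
proof -
  obtain f f1 f2 where T: "T = (f, f1, f2)" by (cases T)
  have "\<bar>quadratic_char_at R F x\<bar> \<le> 1" for F
    unfolding quadratic_char_at_def quadratic_char_def by (cases x) auto
  from this[of "f \<otimes>\<^bsub>P\<^esub> f1"] this[of "f \<otimes>\<^bsub>P\<^esub> f2"] this[of "f1 \<otimes>\<^bsub>P\<^esub> f2"]
  have "\<bar>quadratic_char_at R (f \<otimes>\<^bsub>P\<^esub> f1) x + quadratic_char_at R (f \<otimes>\<^bsub>P\<^esub> f2) x + quadratic_char_at R (f1 \<otimes>\<^bsub>P\<^esub> f2) x\<bar> \<le> 3"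
    by linarith
  then have "\<bar>real_of_int (quadratic_char_at R (f \<otimes>\<^bsub>P\<^esub> f1) x + quadratic_char_at R (f \<otimes>\<^bsub>P\<^esub> f2) x + quadratic_char_at R (f1 \<otimes>\<^bsub>P\<^esub> f2) x)\<bar> \<le> 3"
    by linarith
  then show ?thesis unfolding T ypt_def prod.case by simp
qed

text \<open>Covers \<open>card B = 0\<close> as well, where the quotient is 0 by convention. It
  provides the trivial bound for small degrees.\<close>

lemma abs_family_average_le:
  "\<bar>(\<Sum>T\<in>B. \<Prod>i<k. ypt T (p i)) / real (card B)\<bar> \<le> 1"
proof -
  have "\<bar>\<Sum>T\<in>B. \<Prod>i<k. ypt T (p i)\<bar> \<le> (\<Sum>T\<in>B. 1)"
  proof (rule order_trans[OF sum_abs], rule sum_mono)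
    fix T show "\<bar>\<Prod>i<k. ypt T (p i)\<bar> \<le> 1"
      unfolding abs_prod using abs_ypt_le by (intro prod_le_1) auto
  qed
  then have "\<bar>\<Sum>T\<in>B. \<Prod>i<k. ypt T (p i)\<bar> \<le> real (card B)" by simp
  then show ?thesis by (cases "card B = 0") (auto simp: abs_divide divide_le_eq)
qed

text \<open>If the smallness condition of \<open>family_average_estimate\<close> fails, the
  right-hand side is at least 2, while both quantities compared lie between -1 and 1.\<close>

lemma family_average_bound:
  assumes eps: "0 < \<epsilon>" "\<epsilon> < 1" and par: "even (n + n1)" "even (n + n2)" and p: "\<And>i. i < k \<Longrightarrow> p i \<in> proj_line R"
  shows "\<bar>(\<Sum>T\<in>biquadratic_family R n n1 n2. \<Prod>i<k. ypt T (p i)) / real (card (biquadratic_family R n n1 n2))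
      - (\<Prod>z\<in>proj_line R. M.mom (mult_at k p z))\<bar>
    \<le> 32 * (tail_const \<epsilon>)\<^sup>2 * 4 ^ k * real qq powr (- ((1 - \<epsilon>) / 2) * (real_of_int (min n (min n1 n2)) - real k))"
proof (cases "4 * (tail_const \<epsilon>)\<^sup>2 * real qq powr (- ((1 - \<epsilon>) / 2) * real_of_int (min n (min n1 n2))) \<le> 1")
  case True
  then show ?thesis using family_average_estimate[OF eps par, of k p, OF p] by blast
next
  case False
  let ?m = "real_of_int (min n (min n1 n2))"
  have "\<bar>\<Prod>z\<in>proj_line R. M.mom (mult_at k p z)\<bar> \<le> 1"
    unfolding abs_prod using M.abs_mom_le by (intro prod_le_1) auto
  then have "\<bar>(\<Sum>T\<in>biquadratic_family R n n1 n2. \<Prod>i<k. ypt T (p i)) / real (card (biquadratic_family R n n1 n2))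
      - (\<Prod>z\<in>proj_line R. M.mom (mult_at k p z))\<bar> \<le> 2"
    using abs_family_average_le[where B = "biquadratic_family R n n1 n2" and k = k and p = p] by linarith
  also have "2 \<le> 8 * (tail_const \<epsilon>)\<^sup>2 * real qq powr (- ((1 - \<epsilon>) / 2) * ?m)" using False by simp
  also have "\<dots> \<le> (32 * (tail_const \<epsilon>)\<^sup>2 * 4 ^ k) * real qq powr (- ((1 - \<epsilon>) / 2) * (?m - real k))"
  proof (rule mult_mono)
    have "8 * (tail_const \<epsilon>)\<^sup>2 * 1 \<le> 32 * (tail_const \<epsilon>)\<^sup>2 * 4 ^ k"
      by (intro mult_mono one_le_power) auto
    then show "8 * (tail_const \<epsilon>)\<^sup>2 \<le> 32 * (tail_const \<epsilon>)\<^sup>2 * 4 ^ k" by simp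
    have "(1 - \<epsilon>) / 2 * (?m - real k) \<le> (1 - \<epsilon>) / 2 * ?m" using eps by (intro mult_left_mono) auto
    then show "real qq powr (- ((1 - \<epsilon>) / 2) * ?m) \<le> real qq powr (- ((1 - \<epsilon>) / 2) * (?m - real k))"
      using card_ge_3 by (intro powr_mono) auto
  qed auto
  finally show ?thesis .
qed

text \<open>The bijection \<open>h\<close> numbers the points of the projective line by the index
  set of the random variables, so that both moments become sums over the same tuples.\<close>

lemma trace_moment_expand:
  assumes h: "bij_betw h {1..qq + 1} (proj_line R)"
  shows "trace_moment k R n n1 n2 = (3 * (- (1 / sqrt (1 + real qq)))) ^ k *
    (\<Sum>p\<in>PiE {..<k} (\<lambda>_. {1..qq + 1}).
      (\<Sum>T\<in>biquadratic_family R (int n) (int n1) (int n2). \<Prod>i<k. ypt T (h (p i)))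
        / real (card (biquadratic_family R (int n) (int n1) (int n2))))"
proof -
  let ?B = "biquadratic_family R (int n) (int n1) (int n2)" and ?c = "3 * (- (1 / sqrt (1 + real qq)))"
  let ?A = "PiE {..<k} (\<lambda>_. {1..qq + 1})"
  have S: "(\<Sum>x\<in>proj_line R. ypt T x) = (\<Sum>y\<in>{1..qq + 1}. ypt T (h y))" for T
    by (rule sum.reindex_bij_betw[OF h, symmetric])
  have eq: "(\<lambda>(f, f1, f2). (real_of_int (frob_trace R f f1 f2) / sqrt (1 + real qq)) ^ k) T
      = ?c ^ k * (\<Sum>p\<in>?A. \<Prod>i<k. ypt T (h (p i)))" for T
  proof -
    obtain f f1 f2 where T: "T = (f, f1, f2)" by (cases T)
    have "real_of_int (frob_trace R f f1 f2) / sqrt (1 + real qq) = ?c * (\<Sum>y\<in>{1..qq + 1}. ypt T (h y))"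
      unfolding frob_trace_eq S[symmetric] T by (simp add: S_hat_eq_sum_ypt)
    then have "(real_of_int (frob_trace R f f1 f2) / sqrt (1 + real qq)) ^ k = ?c ^ k * (\<Sum>y\<in>{1..qq + 1}. ypt T (h y)) ^ k"
      by (simp only: power_mult_distrib)
    also have "(\<Sum>y\<in>{1..qq + 1}. ypt T (h y)) ^ k = (\<Sum>p\<in>?A. \<Prod>i<k. ypt T (h (p i)))"
      by (rule sum_power_PiE) simp
    finally show ?thesis unfolding T prod.case .
  qed
  have "trace_moment k R n n1 n2 = 1 / real (card ?B) * (\<Sum>T\<in>?B. ?c ^ k * (\<Sum>p\<in>?A. \<Prod>i<k. ypt T (h (p i))))"
    unfolding trace_moment_def by (intro arg_cong2[where f = "(*)"] refl sum.cong eq)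
  also have "\<dots> = ?c ^ k * ((\<Sum>T\<in>?B. \<Sum>p\<in>?A. \<Prod>i<k. ypt T (h (p i))) / real (card ?B))"
    by (simp add: sum_distrib_left[symmetric])
  also have "(\<Sum>T\<in>?B. \<Sum>p\<in>?A. \<Prod>i<k. ypt T (h (p i))) = (\<Sum>p\<in>?A. \<Sum>T\<in>?B. \<Prod>i<k. ypt T (h (p i)))"
    by (rule sum.swap)
  finally show ?thesis by (simp only: sum_divide_distrib)
qed

lemma trace_moment_estimate:
  assumes eps: "0 < \<epsilon>" "\<epsilon> < 1" and par: "even (n + n1)" "even (n + n2)"
  shows "\<bar>trace_moment k R n n1 n2
     - measure_pmf.expectation (Pi_pmf {1..qq + 1} 0 (\<lambda>_. point_pmf qq))
         (\<lambda>x. (- (1 / sqrt (1 + real qq)) * (\<Sum>i = 1..qq + 1. x i)) ^ k)\<bar>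
    \<le> 32 * 24 ^ k * (tail_const \<epsilon>)\<^sup>2 * real qq powr (- ((1 - \<epsilon>) / 2) * real (min n (min n1 n2)) + real k)"
proof -
  have "card (proj_line R) = Suc qq"
    unfolding proj_line_def using finite_carrier by (simp add: card_image)
  then have "card {1..qq + 1} = card (proj_line R)" by simp
  then obtain h where h: "bij_betw h {1..qq + 1} (proj_line R)"
    using finite_same_card_bij[of "{1..qq + 1}" "proj_line R"] finite_carrier by (auto simp: proj_line_def)
  let ?B = "biquadratic_family R (int n) (int n1) (int n2)" and ?c = "3 * (- (1 / sqrt (1 + real qq)))"
  let ?A = "PiE {..<k} (\<lambda>_. {1..qq + 1})"
  let ?m = "real (min n (min n1 n2))"
  define av where "av p = (\<Sum>T\<in>?B. \<Prod>i<k. ypt T (h (p i))) / real (card ?B)" for p :: "nat \<Rightarrow> nat"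
  define mu where "mu p = (\<Prod>y\<in>{1..qq + 1}. measure_pmf.expectation (point_pmf qq) (\<lambda>x. (x / 3) ^ card {i \<in> {..<k}. p i = y}))"
    for p :: "nat \<Rightarrow> nat"
  define b where "b = 32 * (tail_const \<epsilon>)\<^sup>2 * 4 ^ k * real qq powr (- ((1 - \<epsilon>) / 2) * (?m - real k))"
  have term_le: "\<bar>av p - mu p\<bar> \<le> b" if p: "p \<in> ?A" for p
  proof -
    have "mu p = (\<Prod>y\<in>{1..qq + 1}. M.mom (card {i \<in> {..<k}. p i = y}))"
      unfolding mu_def expectation_point_pmf_power M.mom_def ..
    also have "\<dots> = (\<Prod>y\<in>{1..qq + 1}. M.mom (mult_at k (\<lambda>i. h (p i)) (h y)))"
    proof (intro prod.cong refl arg_cong[where f = M.mom])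
      fix y assume y: "y \<in> {1..qq + 1}"
      have "h (p i) = h y \<longleftrightarrow> p i = y" if "i < k" for i
        using bij_betw_imp_inj_on[OF h] y p that by (auto simp: inj_on_def PiE_iff)
      then show "card {i \<in> {..<k}. p i = y} = mult_at k (\<lambda>i. h (p i)) (h y)"
        unfolding mult_at_def by (intro arg_cong[where f = card]) auto
    qed
    also have "\<dots> = (\<Prod>z\<in>proj_line R. M.mom (mult_at k (\<lambda>i. h (p i)) z))"
      by (rule prod.reindex_bij_betw[OF h])
    finally have mu: "mu p = \<dots>" .
    have pr: "h (p i) \<in> proj_line R" if "i < k" for i
    proof -
      have "p i \<in> {1..qq + 1}" using p that by (auto simp: PiE_iff)
      then show ?thesis using bij_betw_apply[OF h] by blast
    qed
    have par': "even (int n + int n1)" "even (int n + int n2)" using par by presburger+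
    have min: "real_of_int (min (int n) (min (int n1) (int n2))) = ?m" by (simp add: min_def)
    show ?thesis
      using family_average_bound[OF eps par', of k "\<lambda>i. h (p i)", OF pr] unfolding mu av_def b_def min by simp
  qed
  have "trace_moment k R n n1 n2
     - measure_pmf.expectation (Pi_pmf {1..qq + 1} 0 (\<lambda>_. point_pmf qq))
         (\<lambda>x. (- (1 / sqrt (1 + real qq)) * (\<Sum>i = 1..qq + 1. x i)) ^ k)
     = ?c ^ k * (\<Sum>p\<in>?A. av p - mu p)"
    unfolding trace_moment_expand[OF h] expectation_moment_expand av_def mu_def
    by (simp only: sum_subtractf right_diff_distrib)
  then have "\<bar>trace_moment k R n n1 n2
     - measure_pmf.expectation (Pi_pmf {1..qq + 1} 0 (\<lambda>_. point_pmf qq))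
         (\<lambda>x. (- (1 / sqrt (1 + real qq)) * (\<Sum>i = 1..qq + 1. x i)) ^ k)\<bar>
     = (3 / sqrt (1 + real qq)) ^ k * \<bar>\<Sum>p\<in>?A. av p - mu p\<bar>"
    by (simp add: abs_mult power_abs)
  \<comment> \<open>There are (q + 1)^k tuples, each with error at most \<open>b\<close>, against
    the normalisation (q + 1)^(-k/2).\<close>
  also have "\<dots> \<le> (3 / sqrt (1 + real qq)) ^ k * ((1 + real qq) ^ k * b)"
  proof (rule mult_left_mono)
    have "\<bar>\<Sum>p\<in>?A. av p - mu p\<bar> \<le> (\<Sum>p\<in>?A. b)"
      by (rule order_trans[OF sum_abs]) (intro sum_mono term_le)
    also have "\<dots> = (1 + real qq) ^ k * b" by (simp add: card_PiE add.commute)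
    finally show "\<bar>\<Sum>p\<in>?A. av p - mu p\<bar> \<le> (1 + real qq) ^ k * b" .
  qed simp
  also have "\<dots> = (3 * sqrt (1 + real qq)) ^ k * b"
  proof -
    have "3 / sqrt (1 + real qq) * (1 + real qq) = 3 * sqrt (1 + real qq)"
      by (simp add: real_div_sqrt field_simps)
    then have "(3 / sqrt (1 + real qq)) ^ k * (1 + real qq) ^ k = (3 * sqrt (1 + real qq)) ^ k"
      unfolding power_mult_distrib[symmetric] by simp
    then show ?thesis by simp
  qed
  also have "\<dots> \<le> (6 ^ k * real qq powr (real k / 2)) * b"
  proof (rule mult_right_mono)
    \<comment> \<open>Passing from q + 1 to q costs a factor 2 per point; together with the 3 this
      is the 6 which, with the 4 in \<open>b\<close>, makes 24.\<close>
    have "sqrt (1 + real qq) \<le> sqrt (4 * real qq)" using card_ge_3 by (intro real_sqrt_le_mono) simp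
    also have "\<dots> = 2 * real qq powr (1 / 2)" by (simp add: real_sqrt_mult powr_half_sqrt)
    finally have "(3 * sqrt (1 + real qq)) ^ k \<le> (6 * real qq powr (1 / 2)) ^ k" by (intro power_mono) auto
    also have "\<dots> = 6 ^ k * real qq powr (real k / 2)"
      using card_ge_3 by (simp add: power_mult_distrib powr_realpow[symmetric] powr_powr)
    finally show "(3 * sqrt (1 + real qq)) ^ k \<le> 6 ^ k * real qq powr (real k / 2)" .
    show "0 \<le> b" by (simp add: b_def)
  qed
  also have "\<dots> = 32 * 24 ^ k * (tail_const \<epsilon>)\<^sup>2 * real qq powr (real k / 2 + - ((1 - \<epsilon>) / 2) * (?m - real k))"
    unfolding b_def powr_add by (simp add: power_mult_distrib[symmetric])
  \<comment> \<open>The tuples contribute k / 2 to the exponent and the points (1 - \<epsilon>) k /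
    2, together at most k.\<close>
  also have "\<dots> \<le> 32 * 24 ^ k * (tail_const \<epsilon>)\<^sup>2 * real qq powr (- ((1 - \<epsilon>) / 2) * ?m + real k)"
  proof (rule mult_left_mono)
    have "\<epsilon> * real k \<ge> 0" using eps by simp
    then have "real k / 2 + - ((1 - \<epsilon>) / 2) * (?m - real k) \<le> - ((1 - \<epsilon>) / 2) * ?m + real k"
      by (simp add: field_simps)
    then show "real qq powr (real k / 2 + - ((1 - \<epsilon>) / 2) * (?m - real k)) \<le> real qq powr (- ((1 - \<epsilon>) / 2) * ?m + real k)"
      using card_ge_3 by (intro powr_mono) auto
  qed simp
  finally show ?thesis .
qed

end

theorem theorem5p1:
  fixes k :: nat and \<epsilon> :: real
  assumes "k \<ge> 1" and "0 < \<epsilon>" and "\<epsilon> < 1"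
  shows "\<exists>C::real. \<forall>(R :: 'a ring) (q::nat) (n::nat) (n1::nat) (n2::nat).
    field R \<and> finite (carrier R) \<and> card (carrier R) = q \<and> odd q \<and>
    even (n + n1) \<and> even (n + n2) \<longrightarrow>
    \<bar>trace_moment k R n n1 n2
       - measure_pmf.expectation (Pi_pmf {1..q + 1} 0 (\<lambda>_. point_pmf q))
           (\<lambda>x. (- (1 / sqrt (1 + real q)) * (\<Sum>i = 1..q + 1. x i)) ^ k)\<bar>
    \<le> C * real q powr (- ((1 - \<epsilon>) / 2) * real (min n (min n1 n2)) + real k)"
proof (intro exI[of _ "32 * 24 ^ k * (tail_const \<epsilon>)\<^sup>2"] allI impI, elim conjE)
  fix R :: "'a ring" and q n n1 n2 :: nat
  assume "field R" "finite (carrier R)" "card (carrier R) = q" "odd q" and par: "even (n + n1)" "even (n + n2)"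
  then have "finite_odd_field R" by (simp add: finite_odd_field_def finite_odd_field_axioms_def)
  from finite_odd_field.trace_moment_estimate[OF this assms(2,3) par, of k]
  show "\<bar>trace_moment k R n n1 n2
       - measure_pmf.expectation (Pi_pmf {1..q + 1} 0 (\<lambda>_. point_pmf q))
           (\<lambda>x. (- (1 / sqrt (1 + real q)) * (\<Sum>i = 1..q + 1. x i)) ^ k)\<bar>
    \<le> 32 * 24 ^ k * (tail_const \<epsilon>)\<^sup>2 * real q powr (- ((1 - \<epsilon>) / 2) * real (min n (min n1 n2)) + real k)"
    using \<open>card (carrier R) = q\<close> by simp
qed

end
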